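(* Let $\Omega$ be either $\mathbb{R}^3$, $\mathbb{T}^3$ or a bounded regular domain of $\mathbb{R}^3$. Let $T^*\in(0,\infty]$. Assume that for some $s>9/2$ and every $T<T^*$, $u\in C^0(0,T;H^s(\Omega))\cap C^1(0,T;H^{s-1}(\Omega))$, and that $u$ is a solution on $[0,T^* )\times\Omega$ to the incompressible Euler equation with, in the presence of a boundary, the impermeability condition $u\cdot\mathbf{n}=0$ on $\partial\Omega$. Let $\omega=\mathrm{curl}\,u$ and $\omega^0=\omega(0,\cdot)$, with $\omega^0\not\equiv0$. Then, for every $T\in[0,T^* )$, $$\frac{1}{\sqrt{\|\omega^0\|_{L^\infty(\Omega)}}}\ \sup_{x\in\Omega}\sqrt{|\omega(T,x)|}\;\le\;\beta(T),$$ where $\beta(T)$ is the growth of the amplitude in the bicharacteristic-amplitude equations associated with $u$, as defined in the context.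
   Context: The incompressible Euler equation is $\partial_t u+(u\cdot\nabla)u+\nabla P=0$, $\mathrm{div}\,u=0$ in $\Omega$; $\mathbf{n}$ is the normal of $\partial\Omega$. $C^k(0,T;X)$ denotes $C^k$ functions on $[0,T]$ with values in $X$. Bicharacteristic-amplitude equations: for initial values $x_0\in\Omega$, $\xi_0\in\mathbb{R}^3\setminus\{0\}$, $b_0\in\mathbb{R}^3$, let $(\gamma_t,\xi_t,b_t)=(\gamma_t(x_0),\xi_t(x_0,\xi_0),b_t(x_0,\xi_0,b_0))$ be the solution of the ODE system in $t$ $$\dot\gamma_t=u(t,\gamma_t),\qquad \dot\xi_t=-(\partial_x u)^T\xi_t,\qquad \dot b_t=-(\partial_x u)b_t+2\,\frac{\xi_t^T(\partial_x u)b_t}{|\xi_t|^2}\,\xi_t,$$ with value $(x_0,\xi_0,b_0)$ at $t=0$, where $(\partial_x u)$ is the matrix $(\partial_x u)_{ij}=\partial_j u_i(t,\gamma_t)$. Define $$\beta(T)=\sup\{|b_T(x_0,\xi_0,b_0)|:\ x_0\in\Omega,\ |b_0|=1,\ |\xi_0|=1,\ b_0\cdot\xi_0=0\}.$$ *)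

theory Defs
  imports "HOL-Probability.Probability"
begin

section \<open>Smooth functions and fluid domains\<close>

text \<open>To be used on open sets: \<open>C^k\<close> by iterating directional derivatives.\<close>

primrec Ck_on :: "nat \<Rightarrow> 'a::real_normed_vector set \<Rightarrow> ('a \<Rightarrow> 'b::real_normed_vector) \<Rightarrow> bool" where
  "Ck_on 0 S f \<longleftrightarrow> continuous_on S f"
| "Ck_on (Suc k) S f \<longleftrightarrow> (\<forall>x\<in>S. f differentiable (at x)) \<and>
     (\<forall>v. Ck_on k S (\<lambda>x. frechet_derivative f (at x) v))"

definition smooth_on :: "'a::real_normed_vector set \<Rightarrow> ('a \<Rightarrow> 'b::real_normed_vector) \<Rightarrow> bool" where
  "smooth_on S f \<longleftrightarrow> (\<forall>k. Ck_on k S f)"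

definition test_function :: "(real^3) set \<Rightarrow> (real^3 \<Rightarrow> real) \<Rightarrow> bool" where
  "test_function D \<phi> \<longleftrightarrow> smooth_on UNIV \<phi> \<and>
     (\<exists>K. compact K \<and> K \<subseteq> D \<and> (\<forall>x. x \<notin> K \<longrightarrow> \<phi> x = 0))"

definition local_defining_function :: "(real^3) set \<Rightarrow> real^3 \<Rightarrow> (real^3 \<Rightarrow> real) \<Rightarrow> bool" where
  "local_defining_function U p \<rho> \<longleftrightarrow>
     (\<exists>V. open V \<and> p \<in> V \<and> smooth_on V \<rho> \<and> (\<forall>x\<in>V. \<not> (GDERIV \<rho> x :> 0)) \<and>
          U \<inter> V = {x \<in> V. \<rho> x < 0})"

definition bounded_regular_domain :: "(real^3) set \<Rightarrow> bool" where
  "bounded_regular_domain U \<longleftrightarrow> open U \<and> connected U \<and> bounded U \<and> U \<noteq> {} \<and>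
     (\<forall>p\<in>frontier U. \<exists>\<rho>. local_defining_function U p \<rho>)"

definition outward_unit_normal :: "(real^3) set \<Rightarrow> real^3 \<Rightarrow> real^3 \<Rightarrow> bool" where
  "outward_unit_normal U p n \<longleftrightarrow>
     (\<exists>\<rho> D. local_defining_function U p \<rho> \<and> (GDERIV \<rho> p :> D) \<and> n = D /\<^sub>R norm D)"

text \<open>The torus is \<open>(\<real> / 2\<pi>\<int>)^3\<close>; functions on it are functions on \<open>\<real>^3\<close> that are
  \<open>2\<pi>\<close>-periodic in each variable. A function on a bounded domain is a total function whose values
  outside the domain (or its closure) are never used.\<close>

datatype fluid_domain = Whole_Space | Flat_Torus | Bounded_Domain "(real^3) set"

fun region :: "fluid_domain \<Rightarrow> (real^3) set" where
  "region (Bounded_Domain U) = U"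
| "region Whole_Space = UNIV"
| "region Flat_Torus = UNIV"

fun admissible_domain :: "fluid_domain \<Rightarrow> bool" where
  "admissible_domain (Bounded_Domain U) \<longleftrightarrow> bounded_regular_domain U"
| "admissible_domain Whole_Space \<longleftrightarrow> True"
| "admissible_domain Flat_Torus \<longleftrightarrow> True"

definition periodic :: "(real^3 \<Rightarrow> 'b) \<Rightarrow> bool" where
  "periodic f \<longleftrightarrow> (\<forall>x i. f (x + (2 * pi) *\<^sub>R axis i 1) = f x)"

section \<open>Sobolev spaces\<close>

text \<open>Frequencies carry Lebesgue measure, respectively counting measure on the dual lattice
  \<open>\<int>^3\<close> of the torus. Up to the factor \<open>(2\<pi>)^3\<close>, which only rescales the norm, \<open>f\<close> being
  synthesised by \<open>g\<close> means that \<open>g\<close> is the Fourier transform, or the sequence of Fourier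
  coefficients, of \<open>f\<close>; for a bounded domain it is the Fourier transform of an extension of \<open>f\<close>.
  The identity \<open>f(x) = \<integral> g(\<xi>) exp(i \<xi>\<cdot>x) d\<xi>\<close> is understood in the sense of distributions
  on the region. Hence \<open>H^s\<close> is defined through the Fourier transform on \<open>\<real>^3\<close>, through Fourier
  series on the torus, and by restriction, with the quotient norm, on a bounded domain.
  These definitions are meant for \<open>s \<ge> 0\<close>.\<close>

fun frequency_measure :: "fluid_domain \<Rightarrow> (real^3) measure" where
  "frequency_measure Flat_Torus = count_space {k. \<forall>i. k $ i \<in> \<int>}"
| "frequency_measure Whole_Space = lborel"
| "frequency_measure (Bounded_Domain U) = lborel"

definition fourier_integral :: "(real^3 \<Rightarrow> real) \<Rightarrow> real^3 \<Rightarrow> complex" where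
  "fourier_integral \<phi> \<xi> = (\<integral>x. cis (\<xi> \<bullet> x) * complex_of_real (\<phi> x) \<partial>lborel)"

definition locally_integrable_on :: "(real^3) set \<Rightarrow> (real^3 \<Rightarrow> real) \<Rightarrow> bool" where
  "locally_integrable_on D f \<longleftrightarrow> (\<forall>K. compact K \<and> K \<subseteq> D \<longrightarrow> set_integrable lborel K f)"

definition synthesised_by :: "fluid_domain \<Rightarrow> (real^3 \<Rightarrow> real) \<Rightarrow> (real^3 \<Rightarrow> complex) \<Rightarrow> bool" where
  "synthesised_by \<Omega> f g \<longleftrightarrow> (\<forall>\<phi>. test_function (region \<Omega>) \<phi> \<longrightarrow>
     complex_of_real (\<integral>x. f x * \<phi> x \<partial>lborel) =
     (\<integral>\<xi>. g \<xi> * fourier_integral \<phi> \<xi> \<partial>frequency_measure \<Omega>))"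

definition Hs_symbol :: "fluid_domain \<Rightarrow> real \<Rightarrow> (real^3 \<Rightarrow> real) \<Rightarrow> (real^3 \<Rightarrow> complex) \<Rightarrow> bool" where
  "Hs_symbol \<Omega> s f g \<longleftrightarrow> g \<in> borel_measurable (frequency_measure \<Omega>) \<and>
     integrable (frequency_measure \<Omega>) (\<lambda>\<xi>. (1 + (norm \<xi>)\<^sup>2) powr s * (cmod (g \<xi>))\<^sup>2) \<and>
     synthesised_by \<Omega> f g"

definition in_Hs :: "fluid_domain \<Rightarrow> real \<Rightarrow> (real^3 \<Rightarrow> real) \<Rightarrow> bool" where
  "in_Hs \<Omega> s f \<longleftrightarrow> locally_integrable_on (region \<Omega>) f \<and> (\<exists>g. Hs_symbol \<Omega> s f g)"

definition Hs_norm :: "fluid_domain \<Rightarrow> real \<Rightarrow> (real^3 \<Rightarrow> real) \<Rightarrow> real" where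
  "Hs_norm \<Omega> s f = Inf {sqrt (\<integral>\<xi>. (1 + (norm \<xi>)\<^sup>2) powr s * (cmod (g \<xi>))\<^sup>2 \<partial>frequency_measure \<Omega>)
     | g. Hs_symbol \<Omega> s f g}"

definition in_Hs_vec :: "fluid_domain \<Rightarrow> real \<Rightarrow> (real^3 \<Rightarrow> real^3) \<Rightarrow> bool" where
  "in_Hs_vec \<Omega> s f \<longleftrightarrow> (\<forall>i. in_Hs \<Omega> s (\<lambda>x. f x $ i))"

definition Hs_norm_vec :: "fluid_domain \<Rightarrow> real \<Rightarrow> (real^3 \<Rightarrow> real^3) \<Rightarrow> real" where
  "Hs_norm_vec \<Omega> s f = L2_set (\<lambda>i. Hs_norm \<Omega> s (\<lambda>x. f x $ i)) UNIV"

definition C0_Hs :: "real set \<Rightarrow> fluid_domain \<Rightarrow> real \<Rightarrow> (real \<Rightarrow> real^3 \<Rightarrow> real^3) \<Rightarrow> bool" where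
  "C0_Hs I \<Omega> s u \<longleftrightarrow> (\<forall>t\<in>I. in_Hs_vec \<Omega> s (u t) \<and>
     ((\<lambda>\<tau>. Hs_norm_vec \<Omega> s (\<lambda>x. u \<tau> x - u t x)) \<longlongrightarrow> 0) (at t within I))"

definition C1_Hs :: "real set \<Rightarrow> fluid_domain \<Rightarrow> real \<Rightarrow> (real \<Rightarrow> real^3 \<Rightarrow> real^3) \<Rightarrow> bool" where
  "C1_Hs I \<Omega> s u \<longleftrightarrow> C0_Hs I \<Omega> s u \<and> (\<exists>v. C0_Hs I \<Omega> s v \<and>
     (\<forall>t\<in>I. ((\<lambda>\<tau>. Hs_norm_vec \<Omega> s (\<lambda>x. (u \<tau> x - u t x) /\<^sub>R (\<tau> - t) - v t x)) \<longlongrightarrow> 0)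
       (at t within I)))"

section \<open>The Euler equation\<close>

text \<open>An element of \<open>H^s\<close> with \<open>s > 3/2\<close> is represented by the function that is continuous up to
  the boundary.\<close>

definition continuous_representative :: "fluid_domain \<Rightarrow> (real^3 \<Rightarrow> real^3) \<Rightarrow> bool" where
  "continuous_representative \<Omega> f \<longleftrightarrow> continuous_on (closure (region \<Omega>)) f \<and>
     (\<Omega> = Flat_Torus \<longrightarrow> periodic f)"

definition lifespan :: "ereal \<Rightarrow> real set" where
  "lifespan Tstar = {t. 0 \<le> t \<and> ereal t < Tstar}"

definition vel_grad :: "(real \<Rightarrow> real^3 \<Rightarrow> real^3) \<Rightarrow> real \<Rightarrow> real^3 \<Rightarrow> real^3^3" where
  "vel_grad u t x = jacobian (u t) (at x)"

definition vorticity :: "(real \<Rightarrow> real^3 \<Rightarrow> real^3) \<Rightarrow> real \<Rightarrow> real^3 \<Rightarrow> real^3" where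
  "vorticity u t x = (let A = vel_grad u t x in
     vector [A$3$2 - A$2$3, A$1$3 - A$3$1, A$2$1 - A$1$2])"

definition euler_solution ::
  "fluid_domain \<Rightarrow> ereal \<Rightarrow> (real \<Rightarrow> real^3 \<Rightarrow> real^3) \<Rightarrow> (real \<Rightarrow> real^3 \<Rightarrow> real) \<Rightarrow> bool" where
  "euler_solution \<Omega> Tstar u P \<longleftrightarrow>
     (\<forall>t\<in>lifespan Tstar.
        (\<Omega> = Flat_Torus \<longrightarrow> periodic (P t)) \<and>
        (\<forall>x\<in>region \<Omega>. u t differentiable (at x) \<and> trace (vel_grad u t x) = 0 \<and>
           (\<exists>gradP. (GDERIV (P t) x :> gradP) \<and>
              ((\<lambda>\<tau>. u \<tau> x) has_vector_derivative - (vel_grad u t x *v u t x) - gradP)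
                (at t within lifespan Tstar))))"

fun impermeable :: "fluid_domain \<Rightarrow> (real^3 \<Rightarrow> real^3) \<Rightarrow> bool" where
  "impermeable (Bounded_Domain U) f \<longleftrightarrow>
     (\<forall>p\<in>frontier U. \<forall>n. outward_unit_normal U p n \<longrightarrow> f p \<bullet> n = 0)"
| "impermeable Whole_Space f \<longleftrightarrow> True"
| "impermeable Flat_Torus f \<longleftrightarrow> True"

definition Linf_norm :: "fluid_domain \<Rightarrow> (real^3 \<Rightarrow> real^3) \<Rightarrow> real" where
  "Linf_norm \<Omega> f = real_of_ereal (esssup (restrict_space lborel (region \<Omega>)) (\<lambda>x. ereal (norm (f x))))"

section \<open>The bicharacteristic-amplitude equations\<close>

definition bichar_amplitude_solution ::
  "fluid_domain \<Rightarrow> (real \<Rightarrow> real^3 \<Rightarrow> real^3) \<Rightarrow> real \<Rightarrow>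
   (real \<Rightarrow> real^3) \<Rightarrow> (real \<Rightarrow> real^3) \<Rightarrow> (real \<Rightarrow> real^3) \<Rightarrow> bool" where
  "bichar_amplitude_solution \<Omega> u T \<gamma> \<xi> b \<longleftrightarrow>
     (\<forall>t\<in>{0..T}. \<gamma> t \<in> region \<Omega> \<and>
       (let A = vel_grad u t (\<gamma> t) in
         (\<gamma> has_vector_derivative u t (\<gamma> t)) (at t within {0..T}) \<and>
         (\<xi> has_vector_derivative - (transpose A *v \<xi> t)) (at t within {0..T}) \<and>
         (b has_vector_derivative
            - (A *v b t) + (2 * (\<xi> t \<bullet> (A *v b t)) / (norm (\<xi> t))\<^sup>2) *\<^sub>R \<xi> t) (at t within {0..T})))"

definition amplitude_growth :: "fluid_domain \<Rightarrow> (real \<Rightarrow> real^3 \<Rightarrow> real^3) \<Rightarrow> real \<Rightarrow> ereal" where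
  "amplitude_growth \<Omega> u T = Sup {ereal (norm (b T)) | \<gamma> \<xi> b.
     bichar_amplitude_solution \<Omega> u T \<gamma> \<xi> b \<and>
     norm (b 0) = 1 \<and> norm (\<xi> 0) = 1 \<and> b 0 \<bullet> \<xi> 0 = 0}"

end

theory Submission
  imports Defs
begin

text \<open>Along a trajectory of \<open>u\<close>, with \<open>A\<close> the velocity gradient, the vorticity solves
  \<open>\<omega>' = A \<omega>\<close> and the covector \<open>\<xi>' = - A\<^sup>T \<xi>\<close>, so \<open>\<omega> \<bullet> \<xi>\<close> is conserved. The amplitude equation
  conserves \<open>b \<bullet> \<xi>\<close> and, for two amplitudes \<open>b\<close>, \<open>b'\<close> orthogonal to \<open>\<xi>\<close>, the determinant of
  \<open>b\<close>, \<open>b'\<close>, \<open>\<xi>\<close>: starting from an orthonormal frame, \<open>1 \<le> \<bar>b\<bar> \<bar>b'\<bar> \<bar>\<xi>\<bar>\<close> at time \<open>T\<close>. Given a point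
  \<open>x\<close>, follow the trajectory backwards from \<open>x\<close> and choose \<open>\<xi>\<close> so that \<open>\<xi>(T)\<close> is parallel to
  \<open>\<omega>(T, x)\<close> and \<open>\<bar>\<xi>(0)\<bar> = 1\<close>. Then \<open>\<bar>\<omega>(T, x)\<bar> \<bar>\<xi>(T)\<bar> \<le> \<bar>\<omega>\<^sup>0\<bar>\<close>, so the larger of the two
  amplitudes satisfies \<open>\<bar>\<omega>(T, x)\<bar> \<le> \<bar>\<omega>\<^sup>0\<bar> \<bar>b(T)\<bar>\<^sup>2\<close>. The regularity behind this comes from the
  inversion formula: \<open>s > 9/2\<close> makes three moments of the symbol of \<open>u\<close> finite, two for \<open>\<partial>\<^sub>t u\<close>.\<close>

section \<open>Test functions and the fundamental lemma of the calculus of variations\<close>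

text \<open>The size of \<open>\<xi> T\<close> enters with two opposite effects. A small
  \<open>\<xi> T\<close> lets the vorticity grow, but conservation of the determinant then forces
  the two amplitudes to be large; multiplying the two inequalities cancels
  \<open>norm (\<xi> T)\<close>, and the square root in the claim comes from bounding a product of
  two amplitudes by the square of the larger one. The analytic obstacle is that on a bounded domain
  everything is known inside the region only. Symbols belong to unspecified extensions, so they
  determine values only through test functions supported in the region; and there is no trajectory
  through \<open>x\<close> until \<open>u\<close> has been extended to a Lipschitz field on the
  whole space. Impermeability keeps the solution of the extended equation inside, by a Gronwall
  argument for a defining function of the boundary. The second obstacle is the pressure, of which
  only the gradient is given. The Euler equation expresses this gradient by fields already known to
  be differentiable, and the symmetry of the Hessian is proved from differentiability of the
  gradient at a single point.\<close>

definition flat :: "nat \<Rightarrow> real \<Rightarrow> real" where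
  "flat m t = (if t \<le> 0 then 0 else exp (- 1 / t) / t ^ m)"

text \<open>The term of index \<open>m + 2\<close> in the exponential series of 1/t already
  dominates t^-m with two powers of t to spare, which is what a vanishing derivative at 0
  requires.\<close>

lemma flat_bound:
  assumes "t > 0"
  shows "\<bar>flat m t\<bar> \<le> fact (m + 2) * t ^ 2"
proof -
  have "(1 / t) ^ (m + 2) / fact (m + 2) \<le> exp (1 / t)"
  proof -
    have "(\<lambda>n. (1 / t) ^ n /\<^sub>R fact n) sums exp (1 / t)" by (rule exp_converges)
    then have "(\<Sum>n\<in>{m + 2}. (1 / t) ^ n /\<^sub>R fact n) \<le> exp (1 / t)"
      using assms sum_le_suminf[of "\<lambda>n. (1 / t) ^ n /\<^sub>R fact n" "{m + 2}"]
      by (auto simp: sums_iff)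
    then show ?thesis by (simp add: field_simps)
  qed
  then have "1 / t ^ (m + 2) \<le> fact (m + 2) * exp (1 / t)"
    unfolding power_one_over by (metis fact_gt_zero mult.commute pos_divide_le_eq)
  then have "exp (- 1 / t) / t ^ (m + 2) \<le> fact (m + 2)"
    using assms by (simp add: exp_minus field_simps del: power_Suc fact_Suc)
  then have "exp (- 1 / t) / t ^ (m + 2) * t ^ 2 \<le> fact (m + 2) * t ^ 2"
    by (rule mult_right_mono) simp
  moreover have "exp (- 1 / t) / t ^ (m + 2) * t ^ 2 = flat m t" "flat m t \<ge> 0"
    using assms by (simp_all add: flat_def power_add field_simps power2_eq_square)
  ultimately show ?thesis by simp
qed

text \<open>Differentiating exp(-1/t) produces a factor t^-2; carrying the powers t^-m along makes
  the family closed under differentiation up to linear combinations.\<close>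

lemma flat_has_derivative:
  "(flat m has_real_derivative (flat (m + 2) t - real m * flat (m + 1) t)) (at t)"
proof -
  consider "t > 0" | "t < 0" | "t = 0" by linarith
  then show ?thesis
  proof cases
    case 1
    have "((\<lambda>t. exp (- 1 / t) / t ^ m) has_real_derivative
        (flat (m + 2) t - real m * flat (m + 1) t)) (at t)"
    proof -
      show ?thesis
        using 1 by (auto intro!: derivative_eq_intros simp: flat_def divide_simps power_add power2_eq_square)
          (cases m; simp add: algebra_simps)
    qed
    then show ?thesis
      by (rule has_field_derivative_transform_within_open[of _ _ _ "{0<..}"])
        (use 1 in \<open>auto simp: flat_def\<close>)
  next
    case 2
    have "((\<lambda>t. 0) has_real_derivative (flat (m + 2) t - real m * flat (m + 1) t)) (at t)"
      using 2 by (simp add: flat_def)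
    then show ?thesis
      by (rule has_field_derivative_transform_within_open[of _ _ _ "{..<0}"])
        (use 2 in \<open>auto simp: flat_def\<close>)
  next
    case 3
    have "((\<lambda>h. (flat m h - flat m 0) / (h - 0)) \<longlongrightarrow> 0) (at 0)"
    proof (rule Lim_null_comparison)
      show "\<forall>\<^sub>F h in at 0. norm ((flat m h - flat m 0) / (h - 0)) \<le> fact (m + 2) * \<bar>h\<bar>"
      proof (rule eventuallyI)
        fix h :: real
        show "norm ((flat m h - flat m 0) / (h - 0)) \<le> fact (m + 2) * \<bar>h\<bar>"
          using flat_bound[of h m]
          by (cases "h > 0")
            (simp_all add: flat_def field_simps power2_eq_square mult_nonpos_nonneg del: fact_Suc)
      qed
      have "((\<lambda>h. fact (m + 2) * \<bar>h\<bar>) \<longlongrightarrow> fact (m + 2) * \<bar>0::real\<bar>) (at 0)"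
        by (intro tendsto_intros)
      then show "((\<lambda>h::real. fact (m + 2) * \<bar>h\<bar>) \<longlongrightarrow> 0) (at 0)" by simp
    qed
    then show ?thesis using 3 by (simp add: has_field_derivative_iff flat_def)
  qed
qed

text \<open>\<open>Ck_on\<close> iterates directional derivatives, so smoothness follows by
  induction from any class of differentiable functions closed under them. This class contains the
  bumps; \<open>inner\<close> and \<open>const\<close> supply the derivative of |x - p|^2, and no
  higher derivative is ever written down.\<close>

inductive bump_algebra :: "'a::real_inner \<Rightarrow> real \<Rightarrow> ('a \<Rightarrow> real) \<Rightarrow> bool" for p r where
  const: "bump_algebra p r (\<lambda>x. c)"
| inner: "bump_algebra p r (\<lambda>x. x \<bullet> v)"
| flat: "bump_algebra p r (\<lambda>x. flat m (r\<^sup>2 - (x - p) \<bullet> (x - p)))"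
| add: "bump_algebra p r f \<Longrightarrow> bump_algebra p r g \<Longrightarrow> bump_algebra p r (\<lambda>x. f x + g x)"
| mult: "bump_algebra p r f \<Longrightarrow> bump_algebra p r g \<Longrightarrow> bump_algebra p r (\<lambda>x. f x * g x)"

lemma bump_algebra_has_derivative:
  assumes "bump_algebra p r f"
  shows "\<exists>D. (\<forall>x. (f has_derivative D x) (at x)) \<and> (\<forall>v. bump_algebra p r (\<lambda>x. D x v))"
  using assms
proof induction
  case (const c)
  then show ?case
    by (intro exI[of _ "\<lambda>x v. 0"]) (auto intro: bump_algebra.const)
next
  case (inner v)
  show ?case
    by (intro exI[of _ "\<lambda>x h. h \<bullet> v"])
      (auto intro!: bump_algebra.const derivative_eq_intros)
next
  case (flat m)
  let ?d = "\<lambda>x. flat (m + 2) (r\<^sup>2 - (x - p) \<bullet> (x - p)) + (- real m) * flat (m + 1) (r\<^sup>2 - (x - p) \<bullet> (x - p))"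
  have "((\<lambda>x. flat m (r\<^sup>2 - (x - p) \<bullet> (x - p))) has_derivative
      (\<lambda>h. ?d x * ((-2) * (x \<bullet> h + - (p \<bullet> h))))) (at x)" for x
    by (rule has_derivative_eq_rhs,
        rule has_derivative_compose[where f="\<lambda>x. r\<^sup>2 - (x - p) \<bullet> (x - p)",
          OF _ flat_has_derivative[unfolded has_field_derivative_def]])
      (auto intro!: derivative_eq_intros simp: inner_diff_left inner_diff_right inner_commute algebra_simps)
  moreover have "bump_algebra p r (\<lambda>x. ?d x * ((-2) * (x \<bullet> h + - (p \<bullet> h))))" for h
    by (intro bump_algebra.intros)
  ultimately show ?case
    by (intro exI[of _ "\<lambda>x h. ?d x * ((-2) * (x \<bullet> h + - (p \<bullet> h)))"]) blast
next
  case (add f g)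
  then obtain D E where D: "\<And>x. (f has_derivative D x) (at x)" "\<And>v. bump_algebra p r (\<lambda>x. D x v)"
    and E: "\<And>x. (g has_derivative E x) (at x)" "\<And>v. bump_algebra p r (\<lambda>x. E x v)" by blast
  then show ?case
    by (intro exI[of _ "\<lambda>x v. D x v + E x v"]) (auto intro!: bump_algebra.intros derivative_intros)
next
  case (mult f g)
  then obtain D E where D: "\<And>x. (f has_derivative D x) (at x)" "\<And>v. bump_algebra p r (\<lambda>x. D x v)"
    and E: "\<And>x. (g has_derivative E x) (at x)" "\<And>v. bump_algebra p r (\<lambda>x. E x v)" by blast
  then show ?case using mult.hyps
    by (intro exI[of _ "\<lambda>x v. f x * E x v + D x v * g x"]) (auto intro!: bump_algebra.intros derivative_intros)
qed

lemma bump_algebra_smooth: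
  assumes "bump_algebra p r f"
  shows "smooth_on UNIV f"
proof -
  have "Ck_on k UNIV f" for k
    using assms
  proof (induction k arbitrary: f)
    case 0
    then show ?case
      using bump_algebra_has_derivative has_derivative_continuous_on
      by (metis Ck_on.simps(1) has_derivative_at_withinI)
  next
    case (Suc k)
    obtain D where D: "\<And>x. (f has_derivative D x) (at x)" "\<And>v. bump_algebra p r (\<lambda>x. D x v)"
      using bump_algebra_has_derivative[OF Suc.prems] by blast
    then have "frechet_derivative f (at x) = D x" for x
      by (metis frechet_derivative_at)
    with D Suc.IH show ?case by (auto simp: differentiable_def)
  qed
  then show ?thesis by (simp add: smooth_on_def)
qed

lemma exists_bump_function:
  fixes p :: "real^3"
  assumes "r > 0" "cball p r \<subseteq> D"
  shows "\<exists>\<phi>. test_function D \<phi> \<and> (\<forall>x. \<phi> x \<ge> 0) \<and> (\<forall>x\<in>ball p r. \<phi> x > 0) \<and> (\<forall>x. x \<notin> cball p r \<longrightarrow> \<phi> x = 0)"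
proof (intro exI conjI)
  let ?\<phi> = "\<lambda>x. flat 0 (r\<^sup>2 - (x - p) \<bullet> (x - p))"
  have *: "(x - p) \<bullet> (x - p) < r\<^sup>2 \<longleftrightarrow> x \<in> ball p r" for x
    using assms(1)
    by (metis abs_of_pos dist_norm mem_ball dist_commute power2_less_imp_less power2_norm_eq_inner
        norm_lt_square)
  show "\<forall>x. ?\<phi> x \<ge> 0" by (simp add: flat_def)
  show "\<forall>x\<in>ball p r. ?\<phi> x > 0" using * by (auto simp: flat_def not_le)
  show z: "\<forall>x. x \<notin> cball p r \<longrightarrow> ?\<phi> x = 0"
    using * by (auto simp: flat_def) (meson less_eq_real_def not_le)
  show "test_function D ?\<phi>"
    unfolding test_function_def using assms z
    by (intro conjI bump_algebra_smooth[of p r] exI[of _ "cball p r"] bump_algebra.flat) auto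
qed

lemma test_function_continuous: "test_function D \<phi> \<Longrightarrow> continuous_on UNIV \<phi>"
  unfolding test_function_def smooth_on_def using Ck_on.simps(1) by blast

lemma test_function_bounded:
  assumes "test_function D \<phi>"
  shows "\<exists>B\<ge>0. \<forall>x. \<bar>\<phi> x\<bar> \<le> B"
proof -
  obtain K where K: "compact K" "\<And>x. x \<notin> K \<Longrightarrow> \<phi> x = 0"
    using assms unfolding test_function_def by blast
  have "bounded (\<phi> ` K)"
    by (meson K(1) assms compact_continuous_image compact_imp_bounded continuous_on_subset
        subset_UNIV test_function_continuous)
  then obtain B where "\<forall>x\<in>K. \<bar>\<phi> x\<bar> \<le> B" by (auto simp: bounded_iff)
  then have "\<forall>x. \<bar>\<phi> x\<bar> \<le> max B 0"
    using K(2) by (metis abs_zero max.cobounded2 max.coboundedI1)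
  then show ?thesis by (intro exI[of _ "max B 0"]) auto
qed

lemma locally_integrable_on_test_function:
  assumes "locally_integrable_on D f" "test_function D \<phi>"
  shows "integrable lborel (\<lambda>x. f x * \<phi> x)"
proof -
  obtain K where K: "compact K" "K \<subseteq> D" "\<And>x. x \<notin> K \<Longrightarrow> \<phi> x = 0"
    using assms unfolding test_function_def by blast
  obtain B where B: "B \<ge> 0" "\<And>x. \<bar>\<phi> x\<bar> \<le> B" using test_function_bounded[OF assms(2)] by blast
  have [measurable]: "\<phi> \<in> borel_measurable borel"
    by (rule borel_measurable_continuous_onI[OF test_function_continuous[OF assms(2)]])
  have i: "integrable lborel (\<lambda>x. indicator K x *\<^sub>R f x)"
    using assms(1) K unfolding locally_integrable_on_def set_integrable_def by blast
  have "integrable lborel (\<lambda>x. (indicator K x *\<^sub>R f x) * \<phi> x)"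
  proof (rule Bochner_Integration.integrable_bound[OF integrable_mult_left[OF integrable_norm[OF i], where c=B]])
    show "(\<lambda>x. (indicator K x *\<^sub>R f x) * \<phi> x) \<in> borel_measurable lborel"
      using borel_measurable_integrable[OF i] by measurable
    show "AE x in lborel. norm (indicator K x *\<^sub>R f x * \<phi> x) \<le> norm (norm (indicator K x *\<^sub>R f x) * B)"
      using B by (intro always_eventually) (auto simp: abs_mult intro!: mult_left_mono)
  qed
  moreover have "(\<lambda>x. (indicator K x *\<^sub>R f x) * \<phi> x) = (\<lambda>x. f x * \<phi> x)"
    using K(3) by (auto simp: indicator_def fun_eq_iff)
  ultimately show ?thesis by simp
qed

lemma continuous_imp_locally_integrable_on:
  assumes "continuous_on D f"
  shows "locally_integrable_on D f"
  unfolding locally_integrable_on_def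
  by (meson assms borel_integrable_compact continuous_on_subset set_integrable_def)

lemma test_function_integrable:
  assumes "test_function D \<phi>"
  shows "integrable lborel \<phi>"
  using locally_integrable_on_test_function[OF continuous_imp_locally_integrable_on[of D "\<lambda>x. 1"] assms]
  by simp

text \<open>Turns almost-everywhere statements about continuous functions into pointwise ones: in
  the fundamental lemma and again for the essential supremum of the vorticity.\<close>

lemma AE_notin_open_empty:
  fixes V :: "'a::euclidean_space set"
  assumes "open V" "AE x in lborel. x \<notin> V"
  shows "V = {}"
proof -
  have "V \<in> null_sets lborel"
    using assms by (subst AE_iff_null_sets) auto
  then show ?thesis
    using assms(1) by (metis negligible_iff_null_sets null_sets_completionI open_not_negligible)
qed

text \<open>A bump supported where \<open>f\<close> is positive would make a nonnegative integrand,
  positive on a ball, integrate to zero. Only one sign is treated; equalities follow by applying the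
  lemma to both signs.\<close>

lemma fundamental_lemma_real:
  fixes f :: "real^3 \<Rightarrow> real"
  assumes "open D" "continuous_on D f"
    and "\<And>\<phi>. test_function D \<phi> \<Longrightarrow> (\<integral>x. f x * \<phi> x \<partial>lborel) = 0"
    and "x \<in> D"
  shows "f x \<le> 0"
proof (rule ccontr)
  assume "\<not> f x \<le> 0"
  then have pos: "f x > 0" by simp
  have "isCont f x" using assms continuous_on_eq_continuous_at by blast
  then have "\<forall>\<^sub>F y in at x. f y > 0" 
    using pos by (simp add: isCont_def order_tendstoD(1))
  then have "\<forall>\<^sub>F y in nhds x. f y > 0" using pos by (simp add: eventually_nhds_conv_at)
  moreover have "\<forall>\<^sub>F y in nhds x. y \<in> D" using assms by (simp add: eventually_nhds_in_open)
  ultimately have "\<forall>\<^sub>F y in nhds x. f y > 0 \<and> y \<in> D" by eventually_elim auto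
  then obtain e where e: "e > 0" "\<And>y. dist y x < e \<Longrightarrow> f y > 0 \<and> y \<in> D"
    by (auto simp: eventually_nhds_metric)
  define r where "r = e / 2"
  have r: "r > 0" "cball x r \<subseteq> D" "\<And>y. y \<in> cball x r \<Longrightarrow> f y > 0"
    using e by (auto simp: r_def dist_commute)
  obtain \<phi> where \<phi>: "test_function D \<phi>" "\<And>y. \<phi> y \<ge> 0" "\<And>y. y \<in> ball x r \<Longrightarrow> \<phi> y > 0"
      "\<And>y. y \<notin> cball x r \<Longrightarrow> \<phi> y = 0"
    using exists_bump_function[OF r(1,2)] by blast
  have i: "integrable lborel (\<lambda>x. f x * \<phi> x)"
    using locally_integrable_on_test_function continuous_imp_locally_integrable_on \<phi>(1) assms(2) by blast
  have nn: "f y * \<phi> y \<ge> 0" for y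
    using \<phi>(2,4) r(3) by (metis less_eq_real_def mult_nonneg_nonneg mult_zero_right)
  have "AE y in lborel. f y * \<phi> y = 0"
    using integral_nonneg_eq_0_iff_AE[OF i] nn assms(3)[OF \<phi>(1)] by auto
  then have "AE y in lborel. y \<notin> ball x r"
  proof eventually_elim
    case (elim y)
    then show ?case using \<phi>(3)[of y] r(3)[of y] by auto
  qed
  then have "ball x r = {}" by (intro AE_notin_open_empty) auto
  then show False using r(1) by simp
qed

lemma fundamental_lemma_complex:
  fixes f :: "real^3 \<Rightarrow> real" and F :: "real^3 \<Rightarrow> complex"
  assumes "open D" "continuous_on D f" "continuous_on D F"
    and eq: "\<And>\<phi>. test_function D \<phi> \<Longrightarrow>
      complex_of_real (\<integral>x. f x * \<phi> x \<partial>lborel) = (\<integral>x. F x * complex_of_real (\<phi> x) \<partial>lborel)"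
    and "x \<in> D"
  shows "F x = complex_of_real (f x)"
proof -
  have part: "integrable lborel (\<lambda>x. h x * \<phi> x)"
    if "continuous_on D h" "test_function D \<phi>" for h \<phi>
    using that locally_integrable_on_test_function continuous_imp_locally_integrable_on by blast
  have cont: "continuous_on D (\<lambda>x. Re (F x))" "continuous_on D (\<lambda>x. Im (F x))"
    using assms(3) by (auto intro: continuous_intros)
  have R: "(\<integral>x. f x * \<phi> x \<partial>lborel) = (\<integral>x. Re (F x) * \<phi> x \<partial>lborel)"
      and I: "(\<integral>x. Im (F x) * \<phi> x \<partial>lborel) = 0" if "test_function D \<phi>" for \<phi>
  proof -
    have "integrable lborel (\<lambda>x. F x * complex_of_real (\<phi> x))"
    proof -
      have "integrable lborel (\<lambda>x. complex_of_real (Re (F x) * \<phi> x) + \<i> * complex_of_real (Im (F x) * \<phi> x))"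
        using part[OF cont(1) that] part[OF cont(2) that]
        by (intro Bochner_Integration.integrable_add integrable_mult_right integrable_of_real)
      then show ?thesis
        by (rule back_subst[of "integrable lborel"]) (auto simp: complex_eq_iff)
    qed
    then have "Re (\<integral>x. F x * complex_of_real (\<phi> x) \<partial>lborel) = (\<integral>x. Re (F x) * \<phi> x \<partial>lborel)"
       "Im (\<integral>x. F x * complex_of_real (\<phi> x) \<partial>lborel) = (\<integral>x. Im (F x) * \<phi> x \<partial>lborel)"
      by (auto simp flip: integral_Re integral_Im)
    then show "(\<integral>x. f x * \<phi> x \<partial>lborel) = (\<integral>x. Re (F x) * \<phi> x \<partial>lborel)"
      "(\<integral>x. Im (F x) * \<phi> x \<partial>lborel) = 0"
      using eq[OF that] by (metis Re_complex_of_real, metis Im_complex_of_real)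
  qed
  have "Re (F x) - f x \<le> 0" "f x - Re (F x) \<le> 0" "Im (F x) \<le> 0" "- Im (F x) \<le> 0"
    using R I assms cont part
    by (intro fundamental_lemma_real[OF assms(1) _ _ assms(5)] continuous_intros;
        simp add: left_diff_distrib)+
  then show ?thesis by (simp add: complex_eq_iff)
qed

section \<open>Fourier synthesis\<close>

abbreviation freq :: "fluid_domain \<Rightarrow> (real^3) measure" where
  "freq \<equiv> frequency_measure"

abbreviation weight :: "real^3 \<Rightarrow> real" where
  "weight \<xi> \<equiv> 1 + (norm \<xi>)\<^sup>2"

text \<open>The multiplier of the directional derivative along \<open>h\<close>, for the kernel
  \<open>cis (\<xi> \<bullet> x)\<close>.\<close>

abbreviation symbol_deriv :: "real^3 \<Rightarrow> (real^3 \<Rightarrow> complex) \<Rightarrow> real^3 \<Rightarrow> complex" where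
  "symbol_deriv h g \<equiv> (\<lambda>\<xi>. \<i> * complex_of_real (\<xi> \<bullet> h) * g \<xi>)"

lemma measurable_frequency [measurable]:
  "(\<lambda>\<xi>. \<xi>) \<in> borel_measurable (freq \<Omega>)"
  by (cases \<Omega>) auto

section \<open>Counting frequencies and integrating the Sobolev weight\<close>

lemma lattice_countable: "countable {k :: real^'n. \<forall>i. k $ i \<in> \<int>}"
proof -
  have "{k :: real^'n. \<forall>i. k $ i \<in> \<int>} \<subseteq> vec_lambda ` (PiE UNIV (\<lambda>_. \<int>))"
    by (auto intro!: image_eqI[of _ _ "vec_nth _"])
  moreover have "countable (PiE (UNIV :: 'n set) (\<lambda>_. \<int> :: real set))"
    by (intro countable_PiE) (auto simp: Ints_def)
  ultimately show ?thesis by (meson countable_image countable_subset)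
qed

lemma sigma_finite_frequency: "sigma_finite_measure (freq \<Omega>)"
  by (cases \<Omega>) (auto intro: sigma_finite_measure_count_space_countable lattice_countable
      lborel.sigma_finite_measure_axioms)

lemma ball_subset_cube:
  fixes \<xi> :: "real^'n"
  assumes "norm \<xi> < R"
  shows "\<bar>\<xi> $ i\<bar> \<le> R"
  using component_le_norm_cart[of \<xi> i] assms by linarith

text \<open>One bound for Lebesgue measure (a cube of side 2N) and for the dual lattice ((2N+1)^3
  points), so that nothing after it has to distinguish the torus from the other domains.\<close>

lemma emeasure_frequency_ball:
  "emeasure (freq \<Omega>) {\<xi> \<in> space (freq \<Omega>). norm \<xi> < real N}
    \<le> ennreal ((2 * real N + 1) ^ 3)"
proof -
  have L: "emeasure lborel {\<xi> :: real^3. norm \<xi> < real N} \<le> ennreal ((2 * real N + 1) ^ 3)"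
  proof -
    have "emeasure lborel {\<xi> :: real^3. norm \<xi> < real N} \<le> emeasure lborel (cbox (vec (- real N)) (vec (real N)) :: (real^3) set)"
    proof (rule emeasure_mono)
      show "{\<xi> :: real^3. norm \<xi> < real N} \<subseteq> cbox (vec (- real N)) (vec (real N))"
      proof
        fix \<xi> :: "real^3" assume "\<xi> \<in> {\<xi>. norm \<xi> < real N}"
        then have "\<bar>\<xi> $ i\<bar> \<le> real N" for i using ball_subset_cube[of \<xi> "real N" i] by simp
        then show "\<xi> \<in> cbox (vec (- real N)) (vec (real N))"
          by (auto simp: mem_box_cart abs_le_iff minus_le_iff)
      qed
    qed simp
    also have "\<dots> = ennreal (measure lborel (cbox (vec (- real N)) (vec (real N)) :: (real^3) set))"
      by (intro emeasure_eq_ennreal_measure) (metis emeasure_lborel_cbox_finite infinity_ennreal_def less_irrefl)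
    also have "measure lborel (cbox (vec (- real N)) (vec (real N)) :: (real^3) set) = (2 * real N) ^ 3"
      by (subst content_cbox_cart) (auto simp: box_ne_empty interval_ne_empty_cart prod_constant)
    also have "ennreal \<dots> \<le> ennreal ((2 * real N + 1) ^ 3)"
      by (intro ennreal_leI power_mono) auto
    finally show ?thesis .
  qed
  have C: "emeasure (count_space Z) {\<xi> \<in> Z. norm \<xi> < real N} \<le> ennreal ((2 * real N + 1) ^ 3)"
    if "Z = {k :: real^3. \<forall>i. k $ i \<in> \<int>}" for Z
  proof -
    let ?S = "real_of_int ` {- int N .. int N}"
    let ?B = "vec_lambda ` (PiE (UNIV :: 3 set) (\<lambda>_. ?S))"
    have fin: "finite ?B" by (intro finite_imageI finite_PiE) auto
    have sub: "{\<xi> \<in> Z. norm \<xi> < real N} \<subseteq> ?B"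
    proof
      fix \<xi> assume "\<xi> \<in> {\<xi> \<in> Z. norm \<xi> < real N}"
      then have "\<xi> $ i \<in> ?S" for i
        using ball_subset_cube[of \<xi> "real N" i] that
        by (auto elim!: Ints_cases[of "\<xi> $ i"] simp: abs_le_iff dest!: spec[of _ i])
      then show "\<xi> \<in> ?B" by (intro image_eqI[of _ _ "vec_nth \<xi>"]) auto
    qed
    have "card {\<xi> \<in> Z. norm \<xi> < real N} \<le> card ?B" by (rule card_mono[OF fin sub])
    also have "\<dots> \<le> card (PiE (UNIV :: 3 set) (\<lambda>_. ?S))" by (intro card_image_le finite_PiE) auto
    also have "\<dots> = (2 * N + 1) ^ 3"
      by (simp add: card_PiE card_image inj_on_def nat_add_distrib nat_mult_distrib)
    finally have "real (card {\<xi> \<in> Z. norm \<xi> < real N}) \<le> real ((2 * N + 1) ^ 3)" by (rule of_nat_mono)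
    then have "ennreal (real (card {\<xi> \<in> Z. norm \<xi> < real N})) \<le> ennreal ((2 * real N + 1) ^ 3)"
      by (intro ennreal_leI) (simp add: add.commute)
    moreover have "finite {\<xi> \<in> Z. norm \<xi> < real N}" using fin sub finite_subset by blast
    ultimately show ?thesis
      by (subst emeasure_count_space) (auto simp: ennreal_of_nat_eq_real_of_nat)
  qed
  show ?thesis using L C by (cases \<Omega>) auto
qed

text \<open>The least n with r < 2^(n+1) works: minimality gives r \<ge> 2^n if n > 0, and for n = 0
  the summand 1 suffices.\<close>

lemma powr_one_add_le_dyadic:
  fixes r p :: real
  assumes "r \<ge> 0" "p > 0"
  shows "\<exists>n. r < 2 ^ Suc n \<and> (1 + r\<^sup>2) powr (- p) \<le> (4 powr (- p)) ^ n"
proof -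
  have "\<exists>n. r < 2 ^ Suc n"
  proof -
    obtain n where "r < 2 ^ n" using real_arch_pow[of 2 r] by auto
    moreover have "(2::real) ^ n \<le> 2 ^ Suc n" by simp
    ultimately show ?thesis by (meson order_less_le_trans)
  qed
  then have *: "r < 2 ^ Suc (LEAST n. r < 2 ^ Suc n)" (is "r < 2 ^ Suc ?n") by (rule LeastI_ex)
  have "4 ^ ?n \<le> 1 + r\<^sup>2"
  proof (cases ?n)
    case 0
    then show ?thesis by simp
  next
    case (Suc m)
    then have "\<not> r < 2 ^ Suc m" using not_less_Least[of m "\<lambda>n. r < 2 ^ Suc n"] by simp
    then have "2 ^ ?n \<le> r" using Suc by simp
    then have "(2 ^ ?n)\<^sup>2 \<le> r\<^sup>2" by (rule power_mono) simp
    moreover have "(2 ^ ?n)\<^sup>2 = (4::real) ^ ?n"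
      by (simp add: power2_eq_square flip: power_mult_distrib)
    ultimately show ?thesis by simp
  qed
  then have "(1 + r\<^sup>2) powr (- p) \<le> (4 ^ ?n) powr (- p)"
    by (intro powr_mono2') (use assms in auto)
  also have "\<dots> = (4 powr (- p)) ^ ?n"
    by (simp add: powr_realpow[symmetric] powr_powr powr_power mult.commute)
  finally show ?thesis using * by blast
qed

text \<open>In dyadic shells the weight is at most 4^(-pn), while the surrounding ball has measure
  of order 8^n. The geometric series of ratio 8 * 4^(-p) converges precisely for p > 3/2, the origin
  of the 3/2 in all later thresholds.\<close>

lemma nn_integral_frequency_weight:
  assumes "p > 3/2"
  shows "(\<integral>\<^sup>+\<xi>. ennreal (weight \<xi> powr (- p)) \<partial>freq \<Omega>) < \<infinity>"
proof -
  let ?M = "freq \<Omega>"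
  define q where "q = 4 powr (- p)"
  let ?B = "\<lambda>n. {\<xi> \<in> space ?M. norm \<xi> < real (2 ^ Suc n)}"
  have q: "q > 0" "8 * q < 1"
  proof -
    have "4 powr (- p) < 4 powr (- 3/2 :: real)" using assms by (intro powr_less_mono) auto
    also have "4 powr (- 3/2 :: real) = (4 powr (1/2)) powr (- 3)" by (subst powr_powr) simp
    also have "4 powr (1/2) = (2::real)" by (simp add: powr_half_sqrt)
    also have "2 powr (- 3) = (1/8 :: real)" by (simp add: powr_minus powr_realpow[of 2 3, simplified])
    finally show "8 * q < 1" by (simp add: q_def)
  qed (simp add: q_def)
  have [measurable]: "?B n \<in> sets ?M" for n by measurable
  have "(\<integral>\<^sup>+\<xi>. ennreal (weight \<xi> powr (- p)) \<partial>?M)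
      \<le> (\<integral>\<^sup>+\<xi>. (\<Sum>n. ennreal (q ^ n) * indicator (?B n) \<xi>) \<partial>?M)"
  proof (intro nn_integral_mono)
    fix \<xi> assume "\<xi> \<in> space ?M"
    obtain n where n: "norm \<xi> < 2 ^ Suc n" "weight \<xi> powr (- p) \<le> q ^ n"
      using powr_one_add_le_dyadic[of "norm \<xi>" p] assms by (auto simp: q_def)
    have "ennreal (weight \<xi> powr (- p)) \<le> ennreal (q ^ n) * indicator (?B n) \<xi>"
      using n \<open>\<xi> \<in> space ?M\<close> by (auto intro: ennreal_leI)
    also have "\<dots> \<le> (\<Sum>n. ennreal (q ^ n) * indicator (?B n) \<xi>)"
      using sum_le_suminf[of "\<lambda>n. ennreal (q ^ n) * indicator (?B n) \<xi>" "{n}"]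
      by (simp del: sum_mult_indicator)
    finally show "ennreal (weight \<xi> powr (- p)) \<le> (\<Sum>n. ennreal (q ^ n) * indicator (?B n) \<xi>)" .
  qed
  also have "\<dots> = (\<Sum>n. \<integral>\<^sup>+\<xi>. ennreal (q ^ n) * indicator (?B n) \<xi> \<partial>?M)"
    by (intro nn_integral_suminf) measurable
  also have "\<dots> = (\<Sum>n. ennreal (q ^ n) * emeasure ?M (?B n))"
    by (simp add: nn_integral_cmult_indicator)
  also have "\<dots> \<le> (\<Sum>n. ennreal (125 * (8 * q) ^ n))"
  proof (intro suminf_le)
    fix n
    have "emeasure ?M (?B n) \<le> ennreal ((2 * real (2 ^ Suc n) + 1) ^ 3)"
      by (rule emeasure_frequency_ball)
    \<comment> \<open>Since 1 \<le> 2^n, the sum 4 * 2^n + 1 is at most 5 * 2^n; its cube gives the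
      125.\<close>
    also have "\<dots> \<le> ennreal ((5 * 2 ^ n) ^ 3)"
      using one_le_power[of "2::real" n] by (intro ennreal_leI power_mono) auto
    also have "((5 * 2 ^ n) ^ 3) = (125 * 8 ^ n :: real)"
      by (simp add: power_mult_distrib power_mult[symmetric] mult.commute[of n])
        (simp add: power_mult)
    finally have "ennreal (q ^ n) * emeasure ?M (?B n) \<le> ennreal (q ^ n) * ennreal (125 * 8 ^ n)"
      by (rule mult_left_mono) simp
    also have "\<dots> = ennreal (125 * (8 * q) ^ n)"
      using q by (simp add: ennreal_mult[symmetric] power_mult_distrib mult_ac)
    finally show "ennreal (q ^ n) * emeasure ?M (?B n) \<le> ennreal (125 * (8 * q) ^ n)" .
  qed auto
  also have "\<dots> < \<infinity>"
  proof -
    have "summable (\<lambda>n. 125 * (8 * q) ^ n)"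
      by (intro summable_mult summable_geometric) (use q in simp)
    then show ?thesis using q by (subst suminf_ennreal2) auto
  qed
  finally show ?thesis .
qed

section \<open>Weighted moments of symbols\<close>

lemma weight_nonzero [simp]: "1 + (norm (x :: 'a::real_normed_vector))\<^sup>2 \<noteq> 0"
  by (metis add_pos_nonneg less_numeral_extra(1,3) zero_le_power2)

text \<open>A weighted L^1 condition in place of the L^2 condition of \<open>Hs_symbol\<close>: it
  controls suprema of the synthesised function and, each multiplication by a frequency costing one
  unit of \<open>k\<close>, of its derivatives.\<close>

definition fourier_moment :: "(real^3) measure \<Rightarrow> real \<Rightarrow> (real^3 \<Rightarrow> complex) \<Rightarrow> bool" where
  "fourier_moment M k g \<longleftrightarrow> g \<in> borel_measurable M \<and>
    integrable M (\<lambda>\<xi>. weight \<xi> powr (k / 2) * cmod (g \<xi>))"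

definition moment_norm :: "(real^3) measure \<Rightarrow> real \<Rightarrow> (real^3 \<Rightarrow> complex) \<Rightarrow> real" where
  "moment_norm M k g = (\<integral>\<xi>. weight \<xi> powr (k / 2) * cmod (g \<xi>) \<partial>M)"

text \<open>Cauchy-Schwarz for the splitting k/2 = (k - s)/2 + s/2 of the exponent of the weight;
  the first factor is square integrable because s - k > 3/2. The constant depends on neither
  \<open>f\<close> nor \<open>g\<close>, which later makes convergence in H^s uniform in
  space.\<close>

lemma Sobolev_moment:
  fixes \<Omega> s k
  assumes "s - k > 3/2"
  obtains C where "C \<ge> 0"
    "\<And>f g. Hs_symbol \<Omega> s f g \<Longrightarrow> fourier_moment (freq \<Omega>) k g"
    "\<And>f g. Hs_symbol \<Omega> s f g \<Longrightarrow> moment_norm (freq \<Omega>) k g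
      \<le> C * sqrt (\<integral>\<xi>. weight \<xi> powr s * (cmod (g \<xi>))\<^sup>2 \<partial>freq \<Omega>)"
proof -
  let ?M = "freq \<Omega>"
  let ?w = "\<lambda>\<xi>::real^3. 1 + (norm \<xi>)\<^sup>2"
  have w: "?w \<xi> > 0" for \<xi> by (simp add: add_pos_nonneg)
  obtain c where c: "c \<ge> 0" "(\<integral>\<^sup>+\<xi>. ennreal (?w \<xi> powr (k - s)) \<partial>?M) = ennreal c"
    using nn_integral_frequency_weight[OF assms, of \<Omega>] by (auto simp: less_top_ennreal)
  have main: "fourier_moment ?M k g \<and> moment_norm ?M k g
      \<le> sqrt c * sqrt (\<integral>\<xi>. ?w \<xi> powr s * (cmod (g \<xi>))\<^sup>2 \<partial>?M)" if "Hs_symbol \<Omega> s f g" for f g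
  proof -
    let ?E = "\<integral>\<xi>. ?w \<xi> powr s * (cmod (g \<xi>))\<^sup>2 \<partial>?M"
    have [measurable]: "g \<in> borel_measurable ?M"
      and i: "integrable ?M (\<lambda>\<xi>. ?w \<xi> powr s * (cmod (g \<xi>))\<^sup>2)"
      using that by (auto simp: Hs_symbol_def)
    have E: "?E \<ge> 0" by (intro integral_nonneg_AE) auto
    let ?a = "\<lambda>\<xi>. ennreal (?w \<xi> powr ((k - s) / 2))"
    let ?b = "\<lambda>\<xi>. ennreal (?w \<xi> powr (s / 2) * cmod (g \<xi>))"
    have "ennreal (?w \<xi> powr (k / 2) * cmod (g \<xi>)) = ?a \<xi> * ?b \<xi>" for \<xi>
      by (simp add: ennreal_mult[symmetric] powr_add[symmetric] mult.assoc[symmetric] diff_divide_distrib)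
    then have "(\<integral>\<^sup>+\<xi>. ennreal (?w \<xi> powr (k / 2) * cmod (g \<xi>)) \<partial>?M)\<^sup>2 = (\<integral>\<^sup>+\<xi>. ?a \<xi> * ?b \<xi> \<partial>?M)\<^sup>2" by simp
    also have "\<dots> \<le> (\<integral>\<^sup>+\<xi>. (?a \<xi>)\<^sup>2 \<partial>?M) * (\<integral>\<^sup>+\<xi>. (?b \<xi>)\<^sup>2 \<partial>?M)"
      by (intro Cauchy_Schwarz_nn_integral) measurable
    also have "(\<integral>\<^sup>+\<xi>. (?a \<xi>)\<^sup>2 \<partial>?M) = ennreal c"
      unfolding c(2)[symmetric]
      by (intro nn_integral_cong) (simp add: power2_eq_square ennreal_mult[symmetric] powr_add[symmetric])
    also have "(\<integral>\<^sup>+\<xi>. (?b \<xi>)\<^sup>2 \<partial>?M) = (\<integral>\<^sup>+\<xi>. ennreal (?w \<xi> powr s * (cmod (g \<xi>))\<^sup>2) \<partial>?M)"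
      by (intro nn_integral_cong) (simp add: power2_eq_square ennreal_mult[symmetric] mult_ac powr_add[symmetric])
    also have "\<dots> = ennreal ?E"
      by (rule nn_integral_eq_integral[OF i]) auto
    finally have sq: "(\<integral>\<^sup>+\<xi>. ennreal (?w \<xi> powr (k / 2) * cmod (g \<xi>)) \<partial>?M)\<^sup>2 \<le> ennreal (c * ?E)"
      using c E by (simp add: ennreal_mult)
    then have "(\<integral>\<^sup>+\<xi>. ennreal (?w \<xi> powr (k / 2) * cmod (g \<xi>)) \<partial>?M) \<noteq> \<infinity>"
      by (auto simp: power2_eq_square ennreal_mult_top top_unique)
    then have int: "integrable ?M (\<lambda>\<xi>. ?w \<xi> powr (k / 2) * cmod (g \<xi>))"
      by (intro integrableI_nonneg) (auto simp: less_top)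
    then have "(\<integral>\<^sup>+\<xi>. ennreal (?w \<xi> powr (k / 2) * cmod (g \<xi>)) \<partial>?M) = ennreal (moment_norm ?M k g)"
      unfolding moment_norm_def by (rule nn_integral_eq_integral) auto
    moreover have "moment_norm ?M k g \<ge> 0"
      unfolding moment_norm_def by (intro integral_nonneg_AE) auto
    ultimately have "(moment_norm ?M k g)\<^sup>2 \<le> c * ?E"
      using sq c E by (simp add: power2_eq_square ennreal_mult[symmetric])
    then have "moment_norm ?M k g \<le> sqrt (c * ?E)" by (rule real_le_rsqrt)
    then show ?thesis using int by (simp add: fourier_moment_def real_sqrt_mult)
  qed
  show ?thesis by (rule that[of "sqrt c"]) (use main c in auto)
qed

lemma moment_norm_nonneg: "moment_norm M k g \<ge> 0"
  unfolding moment_norm_def by (intro integral_nonneg_AE) auto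

lemma weight_powr_mono:
  assumes "k \<le> l"
  shows "weight \<xi> powr (k / 2) \<le> weight \<xi> powr (l / 2)"
  using assms by (intro powr_mono) auto

lemma fourier_moment_mono:
  assumes "fourier_moment M l g" "k \<le> l" "(\<lambda>\<xi>. \<xi>) \<in> borel_measurable M"
  shows "fourier_moment M k g" "moment_norm M k g \<le> moment_norm M l g"
proof -
  note [measurable] = assms(3)
  have [measurable]: "g \<in> borel_measurable M" using assms(1) by (simp add: fourier_moment_def)
  have i: "integrable M (\<lambda>\<xi>. weight \<xi> powr (l / 2) * cmod (g \<xi>))"
    using assms(1) by (simp add: fourier_moment_def)
  have i2: "integrable M (\<lambda>\<xi>. weight \<xi> powr (k / 2) * cmod (g \<xi>))"
    by (rule Bochner_Integration.integrable_bound[OF i])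
      (use assms(2) in \<open>auto intro!: always_eventually mult_right_mono weight_powr_mono\<close>)
  then show "fourier_moment M k g" by (simp add: fourier_moment_def)
  show "moment_norm M k g \<le> moment_norm M l g"
    unfolding moment_norm_def
    by (rule integral_mono[OF i2 i]) (auto intro!: mult_right_mono weight_powr_mono assms)
qed

lemma norm_le_weight: "norm \<xi> \<le> weight \<xi> powr (1 / 2)"
  by (simp add: powr_half_sqrt real_le_rsqrt)

lemma fourier_moment_derivative:
  assumes "fourier_moment M (k + 1) g" "(\<lambda>\<xi>. \<xi>) \<in> borel_measurable M"
  shows "fourier_moment M k (symbol_deriv h g)"
    and "moment_norm M k (symbol_deriv h g) \<le> norm h * moment_norm M (k + 1) g"
proof -
  note [measurable] = assms(2)
  have [measurable]: "g \<in> borel_measurable M" using assms(1) by (simp add: fourier_moment_def)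
  have i: "integrable M (\<lambda>\<xi>. norm h * (weight \<xi> powr ((k + 1) / 2) * cmod (g \<xi>)))"
    using assms(1) by (intro integrable_mult_right) (simp add: fourier_moment_def)
  have le: "weight \<xi> powr (k / 2) * cmod (\<i> * complex_of_real (\<xi> \<bullet> h) * g \<xi>)
    \<le> norm h * (weight \<xi> powr ((k + 1) / 2) * cmod (g \<xi>))" for \<xi>
  proof -
    have "weight \<xi> powr (k / 2) * \<bar>\<xi> \<bullet> h\<bar> \<le> weight \<xi> powr (k / 2) * (weight \<xi> powr (1 / 2) * norm h)"
      using Cauchy_Schwarz_ineq2[of \<xi> h] mult_right_mono[OF norm_le_weight[of \<xi>], of "norm h"]
      by (intro mult_left_mono) auto
    also have "\<dots> = norm h * weight \<xi> powr ((k + 1) / 2)"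
      by (simp add: add_divide_distrib powr_add)
    finally have "weight \<xi> powr (k / 2) * \<bar>\<xi> \<bullet> h\<bar> * cmod (g \<xi>) \<le> norm h * weight \<xi> powr ((k + 1) / 2) * cmod (g \<xi>)"
      by (rule mult_right_mono) simp
    then show ?thesis by (simp add: norm_mult mult_ac)
  qed
  have i2: "integrable M (\<lambda>\<xi>. weight \<xi> powr (k / 2) * cmod (\<i> * complex_of_real (\<xi> \<bullet> h) * g \<xi>))"
    by (rule Bochner_Integration.integrable_bound[OF i])
      (use le in \<open>auto intro!: always_eventually order_trans[OF le] simp: abs_mult\<close>)
  then show "fourier_moment M k (symbol_deriv h g)" by (simp add: fourier_moment_def)
  show "moment_norm M k (symbol_deriv h g) \<le> norm h * moment_norm M (k + 1) g"
    unfolding moment_norm_def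
    by (subst integral_mult_right_zero[symmetric], rule integral_mono[OF i2 i le])
qed

text \<open>The inverse Fourier transform, or the Fourier series, in the normalisation of
  \<open>synthesised_by\<close>. It is a function on the whole space even when the domain is
  bounded.\<close>

definition synth :: "(real^3) measure \<Rightarrow> (real^3 \<Rightarrow> complex) \<Rightarrow> real^3 \<Rightarrow> complex" where
  "synth M g x = (\<integral>\<xi>. g \<xi> * cis (\<xi> \<bullet> x) \<partial>M)"

lemma cis_measurable [measurable]: "cis \<in> borel_measurable borel"
  by (intro borel_measurable_continuous_onI continuous_intros)

lemma fourier_moment_integrable:
  assumes "fourier_moment M k g" "0 \<le> k" "(\<lambda>\<xi>. \<xi>) \<in> borel_measurable M"
  shows "integrable M (\<lambda>\<xi>. g \<xi> * cis (\<xi> \<bullet> x))" "integrable M g"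
proof -
  note [measurable] = assms(3)
  have "fourier_moment M 0 g" using fourier_moment_mono(1)[OF assms(1,2,3)] .
  then have [measurable]: "g \<in> borel_measurable M" and i: "integrable M (\<lambda>\<xi>. weight \<xi> powr (0 / 2) * cmod (g \<xi>))"
    by (auto simp: fourier_moment_def)
  show "integrable M (\<lambda>\<xi>. g \<xi> * cis (\<xi> \<bullet> x))"
    by (rule Bochner_Integration.integrable_bound[OF i]) (auto simp: norm_mult)
  show "integrable M g"
    by (rule Bochner_Integration.integrable_bound[OF i]) (auto simp: norm_mult)
qed

lemma synth_bound:
  assumes "fourier_moment M k g" "0 \<le> k" "(\<lambda>\<xi>. \<xi>) \<in> borel_measurable M"
  shows "cmod (synth M g x) \<le> moment_norm M k g"
proof -
  have "cmod (synth M g x) \<le> (\<integral>\<xi>. cmod (g \<xi> * cis (\<xi> \<bullet> x)) \<partial>M)"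
    unfolding synth_def by (rule integral_norm_bound)
  also have "\<dots> = moment_norm M 0 g"
    by (simp add: moment_norm_def norm_mult) 
  also have "\<dots> \<le> moment_norm M k g" using fourier_moment_mono(2)[OF assms] .
  finally show ?thesis .
qed

lemma synth_add:
  assumes "fourier_moment M k g" "fourier_moment M k h" "0 \<le> k" "(\<lambda>\<xi>. \<xi>) \<in> borel_measurable M"
  shows "synth M (\<lambda>\<xi>. g \<xi> + h \<xi>) x = synth M g x + synth M h x"
  unfolding synth_def ring_distribs
  by (intro Bochner_Integration.integral_add fourier_moment_integrable[OF _ assms(3,4)] assms)

lemma norm_cis_diff_le: "cmod (cis a - cis b) \<le> \<bar>a - b\<bar>"
proof -
  have "cis a - cis b = cis b * (cis (a - b) - 1)" by (simp add: cis_mult right_diff_distrib)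
  moreover have "cmod (cis (a - b) - 1) \<le> \<bar>a - b\<bar>"
    using iexp_approx1[of "a - b" 0] by (simp add: cis_conv_exp)
  ultimately show ?thesis by (simp add: norm_mult)
qed

lemma norm_cis_taylor_le: "cmod (cis (a + b) - cis a - \<i> * b * cis a) \<le> b\<^sup>2"
proof -
  have "cis (a + b) - cis a - \<i> * b * cis a = cis a * (cis b - 1 - \<i> * b)"
    by (simp add: cis_mult[symmetric] algebra_simps)
  moreover have "cmod (cis b - 1 - \<i> * b) \<le> b\<^sup>2 / 2"
    using iexp_approx1[of b 1] by (simp add: cis_conv_exp power2_eq_square diff_diff_eq)
  moreover have "b\<^sup>2 / 2 \<le> b\<^sup>2" by simp
  ultimately show ?thesis by (metis mult_1 norm_cis norm_mult order_trans)
qed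

lemma synth_lipschitz:
  assumes "fourier_moment M 1 g" "(\<lambda>\<xi>. \<xi>) \<in> borel_measurable M"
  shows "cmod (synth M g x - synth M g y) \<le> moment_norm M 1 g * norm (x - y)"
proof -
  note i = fourier_moment_integrable(1)[OF assms(1) _ assms(2), simplified]
  have "synth M g x - synth M g y = (\<integral>\<xi>. g \<xi> * cis (\<xi> \<bullet> x) - g \<xi> * cis (\<xi> \<bullet> y) \<partial>M)"
    unfolding synth_def by (intro Bochner_Integration.integral_diff[symmetric] i)
  also have "cmod \<dots> \<le> (\<integral>\<xi>. norm (x - y) * (weight \<xi> powr (1 / 2) * cmod (g \<xi>)) \<partial>M)"
  proof (rule Bochner_Integration.integral_norm_bound_integral)
    show "integrable M (\<lambda>\<xi>. g \<xi> * cis (\<xi> \<bullet> x) - g \<xi> * cis (\<xi> \<bullet> y))"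
      by (intro Bochner_Integration.integrable_diff i)
    show "integrable M (\<lambda>\<xi>. norm (x - y) * (weight \<xi> powr (1 / 2) * cmod (g \<xi>)))"
      using assms(1) by (intro integrable_mult_right) (simp add: fourier_moment_def)
    fix \<xi>
    have "cmod (g \<xi> * cis (\<xi> \<bullet> x) - g \<xi> * cis (\<xi> \<bullet> y)) = cmod (g \<xi>) * cmod (cis (\<xi> \<bullet> x) - cis (\<xi> \<bullet> y))"
      by (simp add: norm_mult[symmetric] right_diff_distrib)
    also have "\<dots> \<le> cmod (g \<xi>) * \<bar>\<xi> \<bullet> (x - y)\<bar>"
      using norm_cis_diff_le[of "\<xi> \<bullet> x" "\<xi> \<bullet> y"] by (intro mult_left_mono) (auto simp: inner_diff_right)
    also have "\<dots> \<le> cmod (g \<xi>) * (weight \<xi> powr (1 / 2) * norm (x - y))"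
      using Cauchy_Schwarz_ineq2[of \<xi> "x - y"] mult_right_mono[OF norm_le_weight[of \<xi>], of "norm (x - y)"]
      by (intro mult_left_mono) auto
    finally show "cmod (g \<xi> * cis (\<xi> \<bullet> x) - g \<xi> * cis (\<xi> \<bullet> y))
      \<le> norm (x - y) * (weight \<xi> powr (1 / 2) * cmod (g \<xi>))" by (simp add: mult_ac)
  qed
  also have "\<dots> = moment_norm M 1 g * norm (x - y)"
    by (simp add: moment_norm_def)
  finally show ?thesis .
qed

lemma synth_continuous_on:
  assumes "fourier_moment M k g" "k \<ge> 1" "(\<lambda>\<xi>. \<xi>) \<in> borel_measurable M"
  shows "continuous_on S (synth M g)"
proof (rule lipschitz_on_continuous_on)
  show "(moment_norm M 1 g)-lipschitz_on S (synth M g)"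
    using synth_lipschitz fourier_moment_mono[OF assms] assms(3)
    by (intro lipschitz_onI) (auto simp: dist_norm moment_norm_nonneg)
qed

lemma synth_derivative_linear:
  assumes "fourier_moment M 1 g" "(\<lambda>\<xi>. \<xi>) \<in> borel_measurable M"
  shows "bounded_linear (\<lambda>h. synth M (symbol_deriv h g) x)"
proof (rule bounded_linear_intro)
  have m: "fourier_moment M 0 (symbol_deriv h g)" for h
    using fourier_moment_derivative(1)[of M 0 g h] assms by simp
  fix h h'
  show "synth M (\<lambda>\<xi>. \<i> * complex_of_real (\<xi> \<bullet> (h + h')) * g \<xi>) x =
    synth M (symbol_deriv h g) x + synth M (symbol_deriv h' g) x"
    using synth_add[OF m[of h] m[of h'], of x] assms
    by (simp add: inner_add_right distrib_left distrib_right)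
next
  fix r :: real and h :: "real^3"
  show "synth M (\<lambda>\<xi>. \<i> * complex_of_real (\<xi> \<bullet> (r *\<^sub>R h)) * g \<xi>) x =
    r *\<^sub>R synth M (symbol_deriv h g) x"
  proof -
    have "(\<lambda>\<xi>. \<i> * complex_of_real (\<xi> \<bullet> (r *\<^sub>R h)) * g \<xi> * cis (\<xi> \<bullet> x)) =
      (\<lambda>\<xi>. complex_of_real r * (\<i> * complex_of_real (\<xi> \<bullet> h) * g \<xi> * cis (\<xi> \<bullet> x)))"
      by (simp add: fun_eq_iff mult_ac)
    then show ?thesis by (simp add: synth_def scaleR_conv_of_real)
  qed
next
  fix h
  have "fourier_moment M 0 (symbol_deriv h g)"
    using fourier_moment_derivative(1)[of M 0 g h] assms by simp
  from synth_bound[OF this _ assms(2)] fourier_moment_derivative(2)[of M 0 g h] assms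
  show "norm (synth M (symbol_deriv h g) x) \<le> norm h * moment_norm M 1 g"
    by (auto intro: order_trans)
qed

text \<open>The second-order Taylor bound for \<open>cis\<close> makes the remainder at most the
  second moment times |h|^2, uniformly in the base point, so no dominated convergence is
  involved.\<close>

lemma synth_has_derivative:
  assumes m2: "fourier_moment M 2 g" and meas: "(\<lambda>\<xi>. \<xi>) \<in> borel_measurable M"
  shows "(synth M g has_derivative (\<lambda>h. synth M (symbol_deriv h g) x)) (at x)"
    (is "(_ has_derivative ?D) _")
proof (rule has_derivativeI_sandwich[of 1])
  note m1 = fourier_moment_mono(1)[OF m2 _ meas, of 1, simplified]
  note i = fourier_moment_integrable(1)[OF m2 _ meas, simplified]
  have md: "fourier_moment M 0 (symbol_deriv h g)" for h
    using fourier_moment_derivative(1)[of M 0 g h] m1 meas by simp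
  note id = fourier_moment_integrable(1)[OF md _ meas, simplified]
  let ?K = "moment_norm M 2 g"
  show "bounded_linear ?D" by (rule synth_derivative_linear[OF m1 meas])
  have rem: "cmod (synth M g (x + h) - synth M g x - ?D h) \<le> ?K * (norm h)\<^sup>2" for h
  proof -
    let ?r = "\<lambda>\<xi>. g \<xi> * cis (\<xi> \<bullet> (x + h)) - g \<xi> * cis (\<xi> \<bullet> x) - \<i> * complex_of_real (\<xi> \<bullet> h) * g \<xi> * cis (\<xi> \<bullet> x)"
    have "synth M g (x + h) - synth M g x - ?D h = (\<integral>\<xi>. ?r \<xi> \<partial>M)"
      unfolding synth_def
      by (subst Bochner_Integration.integral_diff Bochner_Integration.integral_diff;
          (intro Bochner_Integration.integrable_diff i id)?)+ simp
    also have "cmod \<dots> \<le> (\<integral>\<xi>. (norm h)\<^sup>2 * (weight \<xi> powr (2 / 2) * cmod (g \<xi>)) \<partial>M)"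
    proof (rule Bochner_Integration.integral_norm_bound_integral)
      show "integrable M ?r" by (intro Bochner_Integration.integrable_diff i id)
      show "integrable M (\<lambda>\<xi>. (norm h)\<^sup>2 * (weight \<xi> powr (2 / 2) * cmod (g \<xi>)))"
        using m2 by (intro integrable_mult_right) (simp add: fourier_moment_def)
      fix \<xi>
      have "?r \<xi> = g \<xi> * (cis (\<xi> \<bullet> x + \<xi> \<bullet> h) - cis (\<xi> \<bullet> x) - \<i> * (\<xi> \<bullet> h) * cis (\<xi> \<bullet> x))"
        by (simp add: algebra_simps inner_add_right)
      also have "cmod \<dots> \<le> cmod (g \<xi>) * (\<xi> \<bullet> h)\<^sup>2"
        unfolding norm_mult by (intro mult_left_mono norm_cis_taylor_le) auto
      also have "\<dots> \<le> cmod (g \<xi>) * ((1 + (norm \<xi>)\<^sup>2) * (norm h)\<^sup>2)"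
      proof (intro mult_left_mono)
        have "(\<xi> \<bullet> h)\<^sup>2 \<le> (norm \<xi>)\<^sup>2 * (norm h)\<^sup>2"
          using Cauchy_Schwarz_ineq[of \<xi> h] by (simp add: power2_norm_eq_inner)
        then show "(\<xi> \<bullet> h)\<^sup>2 \<le> (1 + (norm \<xi>)\<^sup>2) * (norm h)\<^sup>2"
          by (simp add: distrib_right add_increasing)
      qed auto
      finally show "cmod (?r \<xi>) \<le> (norm h)\<^sup>2 * (weight \<xi> powr (2 / 2) * cmod (g \<xi>))"
        by (simp add: mult_ac powr_one add_nonneg_nonneg)
    qed
    also have "\<dots> = ?K * (norm h)\<^sup>2" by (simp add: moment_norm_def)
    finally show ?thesis .
  qed
  show "((\<lambda>y. ?K * norm (y - x)) \<longlongrightarrow> 0) (at x)"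
    by (rule tendsto_eq_intros refl | simp)+
  fix y assume "y \<in> UNIV" "y \<noteq> x" "dist y x < 1"
  then show "norm (synth M g y - synth M g x - ?D (y - x)) / norm (y - x) \<le> ?K * norm (y - x)"
    using rem[of "y - x"] by (simp add: pos_divide_le_eq power2_eq_square mult.assoc)
qed auto

text \<open>Fubini moves the test function off the frequency side: the definition pairs
  \<open>g\<close> with the Fourier integral of \<phi>, whereas the fundamental lemma needs a
  function of x paired with \<phi> itself.\<close>

lemma synthesised_by_weak:
  assumes "synthesised_by \<Omega> f g" "fourier_moment (freq \<Omega>) 0 g" "test_function (region \<Omega>) \<phi>"
  shows "complex_of_real (\<integral>x. f x * \<phi> x \<partial>lborel) =
    (\<integral>x. synth (freq \<Omega>) g x * complex_of_real (\<phi> x) \<partial>lborel)"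
proof -
  let ?M = "freq \<Omega>"
  interpret S: sigma_finite_measure ?M by (rule sigma_finite_frequency)
  interpret pair_sigma_finite ?M lborel ..
  have gi: "integrable ?M g"
    using fourier_moment_integrable(2)[OF assms(2)] by simp
  have \<phi>i: "integrable lborel \<phi>" by (rule test_function_integrable[OF assms(3)])
  have [measurable]: "g \<in> borel_measurable ?M" "\<phi> \<in> borel_measurable borel"
    using gi \<phi>i by auto
  let ?f = "\<lambda>\<xi> x. g \<xi> * (cis (\<xi> \<bullet> x) * complex_of_real (\<phi> x))"
  have int: "integrable (?M \<Otimes>\<^sub>M lborel) (case_prod ?f)"
  proof (rule Fubini_integrable)
    show "case_prod ?f \<in> borel_measurable (?M \<Otimes>\<^sub>M lborel)" by measurable
    have "(\<lambda>\<xi>. \<integral>x. cmod (case_prod ?f (\<xi>, x)) \<partial>lborel) = (\<lambda>\<xi>. cmod (g \<xi>) * (\<integral>x. \<bar>\<phi> x\<bar> \<partial>lborel))"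
      by (simp add: norm_mult)
    then show "integrable ?M (\<lambda>\<xi>. \<integral>x. cmod (case_prod ?f (\<xi>, x)) \<partial>lborel)"
      using gi by simp
    show "AE \<xi> in ?M. integrable lborel (\<lambda>x. case_prod ?f (\<xi>, x))"
    proof (rule always_eventually, rule allI)
      fix \<xi>
      have "integrable lborel (\<lambda>x. ?f \<xi> x)"
        by (rule Bochner_Integration.integrable_bound[OF integrable_mult_right[OF \<phi>i, of "cmod (g \<xi>)"]])
          (auto simp: norm_mult)
      then show "integrable lborel (\<lambda>x. case_prod ?f (\<xi>, x))" by simp
    qed
  qed
  have "complex_of_real (\<integral>x. f x * \<phi> x \<partial>lborel) = (\<integral>\<xi>. g \<xi> * fourier_integral \<phi> \<xi> \<partial>?M)"
    using assms by (simp add: synthesised_by_def)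
  also have "\<dots> = (\<integral>\<xi>. (\<integral>x. ?f \<xi> x \<partial>lborel) \<partial>?M)"
    by (simp add: fourier_integral_def)
  also have "\<dots> = (\<integral>x. (\<integral>\<xi>. ?f \<xi> x \<partial>?M) \<partial>lborel)"
    by (rule Fubini_integral[OF int, symmetric])
  also have "\<dots> = (\<integral>x. synth ?M g x * complex_of_real (\<phi> x) \<partial>lborel)"
    by (simp add: synth_def mult.assoc[symmetric])
  finally show ?thesis .
qed

lemma open_region: "admissible_domain \<Omega> \<Longrightarrow> open (region \<Omega>)"
  by (cases \<Omega>) (auto simp: bounded_regular_domain_def)

text \<open>Both sides are continuous and agree when tested inside the region. On a bounded domain
  nothing is claimed outside, where the synthesised function is some extension of
  \<open>f\<close>.\<close>

lemma Hs_symbol_pointwise: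
  assumes "admissible_domain \<Omega>" "Hs_symbol \<Omega> s f g" "fourier_moment (freq \<Omega>) k g" "k \<ge> 1"
    "continuous_on (region \<Omega>) f" "x \<in> region \<Omega>"
  shows "synth (freq \<Omega>) g x = complex_of_real (f x)"
proof (rule fundamental_lemma_complex[OF open_region[OF assms(1)] assms(5)])
  show "continuous_on (region \<Omega>) (synth (freq \<Omega>) g)"
    by (rule synth_continuous_on[OF assms(3,4)]) simp
  have "fourier_moment (freq \<Omega>) 0 g"
    by (rule fourier_moment_mono(1)[OF assms(3)]) (use assms(4) in auto)
  then show "complex_of_real (\<integral>x. f x * \<phi> x \<partial>lborel) =
      (\<integral>x. synth (freq \<Omega>) g x * complex_of_real (\<phi> x) \<partial>lborel)"
    if "test_function (region \<Omega>) \<phi>" for \<phi>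
    using assms(2) by (intro synthesised_by_weak that) (simp_all add: Hs_symbol_def)
qed (rule assms)

section \<open>Sobolev regularity\<close>

lemma Hs_symbol_moment:
  assumes "Hs_symbol \<Omega> s f g" "s - k > 3/2"
  shows "fourier_moment (freq \<Omega>) k g"
  by (rule Sobolev_moment[OF assms(2), of \<Omega>]) (use assms(1) in blast)

lemma Re_synth_has_derivative:
  assumes "fourier_moment M 2 g" "(\<lambda>\<xi>. \<xi>) \<in> borel_measurable M"
  shows "((\<lambda>x. Re (synth M g x)) has_derivative (\<lambda>h. Re (synth M (symbol_deriv h g) x))) (at x)"
  by (rule bounded_linear.has_derivative[OF bounded_linear_Re synth_has_derivative[OF assms]])

lemma has_derivative_cart:
  fixes f :: "'a::real_normed_vector \<Rightarrow> real^'n"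
  assumes "\<And>i. ((\<lambda>x. f x $ i) has_derivative (\<lambda>h. f' h $ i)) F"
  shows "(f has_derivative f') F"
proof -
  have e: "x = (\<Sum>i\<in>UNIV. x $ i *\<^sub>R axis i 1)" for x :: "real^'n"
    using basis_expansion[of x] by (simp add: scalar_mult_eq_scaleR)
  have "((\<lambda>x. \<Sum>i\<in>UNIV. f x $ i *\<^sub>R axis i 1) has_derivative (\<lambda>h. \<Sum>i\<in>UNIV. f' h $ i *\<^sub>R (axis i 1 :: real^'n))) F"
    by (intro has_derivative_sum has_derivative_scaleR_left assms)
  then show ?thesis using e by simp
qed

lemma jacobian_component:
  assumes "(F has_derivative F') (at x)"
  shows "jacobian F (at x) $ i $ j = F' (axis j 1) $ i"
  using frechet_derivative_at[OF assms] by (simp add: jacobian_def matrix_def)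

lemma norm_le_of_components:
  fixes y :: "real^'n"
  assumes "\<And>i. \<bar>y $ i\<bar> \<le> c"
  shows "norm y \<le> real CARD('n) * c"
proof -
  have "norm y \<le> (\<Sum>i\<in>UNIV. \<bar>y $ i\<bar>)" by (rule norm_le_l1_cart)
  also have "\<dots> \<le> (\<Sum>i\<in>(UNIV::'n set). c)" by (intro sum_mono assms)
  finally show ?thesis by simp
qed

text \<open>All estimates are stated with the same second moment, so that one small number controls
  a field and its first derivatives. The Lipschitz bound is inherited from the synthesised function
  on the whole space and therefore holds on an \<open>U\<close> that need not be convex.\<close>

lemma synth_field:
  fixes F :: "real^3 \<Rightarrow> real^3"
  assumes U: "open U" and meas: "(\<lambda>\<xi>. \<xi>) \<in> borel_measurable M"
    and m: "\<And>i. fourier_moment M 2 (g i)"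
    and F: "\<forall>x\<in>U. \<forall>i. F x $ i = Re (synth M (g i) x)"
  shows synth_field_differentiable: "\<And>x. x \<in> U \<Longrightarrow> F differentiable (at x)"
    and synth_field_jacobian: "\<And>x i j. x \<in> U \<Longrightarrow>
      jacobian F (at x) $ i $ j = Re (synth M (symbol_deriv (axis j 1) (g i)) x)"
    and synth_field_jacobian_continuous: "\<And>i j. continuous_on U (\<lambda>x. jacobian F (at x) $ i $ j)"
    and synth_field_bound: "\<And>x i. x \<in> U \<Longrightarrow> \<bar>F x $ i\<bar> \<le> moment_norm M 2 (g i)"
    and synth_field_jacobian_bound: "\<And>x i j. x \<in> U \<Longrightarrow> \<bar>jacobian F (at x) $ i $ j\<bar> \<le> moment_norm M 2 (g i)"
    and synth_field_lipschitz: "\<And>x y i. x \<in> U \<Longrightarrow> y \<in> U \<Longrightarrow> \<bar>F x $ i - F y $ i\<bar> \<le> moment_norm M 2 (g i) * norm (x - y)"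
proof -
  note m1 = fourier_moment_mono(1)[OF m _ meas, of 1, simplified]
  note n1 = fourier_moment_mono(2)[OF m _ meas, of 1, simplified]
  have d: "(F has_derivative (\<lambda>h. \<chi> i. Re (synth M (symbol_deriv h (g i)) x))) (at x)"
    if "x \<in> U" for x
  proof (rule has_derivative_cart, unfold vec_lambda_beta)
    fix i
    show "((\<lambda>x. F x $ i) has_derivative (\<lambda>h. Re (synth M (symbol_deriv h (g i)) x))) (at x)"
      by (rule has_derivative_transform_within_open[OF Re_synth_has_derivative[OF m meas] U that]) (simp add: F[rule_format])
  qed
  show "F differentiable (at x)" if "x \<in> U" for x using d[OF that] by (auto simp: differentiable_def)
  show j: "jacobian F (at x) $ i $ j = Re (synth M (symbol_deriv (axis j 1) (g i)) x)"
    if "x \<in> U" for x i j using jacobian_component[OF d[OF that]] by simp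
  have md: "fourier_moment M 1 (symbol_deriv (axis j 1) (g i))"
    and nd: "moment_norm M 1 (symbol_deriv (axis j 1) (g i)) \<le> moment_norm M 2 (g i)" for i j
    using fourier_moment_derivative[of M 1 "g i" "axis j 1"] m meas by simp_all
  have "continuous_on U (\<lambda>x. Re (synth M (symbol_deriv (axis j 1) (g i)) x))" for i j
    by (intro continuous_on_Re synth_continuous_on[OF md _ meas]) simp
  then show "continuous_on U (\<lambda>x. jacobian F (at x) $ i $ j)" for i j
    by (rule continuous_on_eq) (simp add: j)
  show "\<bar>F x $ i\<bar> \<le> moment_norm M 2 (g i)" if "x \<in> U" for x i
    using F[rule_format, OF that] order_trans[OF abs_Re_le_cmod synth_bound[OF m _ meas]] by simp
  show "\<bar>jacobian F (at x) $ i $ j\<bar> \<le> moment_norm M 2 (g i)" if "x \<in> U" for x i j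
    unfolding j[OF that] using order_trans[OF abs_Re_le_cmod order_trans[OF synth_bound[OF md _ meas] nd]] by simp
  show "\<bar>F x $ i - F y $ i\<bar> \<le> moment_norm M 2 (g i) * norm (x - y)" if "x \<in> U" "y \<in> U" for x y i
  proof -
    have "\<bar>F x $ i - F y $ i\<bar> \<le> cmod (synth M (g i) x - synth M (g i) y)"
      using abs_Re_le_cmod[of "synth M (g i) x - synth M (g i) y"] by (simp add: F[rule_format] that)
    also have "\<dots> \<le> moment_norm M 1 (g i) * norm (x - y)" by (rule synth_lipschitz[OF m1 meas])
    also have "\<dots> \<le> moment_norm M 2 (g i) * norm (x - y)" by (intro mult_right_mono n1) auto
    finally show ?thesis .
  qed
qed

section \<open>Linear combinations of Sobolev functions\<close>

lemma fourier_integral_measurable: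
  assumes "test_function D \<phi>"
  shows "fourier_integral \<phi> \<in> borel_measurable (freq \<Omega>)"
proof -
  have [measurable]: "\<phi> \<in> borel_measurable borel"
    by (rule borel_measurable_continuous_onI[OF test_function_continuous[OF assms]])
  have "fourier_integral \<phi> \<in> borel_measurable borel"
    unfolding fourier_integral_def[abs_def] by (intro lborel.borel_measurable_lebesgue_integral) measurable
  then show ?thesis
    using measurable_compose[OF measurable_frequency] by blast
qed

lemma fourier_pairing_integrable:
  assumes "fourier_moment (freq \<Omega>) 0 g" "test_function D \<phi>"
  shows "integrable (freq \<Omega>) (\<lambda>\<xi>. g \<xi> * fourier_integral \<phi> \<xi>)"
proof -
  have gi: "integrable (freq \<Omega>) g"
    using fourier_moment_integrable(2)[OF assms(1)] by simp
  note [measurable] = borel_measurable_integrable[OF gi] fourier_integral_measurable[OF assms(2)]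
  have b: "cmod (fourier_integral \<phi> \<xi>) \<le> (\<integral>x. \<bar>\<phi> x\<bar> \<partial>lborel)" for \<xi>
    unfolding fourier_integral_def
    by (rule order_trans[OF integral_norm_bound]) (simp add: norm_mult)
  show ?thesis
    by (rule Bochner_Integration.integrable_bound[OF integrable_mult_left[OF integrable_norm[OF gi], of "\<integral>x. \<bar>\<phi> x\<bar> \<partial>lborel"]])
      (auto simp: norm_mult intro!: mult_left_mono order_trans[OF b])
qed

text \<open>The bound s > 3/2 makes the symbols integrable, hence their pairings with test functions
  too, and only then may the frequency integral of a sum be split.\<close>

lemma Hs_symbol_combination:
  assumes "Hs_symbol \<Omega> s f g" "Hs_symbol \<Omega> s f' g'" "s > 3/2"
    and loc: "locally_integrable_on (region \<Omega>) f" "locally_integrable_on (region \<Omega>) f'"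
  shows "Hs_symbol \<Omega> s (\<lambda>x. a * f x + b * f' x) (\<lambda>\<xi>. complex_of_real a * g \<xi> + complex_of_real b * g' \<xi>)"
proof -
  let ?M = "freq \<Omega>"
  have [measurable]: "g \<in> borel_measurable ?M" "g' \<in> borel_measurable ?M"
    using assms by (auto simp: Hs_symbol_def)
  let ?w = "\<lambda>\<xi>::real^3. weight \<xi> powr s"
  have m: "fourier_moment ?M 0 g" "fourier_moment ?M 0 g'"
    using Hs_symbol_moment[OF assms(1), of 0] Hs_symbol_moment[OF assms(2), of 0] assms(3) by simp_all
  have i: "integrable ?M (\<lambda>\<xi>. 2 * a\<^sup>2 * (?w \<xi> * (cmod (g \<xi>))\<^sup>2) + 2 * b\<^sup>2 * (?w \<xi> * (cmod (g' \<xi>))\<^sup>2))"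
    using assms by (intro Bochner_Integration.integrable_add integrable_mult_right) (auto simp: Hs_symbol_def)
  have "integrable ?M (\<lambda>\<xi>. ?w \<xi> * (cmod (complex_of_real a * g \<xi> + complex_of_real b * g' \<xi>))\<^sup>2)"
  proof (rule Bochner_Integration.integrable_bound[OF i])
    show "AE \<xi> in ?M. norm (?w \<xi> * (cmod (complex_of_real a * g \<xi> + complex_of_real b * g' \<xi>))\<^sup>2)
      \<le> norm (2 * a\<^sup>2 * (?w \<xi> * (cmod (g \<xi>))\<^sup>2) + 2 * b\<^sup>2 * (?w \<xi> * (cmod (g' \<xi>))\<^sup>2))"
    proof (intro always_eventually allI)
      fix \<xi>
      let ?p = "cmod (complex_of_real a * g \<xi>)" and ?q = "cmod (complex_of_real b * g' \<xi>)"
      have "(cmod (complex_of_real a * g \<xi> + complex_of_real b * g' \<xi>))\<^sup>2 \<le> (?p + ?q)\<^sup>2"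
        by (intro power_mono norm_triangle_ineq) simp
      also have "\<dots> \<le> 2 * ?p\<^sup>2 + 2 * ?q\<^sup>2"
        using zero_le_power2[of "?p - ?q"] by (simp add: power2_diff power2_sum)
      also have "\<dots> = 2 * a\<^sup>2 * (cmod (g \<xi>))\<^sup>2 + 2 * b\<^sup>2 * (cmod (g' \<xi>))\<^sup>2"
        by (simp add: norm_mult power_mult_distrib)
      finally have "?w \<xi> * (cmod (complex_of_real a * g \<xi> + complex_of_real b * g' \<xi>))\<^sup>2 \<le>
        ?w \<xi> * (2 * a\<^sup>2 * (cmod (g \<xi>))\<^sup>2 + 2 * b\<^sup>2 * (cmod (g' \<xi>))\<^sup>2)"
        by (rule mult_left_mono) simp
      then show "norm (?w \<xi> * (cmod (complex_of_real a * g \<xi> + complex_of_real b * g' \<xi>))\<^sup>2)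
        \<le> norm (2 * a\<^sup>2 * (?w \<xi> * (cmod (g \<xi>))\<^sup>2) + 2 * b\<^sup>2 * (?w \<xi> * (cmod (g' \<xi>))\<^sup>2))"
        by (simp add: algebra_simps)
    qed
  qed measurable
  moreover have "synthesised_by \<Omega> (\<lambda>x. a * f x + b * f' x) (\<lambda>\<xi>. complex_of_real a * g \<xi> + complex_of_real b * g' \<xi>)"
    unfolding synthesised_by_def
  proof (intro allI impI)
    fix \<phi> assume \<phi>: "test_function (region \<Omega>) \<phi>"
    have "(\<integral>x. (a * f x + b * f' x) * \<phi> x \<partial>lborel) = (\<integral>x. a * (f x * \<phi> x) + b * (f' x * \<phi> x) \<partial>lborel)"
      by (simp add: algebra_simps)
    also have "\<dots> = a * (\<integral>x. f x * \<phi> x \<partial>lborel) + b * (\<integral>x. f' x * \<phi> x \<partial>lborel)"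
      using locally_integrable_on_test_function[OF loc(1) \<phi>] locally_integrable_on_test_function[OF loc(2) \<phi>] by simp
    finally have 1: "(\<integral>x. (a * f x + b * f' x) * \<phi> x \<partial>lborel) = a * (\<integral>x. f x * \<phi> x \<partial>lborel) + b * (\<integral>x. f' x * \<phi> x \<partial>lborel)" .
    have "(\<integral>\<xi>. (complex_of_real a * g \<xi> + complex_of_real b * g' \<xi>) * fourier_integral \<phi> \<xi> \<partial>?M)
      = (\<integral>\<xi>. complex_of_real a * (g \<xi> * fourier_integral \<phi> \<xi>) + complex_of_real b * (g' \<xi> * fourier_integral \<phi> \<xi>) \<partial>?M)"
      by (simp add: algebra_simps)
    also have "\<dots> = complex_of_real a * (\<integral>\<xi>. g \<xi> * fourier_integral \<phi> \<xi> \<partial>?M) + complex_of_real b * (\<integral>\<xi>. g' \<xi> * fourier_integral \<phi> \<xi> \<partial>?M)"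
      using fourier_pairing_integrable[OF m(1) \<phi>] fourier_pairing_integrable[OF m(2) \<phi>] by simp
    finally show "complex_of_real (\<integral>x. (a * f x + b * f' x) * \<phi> x \<partial>lborel) =
      (\<integral>\<xi>. (complex_of_real a * g \<xi> + complex_of_real b * g' \<xi>) * fourier_integral \<phi> \<xi> \<partial>?M)"
      using assms(1,2) \<phi> unfolding 1 by (simp add: Hs_symbol_def synthesised_by_def)
  qed
  ultimately show ?thesis by (simp add: Hs_symbol_def)
qed

lemma locally_integrable_on_combination:
  assumes "locally_integrable_on D f" "locally_integrable_on D f'"
  shows "locally_integrable_on D (\<lambda>x. a * f x + b * f' x)"
  using assms unfolding locally_integrable_on_def
  by (auto intro!: set_integral_add set_integrable_mult_right)

lemma in_Hs_combination:
  assumes "in_Hs \<Omega> s f" "in_Hs \<Omega> s f'" "s > 3/2"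
  shows "in_Hs \<Omega> s (\<lambda>x. a * f x + b * f' x)"
proof -
  obtain g g' where g: "Hs_symbol \<Omega> s f g" "Hs_symbol \<Omega> s f' g'"
    using assms(1,2) unfolding in_Hs_def by blast
  have loc: "locally_integrable_on (region \<Omega>) f" "locally_integrable_on (region \<Omega>) f'"
    using assms(1,2) unfolding in_Hs_def by blast+
  show ?thesis
    unfolding in_Hs_def
    using Hs_symbol_combination[OF g assms(3) loc] locally_integrable_on_combination[OF loc] by blast
qed

lemma in_Hs_vec_combination:
  assumes "in_Hs_vec \<Omega> s f" "in_Hs_vec \<Omega> s f'" "s > 3/2"
  shows "in_Hs_vec \<Omega> s (\<lambda>x. a *\<^sub>R f x + b *\<^sub>R f' x)"
  using assms in_Hs_combination[of \<Omega> s _ _ a b] unfolding in_Hs_vec_def by simp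

section \<open>Sobolev estimates and their uniformity in time\<close>

lemma Hs_symbol_of_norm_less:
  assumes "in_Hs_vec \<Omega> s f" "Hs_norm_vec \<Omega> s f < e"
  shows "\<exists>g. \<forall>i. Hs_symbol \<Omega> s (\<lambda>x. f x $ i) (g i) \<and>
    sqrt (\<integral>\<xi>. weight \<xi> powr s * (cmod (g i \<xi>))\<^sup>2 \<partial>freq \<Omega>) < e"
proof (intro choice allI)
  fix i
  let ?S = "{sqrt (\<integral>\<xi>. weight \<xi> powr s * (cmod (g \<xi>))\<^sup>2 \<partial>freq \<Omega>) | g. Hs_symbol \<Omega> s (\<lambda>x. f x $ i) g}"
  have "Inf ?S \<le> Hs_norm_vec \<Omega> s f"
    unfolding Hs_norm_vec_def Hs_norm_def by (rule member_le_L2_set) auto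
  then have "Inf ?S < e" using assms(2) by simp
  \<comment> \<open>A near-minimiser exists only because the set of symbols is nonempty, which is
    what membership in H^s provides.\<close>
  moreover have "?S \<noteq> {}" using assms(1) unfolding in_Hs_vec_def in_Hs_def by blast
  ultimately obtain z where "z \<in> ?S" "z < e" using cInf_lessD[of ?S e] by blast
  then show "\<exists>g. Hs_symbol \<Omega> s (\<lambda>x. f x $ i) g \<and>
    sqrt (\<integral>\<xi>. weight \<xi> powr s * (cmod (g \<xi>))\<^sup>2 \<partial>freq \<Omega>) < e" by blast
qed

text \<open>\<open>Hs_norm\<close> is an infimum over symbols, which on a bounded domain are not unique; hence the bound
  comes with a symbol \<open>g\<close> depending on \<open>e\<close>.\<close>

lemma Sobolev_embedding:
  fixes \<Omega> s
  assumes s: "s > 7/2"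
  obtains C where "C > 0" "\<And>f e. in_Hs_vec \<Omega> s f \<Longrightarrow> Hs_norm_vec \<Omega> s f < e \<Longrightarrow>
    \<exists>g. (\<forall>i. Hs_symbol \<Omega> s (\<lambda>x. f x $ i) (g i)) \<and>
      (\<forall>i. fourier_moment (freq \<Omega>) 2 (g i) \<and> moment_norm (freq \<Omega>) 2 (g i) \<le> C * e)"
proof -
  obtain C where C: "C \<ge> 0"
    "\<And>f g. Hs_symbol \<Omega> s f g \<Longrightarrow> fourier_moment (freq \<Omega>) 2 g"
    "\<And>f g. Hs_symbol \<Omega> s f g \<Longrightarrow> moment_norm (freq \<Omega>) 2 g
      \<le> C * sqrt (\<integral>\<xi>. weight \<xi> powr s * (cmod (g \<xi>))\<^sup>2 \<partial>freq \<Omega>)"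
    by (rule Sobolev_moment[of s 2 \<Omega>]) (use s in auto)
  show ?thesis
  \<comment> \<open>The summand 1 makes the constant positive, so that a tolerance can later be
    divided by it.\<close>
  proof (rule that[of "C + 1"])
    fix f :: "real^3 \<Rightarrow> real^3" and e assume f: "in_Hs_vec \<Omega> s f" "Hs_norm_vec \<Omega> s f < e"
    obtain g where g: "\<And>i. Hs_symbol \<Omega> s (\<lambda>x. f x $ i) (g i)"
      "\<And>i. sqrt (\<integral>\<xi>. weight \<xi> powr s * (cmod (g i \<xi>))\<^sup>2 \<partial>freq \<Omega>) < e"
      using Hs_symbol_of_norm_less[OF f] by blast
    have "moment_norm (freq \<Omega>) 2 (g i) \<le> (C + 1) * e" for i
    proof -
      let ?q = "sqrt (\<integral>\<xi>. weight \<xi> powr s * (cmod (g i \<xi>))\<^sup>2 \<partial>freq \<Omega>)"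
      have "?q \<ge> 0" by (intro real_sqrt_ge_zero integral_nonneg_AE) auto
      then have "C * ?q \<le> (C + 1) * e"
        using g(2)[of i] C(1) by (intro mult_mono) auto
      then show ?thesis using C(3)[OF g(1)[of i]] by linarith
    qed
    then show "\<exists>g. (\<forall>i. Hs_symbol \<Omega> s (\<lambda>x. f x $ i) (g i)) \<and>
      (\<forall>i. fourier_moment (freq \<Omega>) 2 (g i) \<and> moment_norm (freq \<Omega>) 2 (g i) \<le> (C + 1) * e)"
      using g(1) C(2) by blast
  qed (use C in simp)
qed

text \<open>The Lipschitz clause is listed separately because on a nonconvex \<open>U\<close> it
  does not follow, with the same constant, from the bound on the gradient.\<close>

abbreviation C1_bound :: "(real^3) set \<Rightarrow> (real^3 \<Rightarrow> real^3) \<Rightarrow> real \<Rightarrow> bool" where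
  "C1_bound U f c \<equiv>
     (\<forall>x\<in>U. \<forall>i j. \<bar>f x $ i\<bar> \<le> c \<and> \<bar>jacobian f (at x) $ i $ j\<bar> \<le> c) \<and>
     (\<forall>x\<in>U. \<forall>y\<in>U. \<forall>i. \<bar>f x $ i - f y $ i\<bar> \<le> c * norm (x - y))"

lemma Sobolev_estimate:
  fixes \<Omega> s
  assumes adm: "admissible_domain \<Omega>" and s: "s > 7/2"
  obtains C where "C > 0" "\<And>f e. in_Hs_vec \<Omega> s f \<Longrightarrow> Hs_norm_vec \<Omega> s f < e \<Longrightarrow> continuous_on (region \<Omega>) f \<Longrightarrow>
      C1_bound (region \<Omega>) f (C * e)"
proof -
  obtain C where C: "C > 0" "\<And>f e. in_Hs_vec \<Omega> s f \<Longrightarrow> Hs_norm_vec \<Omega> s f < e \<Longrightarrow>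
    \<exists>g. (\<forall>i. Hs_symbol \<Omega> s (\<lambda>x. f x $ i) (g i)) \<and>
      (\<forall>i. fourier_moment (freq \<Omega>) 2 (g i) \<and> moment_norm (freq \<Omega>) 2 (g i) \<le> C * e)"
    by (rule Sobolev_embedding[OF s]) (rule that)
  show ?thesis
  proof (rule that[OF C(1)])
    fix f :: "real^3 \<Rightarrow> real^3" and e
    assume f: "in_Hs_vec \<Omega> s f" "Hs_norm_vec \<Omega> s f < e" and cont: "continuous_on (region \<Omega>) f"
    obtain g where g: "\<And>i. Hs_symbol \<Omega> s (\<lambda>x. f x $ i) (g i)"
      "\<And>i. fourier_moment (freq \<Omega>) 2 (g i)" "\<And>i. moment_norm (freq \<Omega>) 2 (g i) \<le> C * e"
      using C(2)[OF f] by blast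
    have F: "\<forall>x\<in>region \<Omega>. \<forall>i. f x $ i = Re (synth (freq \<Omega>) (g i) x)"
      using Hs_symbol_pointwise[OF adm g(1) g(2) _ continuous_on_component[OF cont]] by simp
    note syn = synth_field[OF open_region[OF adm] measurable_frequency g(2) F]
    show "C1_bound (region \<Omega>) f (C * e)"
    proof (intro conjI ballI allI)
      show "\<bar>f x $ i\<bar> \<le> C * e" "\<bar>jacobian f (at x) $ i $ j\<bar> \<le> C * e" if "x \<in> region \<Omega>" for x i j
        using order_trans[OF syn(4)[OF that] g(3)] order_trans[OF syn(5)[OF that] g(3)] by auto
      show "\<bar>f x $ i - f y $ i\<bar> \<le> C * e * norm (x - y)" if "x \<in> region \<Omega>" "y \<in> region \<Omega>" for x y i
        by (rule order_trans[OF syn(6)[OF that] mult_right_mono[OF g(3) norm_ge_zero]])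
    qed
  qed
qed

text \<open>Here s > 9/2 is spent in full: of the three moments, one is used up by the gradient and
  the remaining two by \<open>synth_has_derivative\<close> applied to it.\<close>

lemma Hs_gradient_differentiable:
  assumes adm: "admissible_domain \<Omega>" and s: "s > 9/2"
    and f: "in_Hs_vec \<Omega> s f" "continuous_on (region \<Omega>) f" and x: "x \<in> region \<Omega>"
  shows "(\<lambda>y. jacobian f (at y) $ i $ j) differentiable (at x)"
proof -
  let ?M = "freq \<Omega>"
  obtain g where g: "\<And>i. Hs_symbol \<Omega> s (\<lambda>x. f x $ i) (g i)"
    using f(1) unfolding in_Hs_vec_def in_Hs_def by metis
  have m3: "fourier_moment ?M 3 (g i)" for i
    using Hs_symbol_moment[OF g, of 3] s by simp
  have m2: "fourier_moment ?M 2 (g i)" for i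
    using fourier_moment_mono(1)[OF m3] by simp
  have F: "\<forall>x\<in>region \<Omega>. \<forall>i. f x $ i = Re (synth ?M (g i) x)"
    using Hs_symbol_pointwise[OF adm g m2 _ continuous_on_component[OF f(2)]] by simp
  note j = synth_field_jacobian[OF open_region[OF adm] measurable_frequency m2 F]
  have "fourier_moment ?M 2 (symbol_deriv (axis j 1) (g i))"
    using fourier_moment_derivative(1)[of ?M 2 "g i" "axis j 1"] m3 by simp
  from Re_synth_has_derivative[OF this measurable_frequency, of x]
  have "((\<lambda>y. jacobian f (at y) $ i $ j) has_derivative
      (\<lambda>h. Re (synth ?M (symbol_deriv h (symbol_deriv (axis j 1) (g i))) x))) (at x)"
    by (rule has_derivative_transform_within_open[OF _ open_region[OF adm] x]) (simp add: j)
  then show ?thesis by (auto simp: differentiable_def)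
qed

lemma Hs_differentiable:
  assumes adm: "admissible_domain \<Omega>" and s: "s > 7/2"
    and f: "in_Hs_vec \<Omega> s f" "continuous_on (region \<Omega>) f" and x: "x \<in> region \<Omega>"
  shows "f differentiable (at x)"
proof -
  let ?M = "freq \<Omega>"
  obtain g where g: "\<And>i. Hs_symbol \<Omega> s (\<lambda>x. f x $ i) (g i)"
    using f(1) unfolding in_Hs_vec_def in_Hs_def by metis
  have m2: "fourier_moment ?M 2 (g i)" for i
    using Hs_symbol_moment[OF g, of 2] s by simp
  have F: "\<forall>x\<in>region \<Omega>. \<forall>i. f x $ i = Re (synth ?M (g i) x)"
    using Hs_symbol_pointwise[OF adm g m2 _ continuous_on_component[OF f(2)]] by simp
  show ?thesis by (rule synth_field_differentiable[OF open_region[OF adm] measurable_frequency m2 F x])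
qed

lemma jacobian_linear_combination:
  fixes f f' :: "real^'n \<Rightarrow> real^'m"
  assumes "f differentiable (at x)" "f' differentiable (at x)"
  shows "jacobian (\<lambda>x. a *\<^sub>R f x + b *\<^sub>R f' x) (at x) = a *\<^sub>R jacobian f (at x) + b *\<^sub>R jacobian f' (at x)"
proof -
  have "((\<lambda>x. a *\<^sub>R f x + b *\<^sub>R f' x) has_derivative
      (\<lambda>h. a *\<^sub>R frechet_derivative f (at x) h + b *\<^sub>R frechet_derivative f' (at x) h)) (at x)"
    using assms frechet_derivative_works by (intro derivative_intros) auto
  then show ?thesis
    by (simp add: vec_eq_iff jacobian_component) (simp add: jacobian_def matrix_def)
qed

text \<open>The Sobolev estimate is applied to the difference u(\<tau>) - u(t), whose norm is
  eventually below \<open>e / C\<close>. The last clause says that this difference has a small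
  Lipschitz constant, so Lipschitz constants at nearby times are comparable.\<close>

lemma eventually_uniform_in_time:
  assumes adm: "admissible_domain \<Omega>" and s: "s > 9/2" and C0: "C0_Hs J \<Omega> s u"
    and cont: "\<forall>t\<in>J. continuous_on (region \<Omega>) (u t)" and t: "t \<in> J" and e: "e > 0"
  shows "\<forall>\<^sub>F \<tau> in at t within J. \<tau> \<in> J \<and> (\<forall>x\<in>region \<Omega>. \<forall>i j. \<bar>u \<tau> x $ i - u t x $ i\<bar> \<le> e \<and>
      \<bar>vel_grad u \<tau> x $ i $ j - vel_grad u t x $ i $ j\<bar> \<le> e) \<and>
    (\<forall>x\<in>region \<Omega>. \<forall>y\<in>region \<Omega>. \<forall>i. \<bar>(u \<tau> x $ i - u t x $ i) - (u \<tau> y $ i - u t y $ i)\<bar> \<le> e * norm (x - y))"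
proof -
  obtain C where C: "C > 0" "\<And>f e. in_Hs_vec \<Omega> s f \<Longrightarrow> Hs_norm_vec \<Omega> s f < e \<Longrightarrow> continuous_on (region \<Omega>) f \<Longrightarrow>
      C1_bound (region \<Omega>) f (C * e)"
    by (rule Sobolev_estimate[OF adm, of s]) (use s in auto)
  have H: "in_Hs_vec \<Omega> s (u \<tau>)" if "\<tau> \<in> J" for \<tau> using C0 that by (simp add: C0_Hs_def)
  have lim: "((\<lambda>\<tau>. Hs_norm_vec \<Omega> s (\<lambda>x. u \<tau> x - u t x)) \<longlongrightarrow> 0) (at t within J)"
    using C0 t by (simp add: C0_Hs_def)
  have "\<forall>\<^sub>F \<tau> in at t within J. Hs_norm_vec \<Omega> s (\<lambda>x. u \<tau> x - u t x) < e / C"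
    by (rule order_tendstoD(2)[OF lim]) (use C e in simp)
  moreover have "\<forall>\<^sub>F \<tau> in at t within J. \<tau> \<in> J" by (auto simp: eventually_at_filter)
  ultimately show ?thesis
  proof eventually_elim
    case (elim \<tau>)
    have ce: "C * (e / C) = e" using C(1) by simp
    have d: "u \<sigma> differentiable (at x)" if "\<sigma> \<in> J" "x \<in> region \<Omega>" for \<sigma> x
      using Hs_differentiable[OF adm _ H[OF that(1)] cont[rule_format, OF that(1)] that(2)] s by simp
    have j: "jacobian (\<lambda>x. u \<tau> x - u t x) (at x) = vel_grad u \<tau> x - vel_grad u t x" if "x \<in> region \<Omega>" for x
      using jacobian_linear_combination[OF d[OF elim(2) that] d[OF t that], of 1 "-1"] by (simp add: vel_grad_def)
    have "in_Hs_vec \<Omega> s (\<lambda>x. u \<tau> x - u t x)"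
      using in_Hs_vec_combination[OF H[OF elim(2)] H[OF t], of 1 "-1"] s by simp
    moreover have "continuous_on (region \<Omega>) (\<lambda>x. u \<tau> x - u t x)"
      by (intro continuous_intros cont[rule_format] elim t)
    ultimately show ?case
      using C(2)[OF _ elim(1), unfolded ce] elim(2) by (simp add: j)
  qed
qed

text \<open>Near each time the Lipschitz constant increases by at most 1, and finitely many such
  neighbourhoods cover \<open>J\<close>. Working with the constants themselves avoids a triangle
  inequality for \<open>Hs_norm\<close>, which is an infimum.\<close>

lemma uniformly_lipschitz_in_time:
  assumes adm: "admissible_domain \<Omega>" and s: "s > 9/2" and C0: "C0_Hs J \<Omega> s u"
    and cont: "\<forall>t\<in>J. continuous_on (region \<Omega>) (u t)" and J: "compact J"
  obtains L where "L \<ge> 0" "\<And>t x y. t \<in> J \<Longrightarrow> x \<in> region \<Omega> \<Longrightarrow> y \<in> region \<Omega> \<Longrightarrow> norm (u t x - u t y) \<le> L * norm (x - y)"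
proof -
  define Q where "Q L \<tau> \<longleftrightarrow> (\<forall>x\<in>region \<Omega>. \<forall>y\<in>region \<Omega>. \<forall>i. \<bar>u \<tau> x $ i - u \<tau> y $ i\<bar> \<le> L * norm (x - y))" for L \<tau>
  have mono: "Q L' \<tau>" if "Q L \<tau>" "L \<le> L'" for L L' \<tau>
    using that unfolding Q_def by (meson mult_right_mono norm_ge_zero order_trans)
  have "\<exists>L. Q L t" if t: "t \<in> J" for t
  proof -
    have s': "s > 7/2" using s by simp
    obtain C where C: "\<And>f e. in_Hs_vec \<Omega> s f \<Longrightarrow> Hs_norm_vec \<Omega> s f < e \<Longrightarrow> continuous_on (region \<Omega>) f \<Longrightarrow>
      C1_bound (region \<Omega>) f (C * e)"
      by (rule Sobolev_estimate[OF adm s']) (rule that)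
    show ?thesis
      using C[of "u t" "Hs_norm_vec \<Omega> s (u t) + 1"] C0 t cont[rule_format, OF t] unfolding Q_def C0_Hs_def by auto
  qed
  then obtain l where l: "\<And>t. t \<in> J \<Longrightarrow> Q (l t) t" by metis
  have "\<exists>N. open N \<and> t \<in> N \<and> (\<forall>\<tau>\<in>N \<inter> J. Q (l t + 1) \<tau>)" if t: "t \<in> J" for t
  proof -
    have "\<forall>\<^sub>F \<tau> in at t within J. Q (l t + 1) \<tau>"
      using eventually_uniform_in_time[OF adm s C0 cont t zero_less_one]
    proof eventually_elim
      case (elim \<tau>)
      show ?case unfolding Q_def
      proof (intro ballI allI)
        fix x y i assume xy: "x \<in> region \<Omega>" "y \<in> region \<Omega>"
        have "\<bar>(u \<tau> x $ i - u t x $ i) - (u \<tau> y $ i - u t y $ i)\<bar> \<le> 1 * norm (x - y)" using elim xy by blast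
        moreover have "\<bar>u t x $ i - u t y $ i\<bar> \<le> l t * norm (x - y)" using l[OF t] xy unfolding Q_def by blast
        ultimately show "\<bar>u \<tau> x $ i - u \<tau> y $ i\<bar> \<le> (l t + 1) * norm (x - y)"
          by (simp add: distrib_right)
      qed
    qed
    then obtain N where N: "open N" "t \<in> N" "\<forall>\<tau>\<in>N. \<tau> \<noteq> t \<longrightarrow> \<tau> \<in> J \<longrightarrow> Q (l t + 1) \<tau>"
      unfolding eventually_at_topological by blast
    have "Q (l t + 1) t" using mono[OF l[OF t]] by simp
    then show ?thesis using N by (intro exI[of _ N]) auto
  qed
  then obtain N where N: "\<And>t. t \<in> J \<Longrightarrow> open (N t) \<and> t \<in> N t \<and> (\<forall>\<tau>\<in>N t \<inter> J. Q (l t + 1) \<tau>)" by metis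
  obtain J' where J': "J' \<subseteq> J" "finite J'" "J \<subseteq> (\<Union>t\<in>J'. N t)"
    using compactE_image[OF J, of J N] N by blast
  \<comment> \<open>The sum of nonnegative local constants serves as their maximum.\<close>
  define L where "L = (\<Sum>t\<in>J'. \<bar>l t\<bar> + 1)"
  have QL: "Q L \<tau>" if \<tau>: "\<tau> \<in> J" for \<tau>
  proof -
    obtain t where t: "t \<in> J'" "\<tau> \<in> N t" using J' \<tau> by blast
    have "l t + 1 \<le> \<bar>l t\<bar> + 1" by simp
    also have "\<dots> \<le> L" unfolding L_def by (rule member_le_sum[OF t(1) _ J'(2)]) simp
    finally show ?thesis using mono N t J' \<tau> by blast
  qed
  show ?thesis
  \<comment> \<open>The factor 3 passes from the components to the norm.\<close>
  proof (rule that[of "3 * L"])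
    show "3 * L \<ge> 0" unfolding L_def by (simp add: sum_nonneg)
    show "norm (u t x - u t y) \<le> 3 * L * norm (x - y)" if "t \<in> J" "x \<in> region \<Omega>" "y \<in> region \<Omega>" for t x y
      using norm_le_of_components[of "u t x - u t y" "L * norm (x - y)"] QL[OF that(1)] that(2,3) unfolding Q_def by simp
  qed
qed

text \<open>The time derivative provided by \<open>C1_Hs\<close> is an H^s function with no
  continuity assumed, so its values at points are meaningless. The field \<open>w\<close>
  synthesised from one of its symbols is differentiable and serves as its representative.\<close>

lemma time_derivative_field:
  assumes adm: "admissible_domain \<Omega>" and s: "s > 7/2" and C1: "C1_Hs J \<Omega> s u"
    and cont: "\<forall>t\<in>J. continuous_on (region \<Omega>) (u t)" and t: "t \<in> J"
    and nontriv: "at t within J \<noteq> bot"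
  obtains w where "\<And>x. x \<in> region \<Omega> \<Longrightarrow> w differentiable (at x)"
    "\<And>i j. continuous_on (region \<Omega>) (\<lambda>x. jacobian w (at x) $ i $ j)"
    "\<And>e. e > 0 \<Longrightarrow> \<forall>\<^sub>F \<tau> in at t within J. \<forall>x\<in>region \<Omega>. \<forall>i j. \<bar>(u \<tau> x $ i - u t x $ i) / (\<tau> - t) - w x $ i\<bar> \<le> e \<and>
      \<bar>(vel_grad u \<tau> x $ i $ j - vel_grad u t x $ i $ j) / (\<tau> - t) - jacobian w (at x) $ i $ j\<bar> \<le> e"
proof -
  let ?M = "freq \<Omega>"
  obtain v where v: "C0_Hs J \<Omega> s v"
    and lim: "((\<lambda>\<tau>. Hs_norm_vec \<Omega> s (\<lambda>x. (u \<tau> x - u t x) /\<^sub>R (\<tau> - t) - v t x)) \<longlongrightarrow> 0) (at t within J)"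
    using C1 t unfolding C1_Hs_def by blast
  have Hu: "in_Hs_vec \<Omega> s (u \<tau>)" if "\<tau> \<in> J" for \<tau> using C1 that by (simp add: C0_Hs_def C1_Hs_def)
  have Hv: "in_Hs_vec \<Omega> s (v t)" using v t by (simp add: C0_Hs_def)
  obtain C where C: "C > 0" "\<And>f e. in_Hs_vec \<Omega> s f \<Longrightarrow> Hs_norm_vec \<Omega> s f < e \<Longrightarrow>
    \<exists>g. (\<forall>i. Hs_symbol \<Omega> s (\<lambda>x. f x $ i) (g i)) \<and>
      (\<forall>i. fourier_moment ?M 2 (g i) \<and> moment_norm ?M 2 (g i) \<le> C * e)"
    by (rule Sobolev_embedding[OF s]) (rule that)
  obtain gv where gv: "\<And>i. Hs_symbol \<Omega> s (\<lambda>x. v t x $ i) (gv i)" "\<And>i. fourier_moment ?M 2 (gv i)"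
    using C(2)[OF Hv, of "Hs_norm_vec \<Omega> s (v t) + 1"] by auto
  define w where "w x = (\<chi> i. Re (synth ?M (gv i) x))" for x
  have w: "\<forall>x\<in>region \<Omega>. \<forall>i. w x $ i = Re (synth ?M (gv i) x)" by (simp add: w_def)
  note W = synth_field[OF open_region[OF adm] measurable_frequency gv(2) w]
  have du: "u \<sigma> differentiable (at x)" if "\<sigma> \<in> J" "x \<in> region \<Omega>" for \<sigma> x
    using Hs_differentiable[OF adm s Hu[OF that(1)] cont[rule_format, OF that(1)] that(2)] .
  show ?thesis
  proof (rule that[of w])
    show "w differentiable (at x)" if "x \<in> region \<Omega>" for x by (rule W(1)[OF that])
    show "continuous_on (region \<Omega>) (\<lambda>x. jacobian w (at x) $ i $ j)" for i j by (rule W(3))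
    fix e :: real assume e: "e > 0"
    have "\<forall>\<^sub>F \<tau> in at t within J. Hs_norm_vec \<Omega> s (\<lambda>x. (u \<tau> x - u t x) /\<^sub>R (\<tau> - t) - v t x) < e / C"
      by (rule order_tendstoD(2)[OF lim]) (use C e in simp)
    moreover have "\<forall>\<^sub>F \<tau> in at t within J. \<tau> \<in> J" by (auto simp: eventually_at_filter)
    ultimately show "\<forall>\<^sub>F \<tau> in at t within J. \<forall>x\<in>region \<Omega>. \<forall>i j. \<bar>(u \<tau> x $ i - u t x $ i) / (\<tau> - t) - w x $ i\<bar> \<le> e \<and>
      \<bar>(vel_grad u \<tau> x $ i $ j - vel_grad u t x $ i $ j) / (\<tau> - t) - jacobian w (at x) $ i $ j\<bar> \<le> e"
    proof eventually_elim
      case (elim \<tau>)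
      define r where "r = inverse (\<tau> - t)"
      let ?q = "\<lambda>x. r *\<^sub>R u \<tau> x + (- r) *\<^sub>R u t x"
      have s': "s > 3/2" using s by simp
      have Hq: "in_Hs_vec \<Omega> s ?q" by (rule in_Hs_vec_combination[OF Hu[OF elim(2)] Hu[OF t] s'])
      have Hqv: "in_Hs_vec \<Omega> s (\<lambda>x. ?q x - v t x)"
        using in_Hs_vec_combination[OF Hq Hv s', of 1 "-1"] by simp
      have "Hs_norm_vec \<Omega> s (\<lambda>x. ?q x - v t x) < e / C"
        using elim(1) by (simp add: r_def scaleR_diff_right)
      from C(2)[OF Hqv this] obtain h where h: "\<And>i. Hs_symbol \<Omega> s (\<lambda>x. (?q x - v t x) $ i) (h i)"
        "\<And>i. fourier_moment ?M 2 (h i)" "\<And>i. moment_norm ?M 2 (h i) \<le> C * (e / C)" by blast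
      have contq: "continuous_on (region \<Omega>) ?q" by (intro continuous_intros cont[rule_format] elim t)
      have m0: "fourier_moment ?M 0 (h i)" "fourier_moment ?M 0 (gv i)" for i
        using fourier_moment_mono(1)[OF h(2)] fourier_moment_mono(1)[OF gv(2)] by simp_all
      \<comment> \<open>The pointwise inversion formula requires a continuous function. It cannot be
        applied to \<open>?q x - v t x\<close>, so it is applied to the continuous difference
        quotient, whose symbol is taken as the sum of the small symbol \<open>h\<close> and the
        fixed symbol \<open>gv\<close>; subtracting the synthesis of \<open>gv\<close> then leaves
        that of \<open>h\<close>.\<close>
      have symq: "Hs_symbol \<Omega> s (\<lambda>x. ?q x $ i) (\<lambda>\<xi>. h i \<xi> + gv i \<xi>)" for i
      proof -
        have "locally_integrable_on (region \<Omega>) (\<lambda>x. (?q x - v t x) $ i)" "locally_integrable_on (region \<Omega>) (\<lambda>x. v t x $ i)"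
          using Hqv Hv unfolding in_Hs_vec_def in_Hs_def by blast+
        from Hs_symbol_combination[OF h(1) gv(1) s' this, of 1 1] show ?thesis by simp
      qed
      have msum: "fourier_moment ?M 2 (\<lambda>\<xi>. h i \<xi> + gv i \<xi>)" for i
        using Hs_symbol_moment[OF symq, of 2] s by simp
      have D: "(?q x - w x) $ i = Re (synth ?M (h i) x)" if x: "x \<in> region \<Omega>" for x i
      proof -
        have "synth ?M (\<lambda>\<xi>. h i \<xi> + gv i \<xi>) x = complex_of_real (?q x $ i)"
          using Hs_symbol_pointwise[OF adm symq msum _ continuous_on_component[OF contq] x] by simp
        moreover have "synth ?M (\<lambda>\<xi>. h i \<xi> + gv i \<xi>) x = synth ?M (h i) x + synth ?M (gv i) x"
          by (rule synth_add[OF m0]) auto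
        ultimately have "Re (synth ?M (h i) x) + Re (synth ?M (gv i) x) = ?q x $ i"
          by (metis Re_complex_of_real plus_complex.sel(1))
        then show ?thesis by (simp add: w_def)
      qed
      have D': "\<forall>x\<in>region \<Omega>. \<forall>i. (?q x - w x) $ i = Re (synth ?M (h i) x)"
        using D by blast
      note S = synth_field[OF open_region[OF adm] measurable_frequency h(2) D']
      have ce: "C * (e / C) = e" using C(1) by simp
      show ?case
      proof (intro ballI allI conjI)
        fix x i j assume x: "x \<in> region \<Omega>"
        have "\<bar>(?q x - w x) $ i\<bar> \<le> e" using order_trans[OF S(4)[OF x] h(3)] ce by simp
        then show "\<bar>(u \<tau> x $ i - u t x $ i) / (\<tau> - t) - w x $ i\<bar> \<le> e"
          by (simp add: r_def divide_inverse algebra_simps)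
        have dq: "?q differentiable (at x)" by (intro derivative_intros du elim t x)
        have jq: "jacobian (\<lambda>x. ?q x - w x) (at x) = r *\<^sub>R vel_grad u \<tau> x + (- r) *\<^sub>R vel_grad u t x - jacobian w (at x)"
          using jacobian_linear_combination[OF dq W(1)[OF x], of 1 "-1"]
            jacobian_linear_combination[OF du[OF elim(2) x] du[OF t x], of r "- r"] by (simp add: vel_grad_def)
        have "\<bar>jacobian (\<lambda>x. ?q x - w x) (at x) $ i $ j\<bar> \<le> e"
          by (rule order_trans[OF S(5)[OF x] h(3)[unfolded ce]])
        then show "\<bar>(vel_grad u \<tau> x $ i $ j - vel_grad u t x $ i $ j) / (\<tau> - t) - jacobian w (at x) $ i $ j\<bar> \<le> e"
          unfolding jq by (simp add: r_def divide_inverse algebra_simps)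
      qed
    qed
  qed
qed

section \<open>Ordinary differential equations and Lipschitz extensions\<close>

text \<open>With a global Lipschitz constant the increments of the iteration are bounded by (L t)^n
  / n!, so it converges on the whole interval at once, without continuation of local
  solutions.\<close>

lemma Picard_Lindelof:
  fixes f :: "real \<Rightarrow> 'a::banach \<Rightarrow> 'a"
  assumes T: "T \<ge> 0" and cont: "continuous_on ({0..T} \<times> UNIV) (\<lambda>(t, x). f t x)"
    and L: "L \<ge> 0" "\<And>t x y. t \<in> {0..T} \<Longrightarrow> norm (f t x - f t y) \<le> L * norm (x - y)"
  shows "\<exists>x. x 0 = x0 \<and> (\<forall>t\<in>{0..T}. (x has_vector_derivative f t (x t)) (at t within {0..T}))"
proof -
  define X where "X = rec_nat (\<lambda>t. x0) (\<lambda>n Xn t. x0 + integral {0..t} (\<lambda>s. f s (Xn s)))"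
  have X0: "X 0 = (\<lambda>t. x0)" and XS: "X (Suc n) = (\<lambda>t. x0 + integral {0..t} (\<lambda>s. f s (X n s)))" for n
    by (simp_all add: X_def)
  have comp: "continuous_on {0..T} (\<lambda>s. f s (y s))" if "continuous_on {0..T} y" for y
    using continuous_on_compose2[OF cont continuous_on_Pair[OF continuous_on_id that]] by auto
  have contX: "continuous_on {0..T} (X n)" for n
  proof (induction n)
    case 0
    then show ?case by (simp add: X0)
  next
    case (Suc n)
    show ?case unfolding XS
      by (intro continuous_intros indefinite_integral_continuous_1 integrable_continuous_real comp Suc)
  qed
  have sub: "continuous_on {0..t} (\<lambda>s. f s (y s))" if "continuous_on {0..T} y" "t \<in> {0..T}" for y t
    by (rule continuous_on_subset[OF comp[OF that(1)]]) (use that in auto)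
  have int: "(\<lambda>s. f s (y s)) integrable_on {0..t}" if "continuous_on {0..T} y" "t \<in> {0..T}" for y t
    by (rule integrable_continuous_real[OF sub[OF that]])
  have "bounded ((\<lambda>t. X 1 t - X 0 t) ` {0..T})"
    by (intro compact_imp_bounded compact_continuous_image continuous_intros contX) auto
  then obtain M where "\<forall>y\<in>(\<lambda>t. X 1 t - X 0 t) ` {0..T}. norm y \<le> M"
    unfolding bounded_iff ..
  then have M: "norm (X 1 t - X 0 t) \<le> M" if "t \<in> {0..T}" for t
    using that by (rule bspec[OF _ imageI])
  have M0: "M \<ge> 0" using M[of 0] T norm_ge_zero by (meson atLeastAtMost_iff order_refl order_trans)
  have step: "norm (X (Suc n) t - X n t) \<le> M * (L * t) ^ n / fact n" if "t \<in> {0..T}" for n t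
    using that
  proof (induction n arbitrary: t)
    case 0
    then show ?case using M by simp
  next
    case (Suc n)
    let ?F = "\<lambda>s. M * (L * s) ^ Suc n / fact (Suc n)"
    have hi: "((\<lambda>s. L * (M * (L * s) ^ n / fact n)) has_integral (?F t - ?F 0)) {0..t}"
    proof (rule fundamental_theorem_of_calculus)
      fix s :: real assume "s \<in> {0..t}"
      have "(?F has_real_derivative (M * (real (Suc n) * (L * s) ^ n * L) / fact (Suc n))) (at s within {0..t})"
        by (auto intro!: derivative_eq_intros simp del: fact_Suc power_Suc)
      moreover have "M * (real (Suc n) * (L * s) ^ n * L) / fact (Suc n) = L * (M * (L * s) ^ n / fact n)"
        unfolding fact_Suc by (simp add: field_simps del: of_nat_Suc)
      ultimately show "(?F has_vector_derivative L * (M * (L * s) ^ n / fact n)) (at s within {0..t})"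
        by (simp only: has_real_derivative_iff_has_vector_derivative)
    qed (use Suc.prems in auto)
    have "X (Suc (Suc n)) t - X (Suc n) t = integral {0..t} (\<lambda>s. f s (X (Suc n) s) - f s (X n s))"
      unfolding XS[of "Suc n"] fun_cong[OF XS[of n], of t]
      using Suc.prems by (subst integral_diff) (auto intro!: int contX)
    also have "norm \<dots> \<le> integral {0..t} (\<lambda>s. L * (M * (L * s) ^ n / fact n))"
    proof (rule integral_norm_bound_integral)
      show "(\<lambda>s. f s (X (Suc n) s) - f s (X n s)) integrable_on {0..t}"
        using Suc.prems by (intro integrable_diff int contX)
      show "(\<lambda>s. L * (M * (L * s) ^ n / fact n)) integrable_on {0..t}" using hi by blast
      fix s assume "s \<in> {0..t}"
      then have s: "s \<in> {0..T}" using Suc.prems by auto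
      have "norm (f s (X (Suc n) s) - f s (X n s)) \<le> L * norm (X (Suc n) s - X n s)" by (rule L(2)[OF s])
      also have "\<dots> \<le> L * (M * (L * s) ^ n / fact n)" by (intro mult_left_mono Suc.IH s L(1))
      finally show "norm (f s (X (Suc n) s) - f s (X n s)) \<le> L * (M * (L * s) ^ n / fact n)" .
    qed
    also have "\<dots> = ?F t" using integral_unique[OF hi] by simp
    finally show ?case .
  qed
  \<comment> \<open>The limit of the iterates is written as a telescoping series, to which the
    Weierstrass test applies with an exponential series as majorant.\<close>
  define Y where "Y t = x0 + (\<Sum>n. X (Suc n) t - X n t)" for t
  have "uniform_limit {0..T} (\<lambda>n t. \<Sum>i<n. X (Suc i) t - X i t) (\<lambda>t. \<Sum>i. X (Suc i) t - X i t) sequentially"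
  proof (rule Weierstrass_m_test)
    fix n t assume t: "t \<in> {0..T}"
    have "norm (X (Suc n) t - X n t) \<le> M * (L * t) ^ n / fact n" by (rule step[OF t])
    also have "\<dots> \<le> M * (L * T) ^ n / fact n"
      using t L M0 by (intro divide_right_mono mult_left_mono power_mono) auto
    finally show "norm (X (Suc n) t - X n t) \<le> M * ((L * T) ^ n /\<^sub>R fact n)" by (simp add: field_simps)
  qed (intro summable_mult summable_exp_generic)
  then have "uniform_limit {0..T} (\<lambda>n t. x0 + (\<Sum>i<n. X (Suc i) t - X i t)) Y sequentially"
    unfolding Y_def by (intro uniform_limit_intros)
  moreover have "(\<Sum>i<n. X (Suc i) t - X i t) = X n t - x0" for n t
    using sum_lessThan_telescope[of "\<lambda>i. X i t" n] by (simp add: X0)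
  ultimately have lim: "uniform_limit {0..T} X Y sequentially" by simp
  have contY: "continuous_on {0..T} Y"
    by (rule uniform_limit_theorem[OF _ lim]) (simp_all add: contX)
  have Y: "Y t = x0 + integral {0..t} (\<lambda>s. f s (Y s))" if t: "t \<in> {0..T}" for t
  proof -
    have lim2: "(\<lambda>n. X (Suc n) t) \<longlonglongrightarrow> Y t"
      using tendsto_uniform_limitI[OF lim t] by (rule LIMSEQ_Suc)
    have "(\<lambda>n. integral {0..t} (\<lambda>s. f s (X n s))) \<longlonglongrightarrow> integral {0..t} (\<lambda>s. f s (Y s))"
    proof (rule metric_LIMSEQ_I)
      fix e :: real assume "e > 0"
      \<comment> \<open>Chosen so that L * d * T < e; the 1 keeps the denominator positive when L *
        T = 0.\<close>
      define d where "d = e / (L * T + 1)"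
      have d: "d > 0" "L * d * T < e"
      proof -
        have p: "L * T \<ge> 0" using L(1) T by simp
        then show "d > 0" using \<open>e > 0\<close> by (simp add: d_def)
        have "(L * T) * e < (L * T + 1) * e" using \<open>e > 0\<close> by simp
        then show "L * d * T < e" using p by (simp add: d_def pos_divide_less_eq mult_ac)
      qed
      have "\<forall>\<^sub>F n in sequentially. \<forall>s\<in>{0..T}. dist (X n s) (Y s) < d"
        using lim d(1) by (auto simp: uniform_limit_iff)
      then obtain N where N: "\<And>n s. n \<ge> N \<Longrightarrow> s \<in> {0..T} \<Longrightarrow> dist (X n s) (Y s) < d"
        unfolding eventually_sequentially by blast
      show "\<exists>no. \<forall>n\<ge>no. dist (integral {0..t} (\<lambda>s. f s (X n s))) (integral {0..t} (\<lambda>s. f s (Y s))) < e"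
      proof (intro exI[of _ N] allI impI)
        fix n assume n: "n \<ge> N"
        have "dist (integral {0..t} (\<lambda>s. f s (X n s))) (integral {0..t} (\<lambda>s. f s (Y s)))
          = norm (integral {0..t} (\<lambda>s. f s (X n s) - f s (Y s)))"
          using t by (subst integral_diff) (auto simp: dist_norm intro!: int contX contY)
        also have "\<dots> \<le> (L * d) * (t - 0)"
        proof (rule integral_bound)
          show "continuous_on {0..t} (\<lambda>s. f s (X n s) - f s (Y s))"
            by (intro continuous_intros sub contX contY t)
          fix s assume "s \<in> {0..t}"
          then have s: "s \<in> {0..T}" using t by auto
          have "norm (f s (X n s) - f s (Y s)) \<le> L * norm (X n s - Y s)" by (rule L(2)[OF s])
          also have "\<dots> \<le> L * d" using N[OF n s] L(1) by (intro mult_left_mono) (auto simp: dist_norm)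
          finally show "norm (f s (X n s) - f s (Y s)) \<le> L * d" .
        qed (use t in auto)
        also have "\<dots> \<le> L * d * T" using t L(1) d(1) by (intro mult_left_mono) auto
        also have "\<dots> < e" by (rule d)
        finally show "dist (integral {0..t} (\<lambda>s. f s (X n s))) (integral {0..t} (\<lambda>s. f s (Y s))) < e" .
      qed
    qed
    then have "(\<lambda>n. X (Suc n) t) \<longlonglongrightarrow> x0 + integral {0..t} (\<lambda>s. f s (Y s))"
      unfolding XS by (intro tendsto_intros)
    with lim2 show ?thesis using LIMSEQ_unique by blast
  qed
  have "(Y has_vector_derivative f t (Y t)) (at t within {0..T})" if t: "t \<in> {0..T}" for t
  proof -
    have "((\<lambda>t. x0 + integral {0..t} (\<lambda>s. f s (Y s))) has_vector_derivative 0 + f t (Y t)) (at t within {0..T})"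
      by (intro has_vector_derivative_add has_vector_derivative_const integral_has_vector_derivative comp contY t)
    then show ?thesis
      using Y t has_vector_derivative_transform[of t "{0..T}" Y] by simp
  qed
  moreover have "Y 0 = x0" using Y[of 0] T by simp
  ultimately show ?thesis by blast
qed

text \<open>The trajectory and the covector are both prescribed at the final time; reversing time
  reduces this to an initial value problem.\<close>

lemma Picard_Lindelof_backward:
  fixes f :: "real \<Rightarrow> 'a::banach \<Rightarrow> 'a"
  assumes T: "T \<ge> 0" and cont: "continuous_on ({0..T} \<times> UNIV) (\<lambda>(t, x). f t x)"
    and L: "L \<ge> 0" "\<And>t x y. t \<in> {0..T} \<Longrightarrow> norm (f t x - f t y) \<le> L * norm (x - y)"
  shows "\<exists>x. x T = x1 \<and> (\<forall>t\<in>{0..T}. (x has_vector_derivative f t (x t)) (at t within {0..T}))"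
proof -
  have "continuous_on ({0..T} \<times> UNIV) (\<lambda>p. (\<lambda>(t, x). f t x) (T - fst p, snd p))"
    by (rule continuous_on_compose2[OF cont]) (auto intro!: continuous_intros)
  then have "continuous_on ({0..T} \<times> UNIV) (\<lambda>p. - (\<lambda>(t, x). f t x) (T - fst p, snd p))"
    by (rule continuous_on_minus)
  then have "continuous_on ({0..T} \<times> UNIV) (\<lambda>(t, x). - f (T - t) x)"
    by (simp add: split_beta)
  moreover have "norm (- f (T - t) x - - f (T - t) y) \<le> L * norm (x - y)" if "t \<in> {0..T}" for t x y
    using L(2)[of "T - t" x y] that by (simp add: norm_minus_commute)
  ultimately obtain y where y: "y 0 = x1"
      "\<And>t. t \<in> {0..T} \<Longrightarrow> (y has_vector_derivative - f (T - t) (y t)) (at t within {0..T})"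
    using Picard_Lindelof[OF T _ L(1), of "\<lambda>t x. - f (T - t) x" x1] by blast
  show ?thesis
  proof (intro exI[of _ "\<lambda>t. y (T - t)"] conjI ballI)
    show "y (T - T) = x1" using y by simp
    fix t assume t: "t \<in> {0..T}"
    have im: "(\<lambda>t. T - t) ` {0..T} = {0..T}" by auto
    have "(y \<circ> (\<lambda>t. T - t) has_vector_derivative (-1) *\<^sub>R (- f (T - (T - t)) (y (T - t)))) (at t within {0..T})"
    proof (rule vector_diff_chain_within)
      show "((\<lambda>t. T - t) has_vector_derivative - 1) (at t within {0..T})"
        by (auto intro!: derivative_eq_intros)
      show "(y has_vector_derivative - f (T - (T - t)) (y (T - t))) (at (T - t) within (\<lambda>t. T - t) ` {0..T})"
        unfolding im by (rule y) (use t in auto)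
    qed
    then show "((\<lambda>t. y (T - t)) has_vector_derivative f t (y (T - t))) (at t within {0..T})"
      by (simp add: o_def)
  qed
qed

text \<open>Gronwall in the form that |z|^2 exp(-2 K t) is nonincreasing, so a zero at
  \<open>a\<close> would propagate to \<open>b\<close>. The derivative is needed on the open
  interval only. The lemma serves twice: for the defining function along a trajectory that reaches
  the boundary, and for the covector by whose norm the amplitude equation divides.\<close>

lemma nonzero_backward:
  fixes z :: "real \<Rightarrow> 'a::real_inner"
  assumes "a \<le> b" "continuous_on {a..b} z"
    and d: "\<And>t. a < t \<Longrightarrow> t < b \<Longrightarrow> (z has_vector_derivative z' t) (at t)"
    and K: "\<And>t. a < t \<Longrightarrow> t < b \<Longrightarrow> norm (z' t) \<le> K * norm (z t)"
    and "z b \<noteq> 0"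
  shows "z a \<noteq> 0"
proof
  assume "z a = 0"
  let ?f = "\<lambda>t. (z t \<bullet> z t) * exp (- 2 * K * t)"
  have "?f b \<le> ?f a"
  proof (rule DERIV_nonpos_imp_decreasing_open[OF assms(1)])
    fix t assume t: "a < t" "t < b"
    have "((\<lambda>t. z t \<bullet> z t) has_real_derivative z t \<bullet> z' t + z' t \<bullet> z t) (at t)"
      using d[OF t] unfolding has_vector_derivative_def has_field_derivative_def
      by (auto intro!: derivative_eq_intros simp: algebra_simps)
    then have "(?f has_real_derivative (z t \<bullet> z t) * (exp (- 2 * K * t) * (- 2 * K))
        + (z t \<bullet> z' t + z' t \<bullet> z t) * exp (- 2 * K * t)) (at t)"
      by (auto intro!: derivative_eq_intros)
    moreover have "(z t \<bullet> z t) * (exp (- 2 * K * t) * (- 2 * K))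
        + (z t \<bullet> z' t + z' t \<bullet> z t) * exp (- 2 * K * t) \<le> 0"
    proof -
      have "z t \<bullet> z' t \<le> norm (z t) * norm (z' t)" by (rule norm_cauchy_schwarz)
      also have "\<dots> \<le> norm (z t) * (K * norm (z t))" by (intro mult_left_mono K t) auto
      also have "\<dots> = K * (z t \<bullet> z t)" by (simp add: power2_norm_eq_inner[symmetric] power2_eq_square)
      finally have "exp (- 2 * K * t) * (2 * (z t \<bullet> z' t - K * (z t \<bullet> z t))) \<le> 0"
        by (intro mult_nonneg_nonpos) auto
      then show ?thesis by (simp add: algebra_simps inner_commute)
    qed
    ultimately show "\<exists>y. (?f has_real_derivative y) (at t) \<and> y \<le> 0" by blast
  qed (intro continuous_intros assms(2))
  then have "z b \<bullet> z b * exp (- 2 * K * b) \<le> 0" using \<open>z a = 0\<close> by simp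
  then have "z b \<bullet> z b \<le> 0" by (simp add: mult_le_0_iff)
  then show False using \<open>z b \<noteq> 0\<close> by (metis inner_gt_zero_iff not_le)
qed

section \<open>Joint continuity and Lipschitz extension of time-dependent fields\<close>

lemma continuous_on_Times_lipschitz:
  fixes f :: "real \<Rightarrow> 'a::real_normed_vector \<Rightarrow> 'b::real_normed_vector"
  assumes c: "\<And>x. continuous_on J (\<lambda>t. f t x)"
    and L: "L \<ge> 0" "\<And>t x y. t \<in> J \<Longrightarrow> norm (f t x - f t y) \<le> L * norm (x - y)"
  shows "continuous_on (J \<times> UNIV) (\<lambda>(t, x). f t x)"
proof -
  have "((\<lambda>p. f (fst p) (snd p)) \<longlongrightarrow> f t x) (at (t, x) within J \<times> UNIV)" if t: "t \<in> J" for t x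
  proof (rule Lim_transform)
    have "((\<lambda>p. f (fst p) x) \<longlongrightarrow> f t x) (at (t, x) within J \<times> UNIV)"
    proof -
      have "continuous_on (J \<times> (UNIV :: 'a set)) (\<lambda>p. f (fst p) x)"
        by (rule continuous_on_compose2[OF c]) (auto intro!: continuous_intros)
      then show ?thesis using t by (auto simp: continuous_on_def dest: bspec[of _ _ "(t, x)"])
    qed
    then show "((\<lambda>p. f (fst p) x) \<longlongrightarrow> f t x) (at (t, x) within J \<times> UNIV)" .
    show "((\<lambda>p. f (fst p) (snd p) - f (fst p) x) \<longlongrightarrow> 0) (at (t, x) within J \<times> UNIV)"
    proof (rule Lim_null_comparison)
      show "\<forall>\<^sub>F p in at (t, x) within J \<times> UNIV. norm (f (fst p) (snd p) - f (fst p) x) \<le> L * norm (snd p - x)"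
        unfolding eventually_at by (auto intro!: exI[of _ 1] L(2))
      show "((\<lambda>p. L * norm (snd p - x)) \<longlongrightarrow> 0) (at (t, x) within J \<times> UNIV)"
        by (rule tendsto_eq_intros refl | simp)+
    qed
  qed
  then show ?thesis by (auto simp: continuous_on_def split_beta)
qed

text \<open>The McShane extension, the largest \<open>L\<close>-Lipschitz extension of
  \<open>f\<close> from \<open>U\<close> when \<open>f\<close> is \<open>L\<close>-Lipschitz
  there.\<close>

definition McShane :: "'a::real_normed_vector set \<Rightarrow> real \<Rightarrow> ('a \<Rightarrow> real) \<Rightarrow> 'a \<Rightarrow> real" where
  "McShane U L f x = (INF y\<in>U. f y + L * norm (x - y))"

text \<open>Supplies the lower bound without which the conditional infimum says nothing.\<close>

lemma McShane_lower:
  assumes "L \<ge> 0" "\<And>x y. x \<in> U \<Longrightarrow> y \<in> U \<Longrightarrow> \<bar>f x - f y\<bar> \<le> L * norm (x - y)" "y \<in> U" "y0 \<in> U"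
  shows "f y0 - L * norm (x - y0) \<le> f y + L * norm (x - y)"
proof -
  have "norm (y0 - y) \<le> norm (x - y0) + norm (x - y)"
    using norm_triangle_ineq4[of "x - y" "x - y0"] by simp
  then have "L * norm (y0 - y) \<le> L * norm (x - y0) + L * norm (x - y)"
    using assms(1) by (metis distrib_left mult_left_mono)
  then show ?thesis using assms(2)[OF assms(4,3)] by linarith
qed

text \<open>One comparison for two purposes: one function at two points gives the Lipschitz bound,
  two functions at one point give continuity in time.\<close>

lemma McShane_diff_le:
  assumes "U \<noteq> {}" "L \<ge> 0" "\<And>x y. x \<in> U \<Longrightarrow> y \<in> U \<Longrightarrow> \<bar>f x - f y\<bar> \<le> L * norm (x - y)"
    and "\<And>y. y \<in> U \<Longrightarrow> f y + L * norm (x - y) \<le> g y + L * norm (x' - y) + c"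
  shows "McShane U L f x \<le> McShane U L g x' + c"
proof -
  obtain y0 where y0: "y0 \<in> U" using assms(1) by blast
  have "McShane U L f x - c \<le> McShane U L g x'"
    unfolding McShane_def[of U L g]
  proof (rule cINF_greatest[OF assms(1)])
    fix y assume y: "y \<in> U"
    have "McShane U L f x \<le> f y + L * norm (x - y)"
      unfolding McShane_def
      by (rule cINF_lower[OF _ y]) (auto intro!: bdd_belowI2 McShane_lower[OF assms(2,3) _ y0])
    then show "McShane U L f x - c \<le> g y + L * norm (x' - y)" using assms(4)[OF y] by linarith
  qed
  then show ?thesis by linarith
qed

lemma McShane_lipschitz:
  assumes "U \<noteq> {}" "L \<ge> 0" "\<And>x y. x \<in> U \<Longrightarrow> y \<in> U \<Longrightarrow> \<bar>f x - f y\<bar> \<le> L * norm (x - y)"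
  shows "\<bar>McShane U L f x - McShane U L f x'\<bar> \<le> L * norm (x - x')"
proof -
  have *: "f y + L * norm (a - y) \<le> f y + L * norm (b - y) + L * norm (a - b)" for a b y
  proof -
    have "norm (a - y) \<le> norm (b - y) + norm (a - b)"
      using norm_triangle_ineq[of "a - b" "b - y"] by simp
    from mult_left_mono[OF this assms(2)] show ?thesis by (simp add: distrib_left)
  qed
  have "McShane U L f x \<le> McShane U L f x' + L * norm (x - x')"
    "McShane U L f x' \<le> McShane U L f x + L * norm (x' - x)"
    by (rule McShane_diff_le[OF assms], assumption, assumption, rule *)+
  then show ?thesis by (simp add: norm_minus_commute abs_le_iff)
qed

lemma McShane_eq:
  assumes "L \<ge> 0" "\<And>x y. x \<in> U \<Longrightarrow> y \<in> U \<Longrightarrow> \<bar>f x - f y\<bar> \<le> L * norm (x - y)" "x \<in> U"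
  shows "McShane U L f x = f x"
proof (rule antisym)
  show "McShane U L f x \<le> f x"
    unfolding McShane_def
    by (rule cINF_lower2[OF _ assms(3)]) (auto intro!: bdd_belowI2 McShane_lower[OF assms(1,2) _ assms(3)])
  show "f x \<le> McShane U L f x"
    unfolding McShane_def
  proof (rule cINF_greatest)
    fix y assume y: "y \<in> U"
    show "f x \<le> f y + L * norm (x - y)" using assms(2)[OF assms(3) y] by linarith
  qed (use assms(3) in blast)
qed

text \<open>The McShane extension does not increase uniform distances between the extended
  functions, so uniform continuity in time on \<open>U\<close> survives outside \<open>U\<close>.
  Together with the Lipschitz bound in space this is joint continuity. Extending each component
  separately multiplies the constant by the dimension.\<close>

lemma exists_lipschitz_extension:
  fixes u :: "real \<Rightarrow> 'a::real_normed_vector \<Rightarrow> real^'n"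
  assumes "U \<noteq> {}" "L \<ge> 0"
    and lip: "\<And>t x y. t \<in> J \<Longrightarrow> x \<in> U \<Longrightarrow> y \<in> U \<Longrightarrow> norm (u t x - u t y) \<le> L * norm (x - y)"
    and unif: "\<And>t e. t \<in> J \<Longrightarrow> e > 0 \<Longrightarrow> \<forall>\<^sub>F \<tau> in at t within J. \<forall>x\<in>U. norm (u \<tau> x - u t x) \<le> e"
  obtains v K where "K \<ge> 0" "\<And>t x. t \<in> J \<Longrightarrow> x \<in> U \<Longrightarrow> v t x = u t x"
    "\<And>t x y. t \<in> J \<Longrightarrow> norm (v t x - v t y) \<le> K * norm (x - y)"
    "continuous_on (J \<times> UNIV) (\<lambda>(t, x). v t x)"
proof -
  define v where "v t x = (\<chi> i. McShane U L (\<lambda>y. u t y $ i) x)" for t x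
  have lipc: "\<bar>u t x $ i - u t y $ i\<bar> \<le> L * norm (x - y)" if "t \<in> J" "x \<in> U" "y \<in> U" for t x y i
    using lip[OF that] component_le_norm_cart[of "u t x - u t y" i] by simp
  have lv: "norm (v t x - v t y) \<le> (real CARD('n) * L) * norm (x - y)" if "t \<in> J" for t x y
  proof -
    have "norm (v t x - v t y) \<le> (\<Sum>i\<in>UNIV. \<bar>(v t x - v t y) $ i\<bar>)" by (rule norm_le_l1_cart)
    also have "\<dots> \<le> (\<Sum>i\<in>(UNIV::'n set). L * norm (x - y))"
      by (intro sum_mono) (simp add: v_def McShane_lipschitz[OF assms(1,2) lipc[OF that]])
    finally show ?thesis by simp
  qed
  have "continuous_on (J \<times> UNIV) (\<lambda>(t, x). v t x)"
  proof (rule continuous_on_Times_lipschitz[OF _ _ lv])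
    fix x
    have "((\<lambda>\<tau>. v \<tau> x $ i) \<longlongrightarrow> v t x $ i) (at t within J)" if t: "t \<in> J" for t i
    proof (rule tendstoI)
      fix e :: real assume "e > 0"
      have "\<forall>\<^sub>F \<tau> in at t within J. \<tau> \<in> J" by (auto simp: eventually_at_filter)
      with unif[OF t, of "e / 2"] \<open>e > 0\<close>
      have "\<forall>\<^sub>F \<tau> in at t within J. \<tau> \<in> J \<and> (\<forall>x\<in>U. norm (u \<tau> x - u t x) \<le> e / 2)"
        by (simp add: eventually_conj)
      then show "\<forall>\<^sub>F \<tau> in at t within J. dist (v \<tau> x $ i) (v t x $ i) < e"
      proof eventually_elim
        case (elim \<tau>)
        have c: "\<bar>u \<tau> y $ i - u t y $ i\<bar> \<le> e / 2" if "y \<in> U" for y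
          using elim that component_le_norm_cart[of "u \<tau> y - u t y" i] by fastforce
        have c': "u \<tau> y $ i \<le> u t y $ i + e / 2" "u t y $ i \<le> u \<tau> y $ i + e / 2" if "y \<in> U" for y
          using c[OF that] by linarith+
        have "v \<tau> x $ i \<le> v t x $ i + e / 2"
          unfolding v_def vec_lambda_beta
          by (rule McShane_diff_le[OF assms(1,2) lipc]) (use elim c' in auto)
        moreover have "v t x $ i \<le> v \<tau> x $ i + e / 2"
          unfolding v_def vec_lambda_beta
          by (rule McShane_diff_le[OF assms(1,2) lipc]) (use elim c' t in auto)
        ultimately show ?case using \<open>e > 0\<close> by (auto simp: dist_real_def abs_if)
      qed
    qed
    then show "continuous_on J (\<lambda>t. v t x)"
      unfolding continuous_on_def by (intro ballI vec_tendstoI)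
  qed (use assms(2) in auto)
  moreover have "v t x = u t x" if "t \<in> J" "x \<in> U" for t x
    using McShane_eq[OF assms(2) lipc[OF that(1)] that(2)] by (simp add: v_def vec_eq_iff)
  ultimately show ?thesis using that[of "real CARD('n) * L" v] lv assms(2) by auto
qed

section \<open>Flows tangent to a smooth boundary\<close>

lemma frechet_derivative_sum_axis:
  fixes f :: "real^'n \<Rightarrow> real"
  assumes "f differentiable (at x)"
  shows "frechet_derivative f (at x) h = (\<Sum>i\<in>UNIV. h $ i * frechet_derivative f (at x) (axis i 1))"
proof -
  interpret linear "frechet_derivative f (at x)" by (rule linear_frechet_derivative[OF assms])
  have "h = (\<Sum>i\<in>UNIV. h $ i *\<^sub>R axis i 1)"
    using basis_expansion[of h] by (simp add: scalar_mult_eq_scaleR)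
  then have "frechet_derivative f (at x) h = frechet_derivative f (at x) (\<Sum>i\<in>UNIV. h $ i *\<^sub>R axis i 1)" by simp
  then show ?thesis by (simp add: sum scaleR)
qed

text \<open>\<open>Ck_on\<close> gives continuity of the derivative in each fixed direction only;
  compactness is applied to the finitely many coordinate directions, and linearity yields a bound
  uniform in \<open>h\<close>.\<close>

lemma frechet_derivative_bound_cball:
  fixes f :: "real^'n \<Rightarrow> real"
  assumes "Ck_on (Suc 0) V f" "cball p r \<subseteq> V"
  obtains B where "B \<ge> 0" "\<And>x h. x \<in> cball p r \<Longrightarrow> \<bar>frechet_derivative f (at x) h\<bar> \<le> B * norm h"
proof -
  have d: "\<And>x. x \<in> V \<Longrightarrow> f differentiable (at x)"
    and c: "\<And>h. continuous_on V (\<lambda>x. frechet_derivative f (at x) h)" using assms(1) by auto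
  have "\<exists>b. \<forall>x\<in>cball p r. \<bar>frechet_derivative f (at x) (axis i 1)\<bar> \<le> b" for i
  proof -
    have "bounded ((\<lambda>x. frechet_derivative f (at x) (axis i 1)) ` cball p r)"
      by (intro compact_imp_bounded compact_continuous_image continuous_on_subset[OF c assms(2)]) simp
    then show ?thesis by (auto simp: bounded_iff)
  qed
  then obtain b where b: "\<And>i x. x \<in> cball p r \<Longrightarrow> \<bar>frechet_derivative f (at x) (axis i 1)\<bar> \<le> b i" by metis
  have main: "\<bar>frechet_derivative f (at x) h\<bar> \<le> (\<Sum>i\<in>UNIV. \<bar>b i\<bar>) * norm h" if x: "x \<in> cball p r" for x h
  proof -
    have "\<bar>frechet_derivative f (at x) h\<bar> \<le> (\<Sum>i\<in>UNIV. \<bar>h $ i * frechet_derivative f (at x) (axis i 1)\<bar>)"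
      using x assms(2) d by (subst frechet_derivative_sum_axis) auto
    also have "\<dots> \<le> (\<Sum>i\<in>UNIV. norm h * \<bar>b i\<bar>)"
      unfolding abs_mult
      by (intro sum_mono mult_mono component_le_norm_cart) (use order_trans[OF b[OF x] abs_ge_self] in auto)
    finally show ?thesis by (simp add: sum_distrib_left mult.commute)
  qed
  show ?thesis by (rule that[OF _ main]) (auto intro: sum_nonneg)
qed

lemma Ck_on_lipschitz_cball:
  fixes f :: "real^'n \<Rightarrow> real"
  assumes "Ck_on (Suc 0) V f" "cball p r \<subseteq> V"
  obtains B where "B \<ge> 0" "\<And>x y. x \<in> cball p r \<Longrightarrow> y \<in> cball p r \<Longrightarrow> \<bar>f x - f y\<bar> \<le> B * norm (x - y)"
proof -
  obtain B where B: "B \<ge> 0" "\<And>x h. x \<in> cball p r \<Longrightarrow> \<bar>frechet_derivative f (at x) h\<bar> \<le> B * norm h"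
    using frechet_derivative_bound_cball[OF assms] by blast
  have "norm (f x - f y) \<le> B * norm (x - y)" if "x \<in> cball p r" "y \<in> cball p r" for x y
  proof (rule differentiable_bound[OF convex_cball _ _ that])
    fix x assume x: "x \<in> cball p r"
    show "(f has_derivative frechet_derivative f (at x)) (at x within cball p r)"
      using assms x by (metis Ck_on.simps(2) frechet_derivative_works has_derivative_at_withinI subsetD)
    show "onorm (frechet_derivative f (at x)) \<le> B"
      using B(2)[OF x] by (intro onorm_le) simp
  qed
  then show ?thesis using B(1) that by auto
qed

lemma gradient_lipschitz_cball:
  fixes f :: "real^'n \<Rightarrow> real"
  assumes "Ck_on (Suc (Suc 0)) V f" "cball p r \<subseteq> V"
  obtains B where "B \<ge> 0" "\<And>x y h. x \<in> cball p r \<Longrightarrow> y \<in> cball p r \<Longrightarrow>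
    \<bar>frechet_derivative f (at x) h - frechet_derivative f (at y) h\<bar> \<le> B * norm (x - y) * norm h"
proof -
  have d: "\<And>x. x \<in> V \<Longrightarrow> f differentiable (at x)"
    and c: "\<And>h. Ck_on (Suc 0) V (\<lambda>x. frechet_derivative f (at x) h)" using assms(1) by auto
  have "\<exists>b\<ge>0. \<forall>x\<in>cball p r. \<forall>y\<in>cball p r. \<bar>frechet_derivative f (at x) (axis i 1) - frechet_derivative f (at y) (axis i 1)\<bar> \<le> b * norm (x - y)" for i
    using Ck_on_lipschitz_cball[OF c assms(2)] by metis
  then obtain b where b: "\<And>i. b i \<ge> 0" "\<And>i x y. x \<in> cball p r \<Longrightarrow> y \<in> cball p r \<Longrightarrow>
     \<bar>frechet_derivative f (at x) (axis i 1) - frechet_derivative f (at y) (axis i 1)\<bar> \<le> b i * norm (x - y)" by metis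
  have main: "\<bar>frechet_derivative f (at x) h - frechet_derivative f (at y) h\<bar> \<le> (\<Sum>i\<in>UNIV. b i) * norm (x - y) * norm h"
    if x: "x \<in> cball p r" and y: "y \<in> cball p r" for x y h
  proof -
    have "frechet_derivative f (at x) h - frechet_derivative f (at y) h =
      (\<Sum>i\<in>UNIV. h $ i * (frechet_derivative f (at x) (axis i 1) - frechet_derivative f (at y) (axis i 1)))"
      using frechet_derivative_sum_axis[of f x h] frechet_derivative_sum_axis[of f y h] d x y assms(2)
      by (simp add: subset_iff right_diff_distrib sum_subtractf)
    also have "\<bar>\<dots>\<bar> \<le> (\<Sum>i\<in>UNIV. norm h * (b i * norm (x - y)))"
    proof (rule order_trans[OF sum_abs sum_mono])
      fix i
      show "\<bar>h $ i * (frechet_derivative f (at x) (axis i 1) - frechet_derivative f (at y) (axis i 1))\<bar>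
        \<le> norm h * (b i * norm (x - y))"
        unfolding abs_mult by (intro mult_mono component_le_norm_cart b x y) auto
    qed
    finally show ?thesis by (simp add: sum_distrib_left sum_distrib_right mult_ac)
  qed
  show ?thesis by (rule that[OF _ main]) (auto intro: sum_nonneg b)
qed

text \<open>Translates tangency from unit normals to a particular defining function, the form in
  which it can be differentiated along a trajectory.\<close>

lemma frontier_tangency:
  assumes "local_defining_function U p \<rho>" "(GDERIV \<rho> p :> D)" "\<And>n. outward_unit_normal U p n \<Longrightarrow> w \<bullet> n = 0"
  shows "frechet_derivative \<rho> (at p) w = 0"
proof -
  have "w \<bullet> (D /\<^sub>R norm D) = 0" using assms unfolding outward_unit_normal_def by blast
  then have "w \<bullet> D = 0" by (cases "D = 0") auto
  moreover have "frechet_derivative \<rho> (at p) = (\<lambda>h. h \<bullet> D)"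
    using assms(2) unfolding gderiv_def by (rule frechet_derivative_at[symmetric])
  ultimately show ?thesis by simp
qed

lemma differentiable_GDERIV:
  fixes f :: "real^'n \<Rightarrow> real"
  assumes "f differentiable (at x)"
  shows "\<exists>D. (GDERIV f x :> D)"
proof
  let ?D = "\<chi> i. frechet_derivative f (at x) (axis i 1)"
  have "(\<lambda>h. h \<bullet> ?D) = frechet_derivative f (at x)"
    by (simp add: fun_eq_iff frechet_derivative_sum_axis[OF assms, symmetric] inner_vec_def)
  then show "GDERIV f x :> ?D"
    unfolding gderiv_def using assms frechet_derivative_works by metis
qed

text \<open>Walking from \<open>x\<close> in the direction of the gradient at \<open>p\<close> leaves the domain after a distance
  comparable to \<open>\<bar>\<rho> x\<bar>\<close>, and a frontier point, where the field is tangent, lies on the way.\<close>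

lemma tangential_field_estimate:
  fixes v :: "real \<Rightarrow> real^3 \<Rightarrow> real^3"
  assumes loc: "local_defining_function U p \<rho>" and "open U" and fr: "p \<in> frontier U"
    and J: "compact J" and v: "continuous_on (J \<times> UNIV) (\<lambda>(t, x). v t x)"
    and K: "K \<ge> 0" "\<And>t x y. t \<in> J \<Longrightarrow> norm (v t x - v t y) \<le> K * norm (x - y)"
    and tan: "\<And>t q n. t \<in> J \<Longrightarrow> q \<in> frontier U \<Longrightarrow> outward_unit_normal U q n \<Longrightarrow> v t q \<bullet> n = 0"
  obtains r C where "r > 0" "\<And>x. x \<in> ball p r \<Longrightarrow> \<rho> differentiable (at x)"
    "\<And>x. x \<in> ball p r \<Longrightarrow> x \<in> U \<longleftrightarrow> \<rho> x < 0"
    "\<And>x t. x \<in> ball p r \<Longrightarrow> x \<in> U \<Longrightarrow> t \<in> J \<Longrightarrow> \<bar>frechet_derivative \<rho> (at x) (v t x)\<bar> \<le> C * \<bar>\<rho> x\<bar>"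
proof -
  obtain V where V: "open V" "p \<in> V" "smooth_on V \<rho>" "\<And>x. x \<in> V \<Longrightarrow> \<not> (GDERIV \<rho> x :> 0)"
      "U \<inter> V = {x \<in> V. \<rho> x < 0}"
    using loc unfolding local_defining_function_def by blast
  have locV: "local_defining_function U q \<rho>" if "q \<in> V" for q
    using V that unfolding local_defining_function_def by blast
  let ?D = "\<lambda>x. frechet_derivative \<rho> (at x)"
  have ck: "Ck_on (Suc 0) V \<rho>" "Ck_on (Suc (Suc 0)) V \<rho>" using V(3) unfolding smooth_on_def by blast+
  then have diff: "\<And>x. x \<in> V \<Longrightarrow> \<rho> differentiable (at x)"
    and contD: "\<And>h. continuous_on V (\<lambda>x. ?D x h)" by auto
  obtain r0 where r0: "r0 > 0" "cball p r0 \<subseteq> V" using V(1,2) open_contains_cball by blast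
  obtain B where B: "B \<ge> 0" "\<And>x h. x \<in> cball p r0 \<Longrightarrow> \<bar>?D x h\<bar> \<le> B * norm h"
    using frechet_derivative_bound_cball[OF ck(1) r0(2)] by blast
  obtain L where L: "L \<ge> 0" "\<And>x y h. x \<in> cball p r0 \<Longrightarrow> y \<in> cball p r0 \<Longrightarrow> \<bar>?D x h - ?D y h\<bar> \<le> L * norm (x - y) * norm h"
    using gradient_lipschitz_cball[OF ck(2) r0(2)] by blast
  have "bounded ((\<lambda>(t, x). v t x) ` (J \<times> cball p r0))"
    by (intro compact_imp_bounded compact_continuous_image compact_Times J
        continuous_on_subset[OF v]) auto
  then obtain W where W: "\<And>t x. t \<in> J \<Longrightarrow> x \<in> cball p r0 \<Longrightarrow> norm (v t x) \<le> W"
    unfolding bounded_iff by fastforce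
  obtain n where n: "GDERIV \<rho> p :> n" using differentiable_GDERIV diff V(2) by blast
  then have n0: "n \<noteq> 0" using V(2,4) by blast
  have Dp: "?D p n = n \<bullet> n"
    using frechet_derivative_at[OF n[unfolded gderiv_def]] by metis
  \<comment> \<open>Half of the squared gradient at \<open>p\<close>, so that by continuity it stays
    a lower bound for the derivative in direction \<open>n\<close> near \<open>p\<close>.\<close>
  define c where "c = (n \<bullet> n) / 2"
  have c: "c > 0" "?D p n > c" using n0 by (auto simp: c_def Dp)
  have "\<forall>\<^sub>F x in nhds p. ?D x n > c"
  proof -
    have "isCont (\<lambda>x. ?D x n) p" using contD V(1,2) continuous_on_eq_continuous_at by blast
    then have "\<forall>\<^sub>F x in at p. ?D x n > c" using c(2) by (simp add: isCont_def order_tendstoD(1))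
    then show ?thesis using c(2) by (simp add: eventually_nhds_conv_at)
  qed
  then obtain r1' where r1': "r1' > 0" "\<And>x. dist x p < r1' \<Longrightarrow> ?D x n > c"
    by (auto simp: eventually_nhds_metric)
  define r1 where "r1 = min r0 r1'"
  have r1: "r1 > 0" "r1 \<le> r0" "\<And>x. dist x p < r1 \<Longrightarrow> ?D x n > c" using r0 r1' by (auto simp: r1_def)
  have contp: "isCont \<rho> p" using diff V(2) differentiable_imp_continuous_within by blast
  have \<rho>p: "\<rho> p = 0"
  proof (rule antisym)
    have "p \<notin> U" using fr \<open>open U\<close> frontier_disjoint_eq by blast
    then show "0 \<le> \<rho> p" using V(2,5) by force
    show "\<rho> p \<le> 0"
    proof (rule ccontr)
      assume "\<not> \<rho> p \<le> 0"
      then have "\<forall>\<^sub>F x in at p. \<rho> x > 0" using contp by (simp add: isCont_def order_tendstoD(1))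
      moreover have "\<forall>\<^sub>F x in at p. x \<in> V" using V(1,2) by (simp add: eventually_at_in_open')
      ultimately have "\<forall>\<^sub>F x in at p. x \<notin> U" by eventually_elim (use V(5) in force)
      moreover have "p islimpt U"
        using fr \<open>p \<notin> U\<close> by (simp add: frontier_def closure_def)
      ultimately show False by (simp add: islimpt_iff_eventually)
    qed
  qed
  \<comment> \<open>The threshold is what makes the length \<open>s * norm n\<close> of the walk
    below less than \<open>r1 / 2\<close>, so that the walk stays where the derivative in direction
    \<open>n\<close> exceeds \<open>c\<close>.\<close>
  have "\<forall>\<^sub>F x in nhds p. \<bar>\<rho> x\<bar> < r1 * c / (2 * norm n)"
  proof -
    have pos: "r1 * c / (2 * norm n) > 0" using r1 c n0 by simp
    have "\<forall>\<^sub>F x in at p. dist (\<rho> x) (\<rho> p) < r1 * c / (2 * norm n)"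
      using contp pos unfolding isCont_def by (rule tendstoD)
    then show ?thesis using pos \<rho>p by (simp add: eventually_nhds_conv_at)
  qed
  then obtain r2 where r2: "r2 > 0" "\<And>x. dist x p < r2 \<Longrightarrow> \<bar>\<rho> x\<bar> < r1 * c / (2 * norm n)"
    by (auto simp: eventually_nhds_metric)
  define r where "r = min r2 (r1 / 2)"
  have r: "r > 0" "r \<le> r2" "r \<le> r1 / 2" using r1 r2 by (auto simp: r_def)
  have inV: "x \<in> V" if "dist x p < r1" for x using that r0(2) r1(2) by (auto simp: dist_commute)
  have near: "\<exists>y\<in>frontier U. dist y p < r1 \<and> norm (x - y) \<le> norm n / c * \<bar>\<rho> x\<bar>"
    if x: "x \<in> ball p r" "x \<in> U" for x
  proof -
    have xp: "dist x p < r" using x by (simp add: dist_commute)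
    \<comment> \<open>Along \<open>n\<close> the defining function grows at a rate above
      \<open>c\<close>, so after parameter length |\<rho> x| / c it is nonnegative and the domain
      has been left.\<close>
    define s where "s = \<bar>\<rho> x\<bar> / c"
    have \<rho>x: "\<rho> x < 0" using inV[of x] xp r r1(1) x(2) V(5) by auto
    have s: "s > 0" "s * norm n < r1 / 2"
    proof -
      show "s > 0" using \<rho>x c(1) unfolding s_def by (intro divide_pos_pos) auto
      have "\<bar>\<rho> x\<bar> < r1 * c / (2 * norm n)" using xp r r2 by auto
      then show "s * norm n < r1 / 2" using c(1) n0 by (simp add: s_def field_simps)
    qed
    have seg: "dist (x + a *\<^sub>R n) p < r1" if "0 \<le> a" "a \<le> s" for a
    proof -
      have "dist (x + a *\<^sub>R n) p \<le> dist x p + a * norm n"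
        using that norm_triangle_ineq[of "x - p" "a *\<^sub>R n"] by (simp add: dist_norm algebra_simps)
      also have "a * norm n \<le> s * norm n" using that by (intro mult_right_mono) auto
      finally show ?thesis using xp r s by linarith
    qed
    let ?g = "\<lambda>a. \<rho> (x + a *\<^sub>R n)"
    have dg: "(?g has_real_derivative ?D (x + a *\<^sub>R n) n) (at a)" if "0 \<le> a" "a \<le> s" for a
    proof -
      let ?y = "x + a *\<^sub>R n"
      have "(\<rho> has_derivative ?D ?y) (at ?y)"
        using diff[OF inV[OF seg[OF that]]] frechet_derivative_works by blast
      then have "(?g has_derivative (\<lambda>h. ?D ?y (h *\<^sub>R n))) (at a)"
        by (rule has_derivative_compose[rotated]) (auto intro!: derivative_eq_intros)
      moreover have "?D ?y (h *\<^sub>R n) = h * ?D ?y n" for h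
        using linear_frechet_derivative[OF diff[OF inV[OF seg[OF that]]]] by (simp add: linear_cmul)
      ultimately show ?thesis by (simp add: has_field_derivative_def mult.commute[of _ "?D ?y n"])
    qed
    obtain a where a: "0 < a" "a < s" "?g s - ?g 0 = (s - 0) * ?D (x + a *\<^sub>R n) n"
      using MVT2[OF s(1), of ?g "\<lambda>a. ?D (x + a *\<^sub>R n) n"] dg by blast
    have "s * c \<le> s * ?D (x + a *\<^sub>R n) n"
      using a r1(3)[OF seg[of a]] s(1) by (intro mult_left_mono) auto
    moreover have "s * c = - \<rho> x" using \<rho>x c by (simp add: s_def)
    ultimately have "?g s \<ge> 0" using a(3) by simp
    then have "x + s *\<^sub>R n \<notin> U" using V(5) inV[OF seg[of s]] s(1) by force
    moreover have "connected (closed_segment x (x + s *\<^sub>R n))" by simp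
    ultimately have "closed_segment x (x + s *\<^sub>R n) \<inter> frontier U \<noteq> {}"
      using x(2) by (intro connected_Int_frontier) auto
    then obtain y where y: "y \<in> closed_segment x (x + s *\<^sub>R n)" "y \<in> frontier U" by blast
    then obtain b where b: "0 \<le> b" "b \<le> 1" "y = x + (b * s) *\<^sub>R n"
      by (auto simp: in_segment algebra_simps)
    have bs: "0 \<le> b * s" "b * s \<le> s" using b s by (auto simp: mult_left_le_one_le)
    have "norm (x - y) = (b * s) * norm n" using b bs by simp
    also have "\<dots> \<le> s * norm n" using bs by (intro mult_right_mono) auto
    finally show ?thesis using y seg[OF bs] b(3) by (intro bexI[of _ y]) (auto simp: s_def mult_ac)
  qed
  define E where "E = (B * K + L * W) * (norm n / c)"
  show ?thesis
  proof (rule that[of r E])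
    show "r > 0" by (rule r)
    fix x assume x: "x \<in> ball p r"
    then have xr: "dist x p < r1" using r r1 by (auto simp: dist_commute)
    show "\<rho> differentiable (at x)" by (rule diff[OF inV[OF xr]])
    show "x \<in> U \<longleftrightarrow> \<rho> x < 0" using V(5) inV[OF xr] by auto
    fix t assume xU: "x \<in> U" and t: "t \<in> J"
    obtain y where y: "y \<in> frontier U" "dist y p < r1" "norm (x - y) \<le> norm n / c * \<bar>\<rho> x\<bar>"
      using near[OF x xU] by blast
    have xc: "x \<in> cball p r0" and yc: "y \<in> cball p r0" using xr y r1 by (auto simp: dist_commute)
    obtain G where "GDERIV \<rho> y :> G" using differentiable_GDERIV diff[OF inV[OF y(2)]] by blast
    then have Dy: "?D y (v t y) = 0"
      by (rule frontier_tangency[OF locV[OF inV[OF y(2)]]]) (rule tan[OF t y(1)])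
    \<comment> \<open>Comparison with the frontier point \<open>y\<close>, where the derivative of
      \<rho> along the field is zero: changing the field costs B * K * |x - y|, changing the
      gradient costs L * W * |x - y|.\<close>
    have lin: "?D x (v t x) = ?D x (v t x - v t y) + ?D x (v t y)"
      using linear_diff[OF linear_frechet_derivative[OF diff[OF inV[OF xr]]]] by simp
    have "\<bar>?D x (v t x)\<bar> \<le> \<bar>?D x (v t x - v t y)\<bar> + \<bar>?D x (v t y) - ?D y (v t y)\<bar>"
      unfolding lin Dy by linarith
    also have "\<bar>?D x (v t x - v t y)\<bar> \<le> B * (K * norm (x - y))"
      using B(2)[OF xc, of "v t x - v t y"] mult_left_mono[OF K(2)[OF t, of x y] B(1)] by linarith
    also have "\<bar>?D x (v t y) - ?D y (v t y)\<bar> \<le> L * norm (x - y) * W"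
      using L(2)[OF xc yc, of "v t y"] mult_left_mono[OF W[OF t yc], of "L * norm (x - y)"] L(1) by simp
    finally have "\<bar>?D x (v t x)\<bar> \<le> (B * K + L * W) * norm (x - y)" by (simp add: algebra_simps)
    also have "\<dots> \<le> (B * K + L * W) * (norm n / c * \<bar>\<rho> x\<bar>)"
      using B(1) K(1) L(1) W[OF t yc] norm_ge_zero[of "v t y"]
      by (intro mult_left_mono y) (auto intro!: add_nonneg_nonneg mult_nonneg_nonneg simp del: norm_ge_zero)
    finally show "\<bar>?D x (v t x)\<bar> \<le> E * \<bar>\<rho> x\<bar>" by (simp add: E_def mult_ac)
  qed
qed

text \<open>At the last time outside \<open>U\<close> the trajectory is on the frontier, where the
  defining function vanishes. Just afterwards it is inside, where \<rho> is nonzero and the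
  derivative of \<rho> along the trajectory is bounded by a multiple of |\<rho>|; by
  \<open>nonzero_backward\<close>, \<rho> cannot have started from zero.\<close>

lemma flow_stays_inside:
  fixes v :: "real \<Rightarrow> real^3 \<Rightarrow> real^3"
  assumes "open U" and reg: "\<And>p. p \<in> frontier U \<Longrightarrow> \<exists>\<rho>. local_defining_function U p \<rho>"
    and v: "continuous_on ({0..T} \<times> UNIV) (\<lambda>(t, x). v t x)"
    and K: "K \<ge> 0" "\<And>t x y. t \<in> {0..T} \<Longrightarrow> norm (v t x - v t y) \<le> K * norm (x - y)"
    and tan: "\<And>t q n. t \<in> {0..T} \<Longrightarrow> q \<in> frontier U \<Longrightarrow> outward_unit_normal U q n \<Longrightarrow> v t q \<bullet> n = 0"
    and \<gamma>: "\<And>t. t \<in> {0..T} \<Longrightarrow> (\<gamma> has_vector_derivative v t (\<gamma> t)) (at t within {0..T})"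
    and "\<gamma> T \<in> U" "t \<in> {0..T}"
  shows "\<gamma> t \<in> U"
proof (rule ccontr)
  assume "\<gamma> t \<notin> U"
  have cont: "continuous_on {0..T} \<gamma>"
    using \<gamma> by (meson continuous_on_eq_continuous_within has_vector_derivative_continuous)
  define S where "S = {s \<in> {0..T}. \<gamma> s \<in> - U}"
  have "closed S"
    unfolding S_def using \<open>open U\<close> continuous_closed_preimage[OF cont, of "- U"]
    by (simp add: vimage_def Int_def closed_Compl)
  moreover have "S \<noteq> {}" using \<open>\<gamma> t \<notin> U\<close> \<open>t \<in> {0..T}\<close> by (auto simp: S_def)
  moreover have bdd: "bdd_above S" by (auto simp: S_def intro: bdd_aboveI[of _ T])
  ultimately have t0S: "Sup S \<in> S" by (intro closed_contains_Sup)
  define t0 where "t0 = Sup S"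
  have t0: "t0 \<in> {0..T}" "\<gamma> t0 \<notin> U" using t0S by (auto simp: S_def t0_def)
  then have "t0 < T" using \<open>\<gamma> T \<in> U\<close> by (cases "t0 = T") auto
  have after: "\<gamma> s \<in> U" if "t0 < s" "s \<le> T" for s
    using cSup_upper[OF _ bdd, of s] that t0 by (auto simp: S_def t0_def)
  have lim: "(\<gamma> \<longlongrightarrow> \<gamma> t0) (at_right t0)"
  proof -
    have "(\<gamma> \<longlongrightarrow> \<gamma> t0) (at t0 within {t0..T})"
      using continuous_on_subset[OF cont, of "{t0..T}"] t0(1) by (auto simp: continuous_on_def)
    then show ?thesis using \<open>t0 < T\<close> by (simp add: at_within_Icc_at_right)
  qed
  have ev: "\<forall>\<^sub>F s in at_right t0. s \<in> {t0<..<T}" using \<open>t0 < T\<close> by (rule eventually_at_right_real)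
  have "\<gamma> t0 \<in> closure U"
  proof (rule Lim_in_closed_set[OF closed_closure _ _ lim])
    show "\<forall>\<^sub>F s in at_right t0. \<gamma> s \<in> closure U"
      using ev by eventually_elim (use after closure_subset in force)
  qed simp
  then have fr: "\<gamma> t0 \<in> frontier U"
    using t0(2) \<open>open U\<close> by (simp add: frontier_def interior_open)
  obtain \<rho> where \<rho>: "local_defining_function U (\<gamma> t0) \<rho>" using reg[OF fr] by blast
  obtain r C where r: "r > 0" and diff: "\<And>x. x \<in> ball (\<gamma> t0) r \<Longrightarrow> \<rho> differentiable (at x)"
    and inU: "\<And>x. x \<in> ball (\<gamma> t0) r \<Longrightarrow> x \<in> U \<longleftrightarrow> \<rho> x < 0"
    and est: "\<And>x t. x \<in> ball (\<gamma> t0) r \<Longrightarrow> x \<in> U \<Longrightarrow> t \<in> {0..T} \<Longrightarrow> \<bar>frechet_derivative \<rho> (at x) (v t x)\<bar> \<le> C * \<bar>\<rho> x\<bar>"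
    using tangential_field_estimate[OF \<rho> \<open>open U\<close> fr compact_Icc v K tan] by blast
  have "\<forall>\<^sub>F s in at_right t0. \<gamma> s \<in> ball (\<gamma> t0) r"
    using tendstoD[OF lim r] by (simp add: dist_commute)
  with ev have "\<forall>\<^sub>F s in at_right t0. s \<in> {t0<..<T} \<and> \<gamma> s \<in> ball (\<gamma> t0) r" by eventually_elim auto
  then obtain b' where b': "b' > t0" "\<And>s. s > t0 \<Longrightarrow> s < b' \<Longrightarrow> s \<in> {t0<..<T} \<and> \<gamma> s \<in> ball (\<gamma> t0) r"
    by (auto simp: eventually_at_right[OF \<open>t0 < T\<close>])
  \<comment> \<open>The midpoint makes the closed interval up to \<open>b\<close> stay inside the
    ball on which the tangential estimate holds.\<close>
  define b where "b = (t0 + b') / 2"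
  have b: "t0 < b" "\<And>s. s \<in> {t0..b} \<Longrightarrow> s \<in> {0..T} \<and> \<gamma> s \<in> ball (\<gamma> t0) r"
      "\<And>s. t0 < s \<Longrightarrow> s \<le> b \<Longrightarrow> s < T"
  proof -
    show "t0 < b" using b'(1) by (simp add: b_def)
    have bb: "b < b'" using b'(1) by (simp add: b_def)
    show "s \<in> {0..T} \<and> \<gamma> s \<in> ball (\<gamma> t0) r" if "s \<in> {t0..b}" for s
      using that b'(2)[of s] bb t0(1) r by (cases "s = t0") auto
    show "s < T" if "t0 < s" "s \<le> b" for s using that b'(2)[of s] bb by auto
  qed
  have "\<rho> (\<gamma> t0) \<noteq> 0"
  proof (rule nonzero_backward[where z="\<lambda>s. \<rho> (\<gamma> s)" and b=b and K=C
        and z'="\<lambda>s. frechet_derivative \<rho> (at (\<gamma> s)) (v s (\<gamma> s))"])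
    show "t0 \<le> b" using b(1) by simp
    have "continuous_on (ball (\<gamma> t0) r) \<rho>"
      using diff by (meson continuous_at_imp_continuous_on differentiable_imp_continuous_within)
    then show "continuous_on {t0..b} (\<lambda>s. \<rho> (\<gamma> s))"
      by (rule continuous_on_compose2) (use b(2) continuous_on_subset[OF cont] in \<open>auto simp: subset_iff\<close>)
    have "\<gamma> b \<in> U" using after[of b] b(1,3) by force
    then show "\<rho> (\<gamma> b) \<noteq> 0" using inU[of "\<gamma> b"] b(1) b(2)[of b] by auto
    fix s assume s: "t0 < s" "s < b"
    have s': "s \<in> {0..T}" "\<gamma> s \<in> ball (\<gamma> t0) r" "s < T" "0 < s" using b(2)[of s] b(3)[of s] s t0(1) by auto
    show "norm (frechet_derivative \<rho> (at (\<gamma> s)) (v s (\<gamma> s))) \<le> C * norm (\<rho> (\<gamma> s))"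
      using est[OF s'(2) after s'(1)] s s'(3) by simp
    have "(\<gamma> has_vector_derivative v s (\<gamma> s)) (at s)"
      using \<gamma>[OF s'(1)] s'(3,4) by (simp add: at_within_Icc_at)
    then have "((\<lambda>s. \<rho> (\<gamma> s)) has_derivative (\<lambda>h. frechet_derivative \<rho> (at (\<gamma> s)) (h *\<^sub>R v s (\<gamma> s)))) (at s)"
      unfolding has_vector_derivative_def
      by (rule has_derivative_compose) (use diff[OF s'(2)] frechet_derivative_works in blast)
    moreover have "frechet_derivative \<rho> (at (\<gamma> s)) (h *\<^sub>R w) = h *\<^sub>R frechet_derivative \<rho> (at (\<gamma> s)) w" for h w
      using linear_frechet_derivative[OF diff[OF s'(2)]] by (rule linear_cmul)
    ultimately show "((\<lambda>s. \<rho> (\<gamma> s)) has_vector_derivative frechet_derivative \<rho> (at (\<gamma> s)) (v s (\<gamma> s))) (at s)"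
      unfolding has_vector_derivative_def by simp
  qed
  moreover have "\<rho> (\<gamma> t0) = 0"
  proof (rule antisym)
    show "0 \<le> \<rho> (\<gamma> t0)" using inU[of "\<gamma> t0"] t0(2) r by auto
    have "isCont \<rho> (\<gamma> t0)" using diff[of "\<gamma> t0"] r differentiable_imp_continuous_within by auto
    then have "((\<lambda>s. \<rho> (\<gamma> s)) \<longlongrightarrow> \<rho> (\<gamma> t0)) (at_right t0)" using lim by (rule isCont_tendsto_compose)
    then show "\<rho> (\<gamma> t0) \<le> 0"
    proof (rule tendsto_upperbound)
      show "\<forall>\<^sub>F s in at_right t0. \<rho> (\<gamma> s) \<le> 0"
        using \<open>\<forall>\<^sub>F s in at_right t0. s \<in> {t0<..<T} \<and> \<gamma> s \<in> ball (\<gamma> t0) r\<close>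
        by eventually_elim (use after inU in \<open>auto intro!: less_imp_le\<close>)
    qed simp
  qed
  ultimately show False by simp
qed

section \<open>Bicharacteristics and amplitudes\<close>

lemma has_vector_derivative_cart:
  fixes f :: "real \<Rightarrow> real^'n"
  assumes "\<And>i. ((\<lambda>t. f t $ i) has_real_derivative f' $ i) F"
  shows "(f has_vector_derivative f') F"
  unfolding has_vector_derivative_def
proof (rule has_derivative_cart)
  fix i
  show "((\<lambda>t. f t $ i) has_derivative (\<lambda>h. (h *\<^sub>R f') $ i)) F"
    using assms[of i] unfolding has_field_derivative_def
    by (rule has_derivative_eq_rhs) (simp add: fun_eq_iff mult.commute)
qed

lemma has_real_derivative_inner:
  fixes f g :: "real \<Rightarrow> 'a::real_inner"
  assumes "(f has_vector_derivative f') (at t within S)" "(g has_vector_derivative g') (at t within S)"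
  shows "((\<lambda>t. f t \<bullet> g t) has_real_derivative (f t \<bullet> g' + f' \<bullet> g t)) (at t within S)"
  using bounded_bilinear.has_vector_derivative[OF bounded_bilinear_inner assms]
  by (simp add: has_real_derivative_iff_has_vector_derivative)

lemma constant_on_Icc:
  fixes f :: "real \<Rightarrow> real"
  assumes "\<And>t. t \<in> {0..T} \<Longrightarrow> (f has_real_derivative 0) (at t within {0..T})" "t \<in> {0..T}"
  shows "f t = f 0"
proof -
  obtain c where "\<And>t. t \<in> {0..T} \<Longrightarrow> f t = c"
    using has_field_derivative_zero_constant[of "{0..T}" f] assms(1) by auto
  then show ?thesis using assms(2) by auto
qed

text \<open>The second difference of \<open>P\<close> with steps s a and s b is symmetric in a and
  b. By the mean value theorem along a it equals s^2 (a \<bullet> D b) up to a small multiple of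
  s^2, so the two orders of differentiation agree. Only differentiability of the gradient at
  \<open>x\<close> enters; this suits the pressure, for which no second-order regularity is given in
  advance.\<close>

lemma Schwarz_symmetry:
  fixes P :: "'a::real_inner \<Rightarrow> real"
  assumes "open U" "x \<in> U" "\<And>y. y \<in> U \<Longrightarrow> GDERIV P y :> G y" "(G has_derivative D) (at x)"
  shows "h \<bullet> D k = k \<bullet> D h"
proof -
  interpret D: bounded_linear D by (rule has_derivative_bounded_linear[OF assms(4)])
  define N where "N = norm h + norm k + 1"
  have N: "N > 0" "norm h \<le> N" "norm k \<le> N" "norm h + norm k \<le> N" by (auto simp: N_def add_nonneg_pos)
  have main: "\<bar>h \<bullet> D k - k \<bullet> D h\<bar> \<le> 4 * e * N\<^sup>2" if e: "e > 0" for e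
  proof -
    obtain d1 where d1: "d1 > 0" "\<And>y. norm (y - x) < d1 \<Longrightarrow> norm (G y - G x - D (y - x)) \<le> e * norm (y - x)"
      using has_derivative_at_alt[THEN iffD1, OF assms(4)] e by blast
    obtain d2 where d2: "d2 > 0" "ball x d2 \<subseteq> U" using assms(1,2) openE by blast
    \<comment> \<open>Small enough for all points of the parallelogram to lie in \<open>U\<close>
      and in the ball where the linearisation of \<open>G\<close> has relative error
      \<open>e\<close>.\<close>
    define s where "s = min d1 d2 / (2 * N)"
    have s: "s > 0" "s * N < d1" "s * N < d2" using d1(1) d2(1) N(1) by (auto simp: s_def)
    have key: "\<bar>(P (x + s *\<^sub>R a + s *\<^sub>R b) - P (x + s *\<^sub>R a) - P (x + s *\<^sub>R b) + P x) - s\<^sup>2 * (a \<bullet> D b)\<bar> \<le> 2 * e * s\<^sup>2 * N\<^sup>2"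
      if ab: "norm a + norm b \<le> N" for a b
    proof -
      \<comment> \<open>The second difference is \<open>?p 1 - ?p 0\<close>; its mean value contains
        a difference of two gradients whose linear parts differ by exactly D (s b).\<close>
      let ?p = "\<lambda>\<tau>. P (x + (\<tau> * s) *\<^sub>R a + s *\<^sub>R b) - P (x + (\<tau> * s) *\<^sub>R a)"
      let ?p' = "\<lambda>\<tau>. (s *\<^sub>R a) \<bullet> (G (x + (\<tau> * s) *\<^sub>R a + s *\<^sub>R b) - G (x + (\<tau> * s) *\<^sub>R a))"
      have near: "norm ((\<tau> * s) *\<^sub>R a + c *\<^sub>R b) \<le> s * N" if "0 \<le> \<tau>" "\<tau> \<le> 1" "0 \<le> c" "c \<le> s" for \<tau> c
      proof -
        have "norm ((\<tau> * s) *\<^sub>R a + c *\<^sub>R b) \<le> (\<tau> * s) * norm a + c * norm b"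
          using that s(1) by (intro order_trans[OF norm_triangle_ineq]) simp
        also have "\<dots> \<le> s * norm a + s * norm b"
          using that s(1) by (intro add_mono mult_right_mono) (auto simp: mult_left_le_one_le)
        also have "\<dots> \<le> s * N" using ab s(1) by (simp flip: distrib_left)
        finally show ?thesis .
      qed
      have inU: "x + ((\<tau> * s) *\<^sub>R a + c *\<^sub>R b) \<in> U" if "0 \<le> \<tau>" "\<tau> \<le> 1" "0 \<le> c" "c \<le> s" for \<tau> c
      proof -
        have "dist x (x + ((\<tau> * s) *\<^sub>R a + c *\<^sub>R b)) < d2"
          using near[OF that] s(3) by (subst dist_commute) (simp add: dist_norm)
        then show ?thesis using d2(2) by auto
      qed
      have line: "((\<lambda>\<tau>. P (x + (\<tau> * s) *\<^sub>R a + c *\<^sub>R b)) has_real_derivative (s *\<^sub>R a) \<bullet> G (x + (\<tau> * s) *\<^sub>R a + c *\<^sub>R b)) (at \<tau>)"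
        if "0 \<le> \<tau>" "\<tau> \<le> 1" "0 \<le> c" "c \<le> s" for \<tau> c
      proof -
        let ?y = "x + (\<tau> * s) *\<^sub>R a + c *\<^sub>R b"
        have "(P has_derivative (\<lambda>h. h \<bullet> G ?y)) (at ?y)"
          using assms(3) inU[OF that] by (simp add: gderiv_def add.assoc)
        then have "((\<lambda>\<tau>. P (x + (\<tau> * s) *\<^sub>R a + c *\<^sub>R b)) has_derivative (\<lambda>h. ((h * s) *\<^sub>R a) \<bullet> G ?y)) (at \<tau>)"
          by (rule has_derivative_compose[rotated]) (auto intro!: derivative_eq_intros)
        then show ?thesis unfolding has_field_derivative_def
          by (rule has_derivative_eq_rhs) (simp add: fun_eq_iff mult_ac)
      qed
      have "((?p) has_real_derivative ?p' \<tau>) (at \<tau>)" if "0 \<le> \<tau>" "\<tau> \<le> 1" for \<tau>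
        using DERIV_diff[OF line[OF that, of s] line[OF that, of 0]] s(1) by (simp add: inner_diff_right)
      then obtain \<theta> where \<theta>: "0 < \<theta>" "\<theta> < 1" "?p 1 - ?p 0 = (1 - 0) * ?p' \<theta>"
        using MVT2[of 0 1 ?p ?p'] by auto
      let ?y1 = "(\<theta> * s) *\<^sub>R a + s *\<^sub>R b" and ?y2 = "(\<theta> * s) *\<^sub>R a + 0 *\<^sub>R b"
      have n1: "norm ?y1 \<le> s * N" and n2: "norm ?y2 \<le> s * N"
        using \<theta> s(1) by (intro near; simp)+
      have err: "norm (G (x + y) - G x - D y) \<le> e * (s * N)" if y: "norm y \<le> s * N" for y
      proof -
        have "norm (G (x + y) - G x - D y) \<le> e * norm y"
          using d1(2)[of "x + y"] y s(2) by simp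
        also have "\<dots> \<le> e * (s * N)" using y e by (intro mult_left_mono) auto
        finally show ?thesis .
      qed
      have "G (x + ?y1) - G (x + ?y2) - D (s *\<^sub>R b) = (G (x + ?y1) - G x - D ?y1) - (G (x + ?y2) - G x - D ?y2)"
        by (simp add: D.add)
      then have "norm (G (x + ?y1) - G (x + ?y2) - D (s *\<^sub>R b))
          = norm ((G (x + ?y1) - G x - D ?y1) - (G (x + ?y2) - G x - D ?y2))" by (rule arg_cong)
      also have "\<dots> \<le> e * (s * N) + e * (s * N)"
        by (rule order_trans[OF norm_triangle_ineq4 add_mono[OF err[OF n1] err[OF n2]]])
      finally have e3: "norm (G (x + ?y1) - G (x + ?y2) - D (s *\<^sub>R b)) \<le> 2 * e * (s * N)"
        by (simp only: mult_2 distrib_right)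
      have "(P (x + s *\<^sub>R a + s *\<^sub>R b) - P (x + s *\<^sub>R a) - P (x + s *\<^sub>R b) + P x) - s\<^sup>2 * (a \<bullet> D b)
        = (s *\<^sub>R a) \<bullet> (G (x + ?y1) - G (x + ?y2) - D (s *\<^sub>R b))"
        using \<theta>(3) by (simp add: D.scaleR inner_diff_right power2_eq_square algebra_simps)
      also have "\<bar>\<dots>\<bar> \<le> norm (s *\<^sub>R a) * norm (G (x + ?y1) - G (x + ?y2) - D (s *\<^sub>R b))"
        by (rule Cauchy_Schwarz_ineq2)
      also have "\<dots> \<le> (s * N) * (2 * e * (s * N))"
      proof (rule mult_mono[OF _ e3])
        show "norm (s *\<^sub>R a) \<le> s * N" using s(1) ab norm_ge_zero[of b] by (simp add: order_trans[OF _ ab])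
      qed (use s(1) N(1) in auto)
      finally show ?thesis by (simp add: power2_eq_square mult_ac)
    qed
    have "\<bar>s\<^sup>2 * (h \<bullet> D k) - s\<^sup>2 * (k \<bullet> D h)\<bar> \<le> 4 * e * s\<^sup>2 * N\<^sup>2"
      using key[OF N(4)] key[of k h] N(4) by (simp add: add.commute add.left_commute abs_le_iff)
    then have "s\<^sup>2 * \<bar>h \<bullet> D k - k \<bullet> D h\<bar> \<le> s\<^sup>2 * (4 * e * N\<^sup>2)"
    proof -
      have "s\<^sup>2 * \<bar>h \<bullet> D k - k \<bullet> D h\<bar> = \<bar>s\<^sup>2 * (h \<bullet> D k) - s\<^sup>2 * (k \<bullet> D h)\<bar>"
        by (metis abs_mult abs_power2 right_diff_distrib)
      then show "\<bar>s\<^sup>2 * (h \<bullet> D k) - s\<^sup>2 * (k \<bullet> D h)\<bar> \<le> 4 * e * s\<^sup>2 * N\<^sup>2 \<Longrightarrow> ?thesis"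
        by (simp add: mult_ac)
    qed
    then show ?thesis using s(1) by simp
  qed
  have "\<bar>h \<bullet> D k - k \<bullet> D h\<bar> \<le> 0"
  proof (rule field_le_epsilon)
    fix e :: real assume "e > 0"
    then show "\<bar>h \<bullet> D k - k \<bullet> D h\<bar> \<le> 0 + e"
      using main[of "e / (4 * N\<^sup>2)"] N(1) by simp
  qed
  then show ?thesis by simp
qed

lemma material_derivative:
  fixes a :: "real \<Rightarrow> 'a::real_normed_vector \<Rightarrow> real"
  assumes "t \<in> J" "\<And>\<tau>. \<tau> \<in> J \<Longrightarrow> \<gamma> \<tau> \<in> U"
    and conv: "\<And>e. e > 0 \<Longrightarrow> \<forall>\<^sub>F \<tau> in at t within J. \<forall>x\<in>U. \<bar>(a \<tau> x - a t x) / (\<tau> - t) - b x\<bar> \<le> e"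
    and b: "continuous_on U b"
    and D: "(a t has_derivative D) (at (\<gamma> t))"
    and \<gamma>: "(\<gamma> has_vector_derivative g) (at t within J)"
  shows "((\<lambda>\<tau>. a \<tau> (\<gamma> \<tau>)) has_real_derivative (b (\<gamma> t) + D g)) (at t within J)"
proof -
  have evJ: "\<forall>\<^sub>F \<tau> in at t within J. \<tau> \<in> J" by (auto simp: eventually_at_filter)
  have lim\<gamma>: "(\<gamma> \<longlongrightarrow> \<gamma> t) (at t within J)"
    using has_vector_derivative_continuous[OF \<gamma>] by (simp add: continuous_within)
  have "((\<lambda>\<tau>. a t (\<gamma> \<tau>)) has_derivative (\<lambda>h. D (h *\<^sub>R g))) (at t within J)"
    using has_derivative_compose[OF \<gamma>[unfolded has_vector_derivative_def] D] .
  then have "((\<lambda>\<tau>. a t (\<gamma> \<tau>)) has_real_derivative D g) (at t within J)"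
    using linear_cmul[OF has_derivative_linear[OF D]]
    by (simp add: has_field_derivative_def mult.commute[of _ "D g"])
  then have 2: "((\<lambda>\<tau>. (a t (\<gamma> \<tau>) - a t (\<gamma> t)) / (\<tau> - t)) \<longlongrightarrow> D g) (at t within J)"
    by (simp add: has_field_derivative_iff)
  have "((\<lambda>\<tau>. (a \<tau> (\<gamma> \<tau>) - a t (\<gamma> \<tau>)) / (\<tau> - t) - b (\<gamma> \<tau>)) \<longlongrightarrow> 0) (at t within J)"
  proof (rule tendstoI)
    fix e :: real assume "e > 0"
    then have "\<forall>\<^sub>F \<tau> in at t within J. \<forall>x\<in>U. \<bar>(a \<tau> x - a t x) / (\<tau> - t) - b x\<bar> \<le> e / 2"
      by (intro conv) simp
    with evJ show "\<forall>\<^sub>F \<tau> in at t within J. dist ((a \<tau> (\<gamma> \<tau>) - a t (\<gamma> \<tau>)) / (\<tau> - t) - b (\<gamma> \<tau>)) 0 < e"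
      by eventually_elim (use assms(2) \<open>e > 0\<close> in fastforce)
  qed
  moreover have "((\<lambda>\<tau>. b (\<gamma> \<tau>)) \<longlongrightarrow> b (\<gamma> t)) (at t within J)"
    using evJ assms(1,2)
    by (intro continuous_on_tendsto_compose[OF b lim\<gamma>]) (auto elim: eventually_mono)
  ultimately have 1: "((\<lambda>\<tau>. (a \<tau> (\<gamma> \<tau>) - a t (\<gamma> \<tau>)) / (\<tau> - t)) \<longlongrightarrow> b (\<gamma> t)) (at t within J)"
    using tendsto_add[of "\<lambda>\<tau>. (a \<tau> (\<gamma> \<tau>) - a t (\<gamma> \<tau>)) / (\<tau> - t) - b (\<gamma> \<tau>)" 0 "at t within J" "\<lambda>\<tau>. b (\<gamma> \<tau>)"] by simp
  show ?thesis
    unfolding has_field_derivative_iff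
    using tendsto_add[OF 1 2] by (simp add: add_divide_distrib[symmetric])
qed

section \<open>Linear equations along a trajectory and the algebra of the amplitude frame\<close>

lemma linear_ODE:
  fixes f :: "real \<Rightarrow> 'a::banach \<Rightarrow> 'a"
  assumes T: "T \<ge> 0" and L: "L \<ge> 0"
    and lin: "\<And>t. t \<in> {0..T} \<Longrightarrow> linear (f t)"
    and bound: "\<And>t x. t \<in> {0..T} \<Longrightarrow> norm (f t x) \<le> L * norm x"
    and cont: "\<And>x. continuous_on {0..T} (\<lambda>t. f t x)"
  shows linear_ODE_forward: "\<exists>x. x 0 = x0 \<and> (\<forall>t\<in>{0..T}. (x has_vector_derivative f t (x t)) (at t within {0..T}))"
    and linear_ODE_backward: "\<exists>x. x T = x0 \<and> (\<forall>t\<in>{0..T}. (x has_vector_derivative f t (x t)) (at t within {0..T}))"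
proof -
  have lip: "norm (f t x - f t y) \<le> L * norm (x - y)" if "t \<in> {0..T}" for t x y
    using bound[OF that, of "x - y"] linear_diff[OF lin[OF that]] by simp
  note c = continuous_on_Times_lipschitz[OF cont L lip]
  show "\<exists>x. x 0 = x0 \<and> (\<forall>t\<in>{0..T}. (x has_vector_derivative f t (x t)) (at t within {0..T}))"
    by (rule Picard_Lindelof[OF T c L lip])
  show "\<exists>x. x T = x0 \<and> (\<forall>t\<in>{0..T}. (x has_vector_derivative f t (x t)) (at t within {0..T}))"
    by (rule Picard_Lindelof_backward[OF T c L lip])
qed

text \<open>Completing \<open>b\<close> by \<open>cross3 e b\<close> fixes the orientation, hence
  the value +1 of the triple product.\<close>

lemma orthonormal_frame:
  fixes e :: "real^3"
  assumes "norm e = 1"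
  obtains b b' where "norm b = 1" "norm b' = 1" "b \<bullet> e = 0" "b' \<bullet> e = 0" "cross3 b b' \<bullet> e = 1"
proof -
  obtain y :: "real^3" where y: "y \<noteq> 0" "orthogonal e y"
    using orthogonal_to_vector_exists[of e] by auto
  define b where "b = y /\<^sub>R norm y"
  have b: "norm b = 1" "b \<bullet> e = 0" using y by (auto simp: b_def orthogonal_def inner_commute)
  have n: "(norm (cross3 e b))\<^sup>2 = 1"
    using norm_cross_dot[of e b] assms b by (simp add: inner_commute)
  then have "norm (cross3 e b) = 1" by (metis abs_norm_cancel power2_eq_1_iff abs_1 abs_minus_cancel)
  moreover have "cross3 e b \<bullet> e = 0" by (simp add: dot_cross_self)
  moreover have "cross3 b (cross3 e b) \<bullet> e = (norm (cross3 e b))\<^sup>2"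
    unfolding power2_norm_eq_inner by (simp add: cross3_simps)
  ultimately show ?thesis using that b n by metis
qed

lemma inner_transpose_matrix: "(transpose A *v x) \<bullet> y = x \<bullet> (A *v y)" for A :: "real^'n^'m"
  by (simp add: dot_lmul_matrix)

lemma inner_transpose_matrix_right: "x \<bullet> (transpose A *v y) = (A *v x) \<bullet> y" for A :: "real^'n^'m"
  using inner_transpose_matrix[of A y x] by (simp only: inner_commute)

lemma parallel_cross:
  fixes b b' e :: "real^3"
  assumes "b \<bullet> e = 0" "b' \<bullet> e = 0" "e \<noteq> 0"
  shows "cross3 b b' = ((cross3 b b' \<bullet> e) / (norm e)\<^sup>2) *\<^sub>R e"
proof -
  have "(norm e)\<^sup>2 *\<^sub>R cross3 b b' - (cross3 b b' \<bullet> e) *\<^sub>R e = cross3 (cross3 e (cross3 b b')) e"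
    unfolding power2_norm_eq_inner by (simp add: cross3_simps forall_3)
  also have "cross3 e (cross3 b b') = (b' \<bullet> e) *\<^sub>R b - (b \<bullet> e) *\<^sub>R b'"
    by (simp add: cross3_simps forall_3)
  finally have eq: "(norm e)\<^sup>2 *\<^sub>R cross3 b b' = (cross3 b b' \<bullet> e) *\<^sub>R e" using assms by simp
  have "cross3 b b' = ((norm e)\<^sup>2 *\<^sub>R cross3 b b') /\<^sub>R (norm e)\<^sup>2" using assms(3) by simp
  also have "\<dots> = ((cross3 b b' \<bullet> e) / (norm e)\<^sup>2) *\<^sub>R e"
    unfolding eq by (simp add: divide_inverse_commute)
  finally show ?thesis .
qed

text \<open>The multiples of \<open>x\<close> drop out of the determinant. By the trace identity,
  trace zero leaves the product of \<open>cross3 b b'\<close> with A x, minus its product with the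
  transpose of A applied to x; these cancel because \<open>cross3 b b'\<close> is parallel to
  \<open>x\<close>, both amplitudes being orthogonal to it.\<close>

lemma bichar_volume_derivative:
  fixes A :: "real^3^3" and x b b' :: "real^3"
  assumes "x \<noteq> 0" "b \<bullet> x = 0" "b' \<bullet> x = 0" "trace A = 0"
  shows "cross3 b b' \<bullet> (- (transpose A *v x))
    + (cross3 b (- (A *v b') + c' *\<^sub>R x) + cross3 (- (A *v b) + c *\<^sub>R x) b') \<bullet> x = 0"
proof -
  define k where "k = (cross3 b b' \<bullet> x) / (norm x)\<^sup>2"
  have par: "cross3 b b' = k *\<^sub>R x" unfolding k_def by (rule parallel_cross[OF assms(2,3,1)])
  have "(cross3 b (- (A *v b') + c' *\<^sub>R x) + cross3 (- (A *v b) + c *\<^sub>R x) b') \<bullet> x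
     = cross3 b b' \<bullet> (A *v x) - trace A * (cross3 b b' \<bullet> x)"
    by (simp add: cross3_simps matrix_vector_mult_def trace_def)
  moreover have "x \<bullet> (transpose A *v x) = x \<bullet> (A *v x)"
    unfolding inner_transpose_matrix_right by (rule inner_commute)
  ultimately show ?thesis
    unfolding par assms(4) by simp
qed

text \<open>Isolates what happens along one trajectory: only the matrix path \<open>A\<close> and a
  solution \<open>W\<close> of the stretching equation enter, with no reference to the domain or to
  the Euler equation.\<close>

lemma amplitude_controls_vorticity:
  fixes A :: "real \<Rightarrow> real^3^3" and W :: "real \<Rightarrow> real^3"
  assumes T: "T \<ge> 0" and L: "L \<ge> 0"
    and tr: "\<And>t. t \<in> {0..T} \<Longrightarrow> trace (A t) = 0"
    and AL: "\<And>t x. t \<in> {0..T} \<Longrightarrow> norm (A t *v x) \<le> L * norm x"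
    and contA: "\<And>i j. continuous_on {0..T} (\<lambda>t. A t $ i $ j)"
    and W: "\<And>t. t \<in> {0..T} \<Longrightarrow> (W has_vector_derivative A t *v W t) (at t within {0..T})"
  obtains \<xi> b where
    "\<And>t. t \<in> {0..T} \<Longrightarrow> (\<xi> has_vector_derivative - (transpose (A t) *v \<xi> t)) (at t within {0..T})"
    "\<And>t. t \<in> {0..T} \<Longrightarrow> (b has_vector_derivative
       - (A t *v b t) + (2 * (\<xi> t \<bullet> (A t *v b t)) / (norm (\<xi> t))\<^sup>2) *\<^sub>R \<xi> t) (at t within {0..T})"
    "norm (b 0) = 1" "norm (\<xi> 0) = 1" "b 0 \<bullet> \<xi> 0 = 0" "norm (W T) \<le> norm (W 0) * (norm (b T))\<^sup>2"
proof -
  have T0: "T \<in> {0..T}" "0 \<in> {0..T}" using T by auto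
  have tL: "norm (- (transpose (A t) *v x)) \<le> L * norm x" if "t \<in> {0..T}" for t x
  proof -
    let ?y = "transpose (A t) *v x"
    have "norm ?y * norm ?y = x \<bullet> (A t *v ?y)"
      by (simp add: inner_transpose_matrix[symmetric] power2_norm_eq_inner[symmetric] power2_eq_square)
    also have "\<dots> \<le> norm x * norm (A t *v ?y)" by (rule norm_cauchy_schwarz)
    also have "\<dots> \<le> norm x * (L * norm ?y)" by (intro mult_left_mono AL that) simp
    finally have "norm ?y * norm ?y \<le> (L * norm x) * norm ?y" by (simp add: mult_ac)
    then have "norm ?y \<le> L * norm x"
      using L mult_right_le_imp_le[of "norm ?y" "norm ?y" "L * norm x"]
      by (cases "?y = 0") (simp_all del: transpose_matrix_vector)
    then show ?thesis by simp
  qed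
  have contAv: "continuous_on {0..T} (\<lambda>t. A t *v x t)" if "continuous_on {0..T} x" for x
    unfolding matrix_vector_mult_def
    by (intro continuous_on_vec_lambda continuous_on_sum continuous_on_mult contA continuous_on_component that)
  have contTv: "continuous_on {0..T} (\<lambda>t. transpose (A t) *v x)" for x
    unfolding matrix_vector_mult_def transpose_def
    by (simp, intro continuous_on_vec_lambda continuous_on_sum continuous_on_mult contA continuous_on_const)
  \<comment> \<open>If the final vorticity vanishes, any unit vector will do.\<close>
  obtain e where e: "norm e = 1" "W T = norm (W T) *\<^sub>R e"
  proof (cases "W T = 0")
    case True
    then show ?thesis using that[of "axis 1 1"] by simp
  next
    case False
    then show ?thesis using that[of "W T /\<^sub>R norm (W T)"] by simp
  qed
  obtain \<eta> where \<eta>T: "\<eta> T = e"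
    and \<eta>: "\<And>t. t \<in> {0..T} \<Longrightarrow> (\<eta> has_vector_derivative - (transpose (A t) *v \<eta> t)) (at t within {0..T})"
  proof -
    have "linear (\<lambda>x. - (transpose (A t) *v x))" for t
      by (intro linear_compose_neg matrix_vector_mul_linear)
    then have "\<exists>x. x T = e \<and> (\<forall>t\<in>{0..T}. (x has_vector_derivative - (transpose (A t) *v x t)) (at t within {0..T}))"
      by (intro linear_ODE_backward[OF T L _ tL] continuous_on_minus contTv)
    then show ?thesis using that by blast
  qed
  have cont\<eta>: "continuous_on {0..T} \<eta>"
    using \<eta> by (meson continuous_on_eq_continuous_within has_vector_derivative_continuous)
  \<comment> \<open>The amplitude equation divides by |\<xi>|^2. A solution of the linear covector
    equation that is nonzero at time \<open>T\<close> cannot vanish earlier.\<close>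
  have \<eta>0: "\<eta> t \<noteq> 0" if "t \<in> {0..T}" for t
  proof (rule nonzero_backward[where z=\<eta> and b=T and K=L and z'="\<lambda>t. - (transpose (A t) *v \<eta> t)"])
    show "continuous_on {t..T} \<eta>" using that by (intro continuous_on_subset[OF cont\<eta>]) auto
    show "\<eta> T \<noteq> 0" using e \<eta>T by auto
    fix s assume s: "t < s" "s < T"
    show "(\<eta> has_vector_derivative - (transpose (A s) *v \<eta> s)) (at s)"
      using \<eta>[of s] s that by (simp add: at_within_Icc_at)
    show "norm (- (transpose (A s) *v \<eta> s)) \<le> L * norm (\<eta> s)" using tL[of s] s that by simp
  qed (use that in auto)
  \<comment> \<open>The covector was prescribed at time \<open>T\<close>, but must have norm 1 at
    time 0; linearity of its equation permits rescaling.\<close>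
  define \<xi> where "\<xi> t = \<eta> t /\<^sub>R norm (\<eta> 0)" for t
  have \<xi>0: "\<xi> t \<noteq> 0" if "t \<in> {0..T}" for t using \<eta>0 that T0 by (auto simp: \<xi>_def)
  have n\<xi>: "norm (\<xi> 0) = 1" using \<eta>0 T0 by (simp add: \<xi>_def)
  have \<xi>: "(\<xi> has_vector_derivative - (transpose (A t) *v \<xi> t)) (at t within {0..T})" if "t \<in> {0..T}" for t
    using bounded_linear.has_vector_derivative[OF bounded_linear_scaleR_right \<eta>[OF that], of "inverse (norm (\<eta> 0))"]
    by (simp add: \<xi>_def[abs_def] matrix_vector_mult_scaleR)
  have cont\<xi>: "continuous_on {0..T} \<xi>" unfolding \<xi>_def[abs_def] by (intro continuous_intros cont\<eta>)
  define F where "F t x = - (A t *v x) + (2 * (\<xi> t \<bullet> (A t *v x)) / (norm (\<xi> t))\<^sup>2) *\<^sub>R \<xi> t" for t x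
  have Flin: "linear (F t)" for t
    unfolding F_def by (rule linearI)
      (simp_all add: matrix_vector_right_distrib inner_add_right algebra_simps add_divide_distrib matrix_vector_mult_scaleR)
  \<comment> \<open>One \<open>L\<close> comes from the matrix, two from the correction along \<xi>,
    whose norm is at most 2 |A x|.\<close>
  have Fbound: "norm (F t x) \<le> (3 * L) * norm x" if t: "t \<in> {0..T}" for t x
  proof -
    have "norm (F t x) \<le> norm (A t *v x) + norm ((2 * (\<xi> t \<bullet> (A t *v x)) / (norm (\<xi> t))\<^sup>2) *\<^sub>R \<xi> t)"
      unfolding F_def by (metis norm_minus_cancel norm_triangle_ineq)
    also have "norm ((2 * (\<xi> t \<bullet> (A t *v x)) / (norm (\<xi> t))\<^sup>2) *\<^sub>R \<xi> t) = 2 * \<bar>\<xi> t \<bullet> (A t *v x)\<bar> / norm (\<xi> t)"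
      using \<xi>0[OF t] by (simp add: power2_eq_square abs_mult)
    also have "\<dots> \<le> 2 * norm (A t *v x)"
      using \<xi>0[OF t] Cauchy_Schwarz_ineq2[of "\<xi> t" "A t *v x"] by (simp add: pos_divide_le_eq mult.commute)
    finally show ?thesis using AL[OF t, of x] by simp
  qed
  have Fcont: "continuous_on {0..T} (\<lambda>t. F t x)" for x
    unfolding F_def by (intro continuous_intros contAv cont\<xi>) (use \<xi>0 in auto)
  have solve: "\<exists>b. b 0 = b0 \<and> (\<forall>t\<in>{0..T}. (b has_vector_derivative F t (b t)) (at t within {0..T}))" for b0
    by (rule linear_ODE_forward[OF T _ Flin Fbound Fcont]) (use L in simp)
  obtain e1 e2 where fr: "norm e1 = 1" "norm e2 = 1" "e1 \<bullet> \<xi> 0 = 0" "e2 \<bullet> \<xi> 0 = 0" "cross3 e1 e2 \<bullet> \<xi> 0 = 1"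
    using orthonormal_frame[OF n\<xi>] by blast
  obtain b1 where b1: "b1 0 = e1" "\<And>t. t \<in> {0..T} \<Longrightarrow> (b1 has_vector_derivative F t (b1 t)) (at t within {0..T})"
    using solve by blast
  obtain b2 where b2: "b2 0 = e2" "\<And>t. t \<in> {0..T} \<Longrightarrow> (b2 has_vector_derivative F t (b2 t)) (at t within {0..T})"
    using solve by blast
  have orth: "b t \<bullet> \<xi> t = b 0 \<bullet> \<xi> 0"
    if "\<And>t. t \<in> {0..T} \<Longrightarrow> (b has_vector_derivative F t (b t)) (at t within {0..T})" "t \<in> {0..T}" for b t
  proof (rule constant_on_Icc[of T "\<lambda>t. b t \<bullet> \<xi> t", OF _ that(2)])
    fix t assume t: "t \<in> {0..T}"
    have "F t (b t) \<bullet> \<xi> t = - ((A t *v b t) \<bullet> \<xi> t)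
        + 2 * (\<xi> t \<bullet> (A t *v b t)) / (\<xi> t \<bullet> \<xi> t) * (\<xi> t \<bullet> \<xi> t)"
      unfolding F_def power2_norm_eq_inner inner_add_left inner_minus_left inner_scaleR_left ..
    then have "F t (b t) \<bullet> \<xi> t = - ((A t *v b t) \<bullet> \<xi> t) + 2 * ((A t *v b t) \<bullet> \<xi> t)"
      using \<xi>0[OF t] by (simp add: inner_commute)
    then have "b t \<bullet> (- (transpose (A t) *v \<xi> t)) + F t (b t) \<bullet> \<xi> t = 0"
      unfolding inner_minus_right inner_transpose_matrix_right by simp
    then show "((\<lambda>t. b t \<bullet> \<xi> t) has_real_derivative 0) (at t within {0..T})"
      using has_real_derivative_inner[OF that(1)[OF t] \<xi>[OF t]] by simp
  qed
  have vol: "cross3 (b1 t) (b2 t) \<bullet> \<xi> t = 1" if "t \<in> {0..T}" for t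
  proof -
    have "cross3 (b1 t) (b2 t) \<bullet> \<xi> t = cross3 (b1 0) (b2 0) \<bullet> \<xi> 0"
    proof (rule constant_on_Icc[of T "\<lambda>t. cross3 (b1 t) (b2 t) \<bullet> \<xi> t", OF _ that])
      fix t assume t: "t \<in> {0..T}"
      have bil: "bounded_bilinear (cross3 :: real^3 \<Rightarrow> real^3 \<Rightarrow> real^3)"
        using bilinear_cross bilinear_conv_bounded_bilinear by blast
      have o: "b1 t \<bullet> \<xi> t = 0" "b2 t \<bullet> \<xi> t = 0" using orth[OF b1(2) t] orth[OF b2(2) t] b1(1) b2(1) fr by auto
      show "((\<lambda>t. cross3 (b1 t) (b2 t) \<bullet> \<xi> t) has_real_derivative 0) (at t within {0..T})"
        using has_real_derivative_inner[OF bounded_bilinear.has_vector_derivative[OF bil b1(2)[OF t] b2(2)[OF t]] \<xi>[OF t]]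
          bichar_volume_derivative[OF \<xi>0[OF t] o tr[OF t]]
        unfolding F_def by simp
    qed
    then show ?thesis using b1(1) b2(1) fr by simp
  qed
  have W\<xi>: "W T \<bullet> \<xi> T = W 0 \<bullet> \<xi> 0"
  proof (rule constant_on_Icc[of T "\<lambda>t. W t \<bullet> \<xi> t", OF _ T0(1)])
    fix t assume t: "t \<in> {0..T}"
    have "W t \<bullet> (- (transpose (A t) *v \<xi> t)) + (A t *v W t) \<bullet> \<xi> t = 0"
      unfolding inner_minus_right inner_transpose_matrix_right by simp
    then show "((\<lambda>t. W t \<bullet> \<xi> t) has_real_derivative 0) (at t within {0..T})"
      using has_real_derivative_inner[OF W[OF t] \<xi>[OF t]] by simp
  qed
  \<comment> \<open>Equality in Cauchy-Schwarz, since \<xi> at time \<open>T\<close> is a positive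
    multiple of the direction \<open>e\<close> of the vorticity.\<close>
  have "norm (W T) * norm (\<xi> T) = W T \<bullet> \<xi> T"
  proof -
    have "e \<bullet> \<xi> T = norm (\<xi> T)"
      using e(1) by (simp add: \<xi>_def \<eta>T power2_norm_eq_inner[symmetric])
    then show ?thesis by (subst (2) e(2)) simp
  qed
  also have "\<dots> \<le> norm (W 0)"
    using norm_cauchy_schwarz[of "W 0" "\<xi> 0"] n\<xi> unfolding W\<xi> by simp
  finally have Wb: "norm (W T) * norm (\<xi> T) \<le> norm (W 0)" .
  have prod: "1 \<le> norm (b1 T) * norm (b2 T) * norm (\<xi> T)"
  proof -
    have "1 \<le> norm (cross3 (b1 T) (b2 T)) * norm (\<xi> T)"
      using vol[OF T0(1)] norm_cauchy_schwarz[of "cross3 (b1 T) (b2 T)" "\<xi> T"] by simp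
    also have "norm (cross3 (b1 T) (b2 T)) \<le> norm (b1 T) * norm (b2 T)"
    proof (rule power2_le_imp_le)
      show "(norm (cross3 (b1 T) (b2 T)))\<^sup>2 \<le> (norm (b1 T) * norm (b2 T))\<^sup>2"
        using norm_cross_dot[of "b1 T" "b2 T"] zero_le_power2[of "b1 T \<bullet> b2 T"] by linarith
    qed simp
    finally show ?thesis by (simp add: mult_right_mono)
  qed
  \<comment> \<open>\<open>m\<close> stands for the larger of the two final amplitudes. The lower
    bound for m^2 |\<xi>| and the upper bound for |W| |\<xi>| are combined so that |\<xi>|
    disappears.\<close>
  have concl: "norm (W T) \<le> norm (W 0) * m\<^sup>2" if "norm (b1 T) \<le> m" "norm (b2 T) \<le> m" for m
  proof -
    have "norm (b1 T) * norm (b2 T) \<le> m * m"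
      using order_trans[OF norm_ge_zero that(1)] by (intro mult_mono that) auto
    then have "1 \<le> m\<^sup>2 * norm (\<xi> T)"
      using prod mult_right_mono[of "norm (b1 T) * norm (b2 T)" "m * m" "norm (\<xi> T)"] by (simp add: power2_eq_square)
    then have "norm (W T) * 1 \<le> norm (W T) * (m\<^sup>2 * norm (\<xi> T))" by (intro mult_left_mono) auto
    also have "\<dots> = m\<^sup>2 * (norm (W T) * norm (\<xi> T))" by simp
    also have "\<dots> \<le> m\<^sup>2 * norm (W 0)" by (intro mult_left_mono Wb) simp
    finally show ?thesis by (simp add: mult.commute)
  qed
  show ?thesis
  proof (cases "norm (b1 T) \<le> norm (b2 T)")
    case True
    show ?thesis by (rule that[OF \<xi> b2(2)[unfolded F_def]]) (use fr b2 n\<xi> concl True in auto)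
  next
    case False
    show ?thesis by (rule that[OF \<xi> b1(2)[unfolded F_def]]) (use fr b1 n\<xi> concl False in auto)
  qed
qed

section \<open>Vorticity along trajectories\<close>

text \<open>\<open>Q\<close> is the material derivative of the velocity gradient \<open>A\<close>,
  with \<open>B\<close> its time part and \<open>D i j\<close> the spatial gradient of its (i, j)
  entry. \<open>sym1\<close> is symmetry of second derivatives of the velocity, \<open>sym2\<close>
  symmetry of the pressure Hessian. They reduce the antisymmetric part of \<open>Q\<close> to that
  of -A^2, and for trace-free \<open>A\<close> the vector belonging to the latter is A applied to
  the vorticity.\<close>

lemma vorticity_stretching_algebra:
  fixes A B :: "real^3^3" and D :: "3 \<Rightarrow> 3 \<Rightarrow> real^3" and v :: "real^3"
  assumes sym1: "\<And>i j k. D i j $ k = D i k $ j"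
    and sym2: "\<And>i j. B $ i $ j + (\<Sum>k\<in>UNIV. A $ i $ k * A $ k $ j + D i k $ j * v $ k)
      = B $ j $ i + (\<Sum>k\<in>UNIV. A $ j $ k * A $ k $ i + D j k $ i * v $ k)"
    and tr: "trace A = 0"
    and Q: "\<And>i j. Q i j = B $ i $ j + v \<bullet> D i j"
  shows "vector [Q 3 2 - Q 2 3, Q 1 3 - Q 3 1, Q 2 1 - Q 1 2]
    = A *v (vector [A $ 3 $ 2 - A $ 2 $ 3, A $ 1 $ 3 - A $ 3 $ 1, A $ 2 $ 1 - A $ 1 $ 2] :: real^3)"
proof -
  have "v \<bullet> D i j = (\<Sum>k\<in>UNIV. D i k $ j * v $ k)" for i j
    by (simp add: inner_vec_def mult.commute sym1[of i j])
  then have *: "Q i j - Q j i = (\<Sum>k\<in>UNIV. A $ j $ k * A $ k $ i) - (\<Sum>k\<in>UNIV. A $ i $ k * A $ k $ j)" for i j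
    using sym2[of i j] unfolding Q by (simp add: sum.distrib)
  have tr': "A $ 1 $ 1 = - A $ 2 $ 2 - A $ 3 $ 3" using tr by (simp add: trace_def sum_3)
  show ?thesis
    unfolding * by (simp add: vec_eq_iff forall_3 vector_3 matrix_vector_mult_def sum_3 tr' algebra_simps)
qed

lemma lifespan_Icc_subset:
  assumes "T \<in> lifespan Tstar"
  shows "{0..T} \<subseteq> lifespan Tstar"
proof
  fix t assume "t \<in> {0..T}"
  then have "0 \<le> t" "ereal t \<le> ereal T" by auto
  then show "t \<in> lifespan Tstar"
    using assms le_less_trans[of "ereal t" "ereal T" Tstar] by (simp add: lifespan_def)
qed

text \<open>Along a trajectory the velocity gradient \<open>A\<close> satisfies \<open>A' = - A\<^sup>2 - Hess P\<close>; the
  pressure drops out of the antisymmetric part.\<close>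

lemma vorticity_transport:
  fixes u :: "real \<Rightarrow> real^3 \<Rightarrow> real^3"
  assumes adm: "admissible_domain \<Omega>" and s: "s > 9/2"
    and T: "T \<in> lifespan Tstar" "t \<in> {0..T}"
    and C1: "C0_Hs {0..T} \<Omega> s u" "C1_Hs {0..T} \<Omega> (s - 1) u"
    and cont: "\<forall>t\<in>{0..T}. continuous_on (region \<Omega>) (u t)"
    and euler: "euler_solution \<Omega> Tstar u P"
    and \<gamma>: "\<forall>t\<in>{0..T}. \<gamma> t \<in> region \<Omega>"
      "\<forall>t\<in>{0..T}. (\<gamma> has_vector_derivative u t (\<gamma> t)) (at t within {0..T})"
  shows vorticity_transport_equation: "((\<lambda>\<tau>. vorticity u \<tau> (\<gamma> \<tau>)) has_vector_derivative
      vel_grad u t (\<gamma> t) *v vorticity u t (\<gamma> t)) (at t within {0..T})"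
    and vel_grad_continuous_along: "continuous (at t within {0..T}) (\<lambda>\<tau>. vel_grad u \<tau> (\<gamma> \<tau>) $ i $ j)"
proof -
  let ?U = "region \<Omega>" and ?J = "{0..T}"
  have "((\<lambda>\<tau>. vorticity u \<tau> (\<gamma> \<tau>)) has_vector_derivative vel_grad u t (\<gamma> t) *v vorticity u t (\<gamma> t)) (at t within {0..T})
    \<and> continuous (at t within {0..T}) (\<lambda>\<tau>. vel_grad u \<tau> (\<gamma> \<tau>) $ i $ j)"
  \<comment> \<open>On a one-point interval the filter is trivial and both claims hold vacuously;
    otherwise limits are unique, which the identification of the pressure gradient relies
    on.\<close>
  proof (cases "T = 0")
    case True
    then have "at t within {0..T} = bot" using T(2) by (simp add: at_within_eq_bot_iff)
    then show ?thesis
      by (simp add: continuous_within has_vector_derivative_def has_derivative_def bounded_linear_scaleR_left)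
  next
    case False
    then have "T > 0" using T(2) by auto
    have JL: "?J \<subseteq> lifespan Tstar" by (rule lifespan_Icc_subset[OF T(1)])
    then have tl: "t \<in> lifespan Tstar" using T(2) by blast
    have nontriv: "at t within ?J \<noteq> bot"
      using \<open>T > 0\<close> T(2) by (simp add: trivial_limit_within islimpt_Icc)
    note U = open_region[OF adm]
    have Hu: "in_Hs_vec \<Omega> s (u t)" using C1(1) T(2) by (simp add: C0_Hs_def)
    define x where "x = \<gamma> t"
    have x: "x \<in> ?U" using \<gamma>(1) T(2) by (simp add: x_def)
    obtain w where w: "\<And>x. x \<in> ?U \<Longrightarrow> w differentiable (at x)"
      "\<And>i j. continuous_on ?U (\<lambda>x. jacobian w (at x) $ i $ j)"
      "\<And>e. e > 0 \<Longrightarrow> \<forall>\<^sub>F \<tau> in at t within ?J. \<forall>x\<in>?U. \<forall>i j. \<bar>(u \<tau> x $ i - u t x $ i) / (\<tau> - t) - w x $ i\<bar> \<le> e \<and>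
        \<bar>(vel_grad u \<tau> x $ i $ j - vel_grad u t x $ i $ j) / (\<tau> - t) - jacobian w (at x) $ i $ j\<bar> \<le> e"
      by (rule time_derivative_field[OF adm _ C1(2) cont T(2) nontriv]) (use s in auto)
    have "\<exists>d. (GDERIV (\<lambda>y. vel_grad u t y $ i $ j) x :> d)" for i j
      unfolding vel_grad_def
      by (intro differentiable_GDERIV Hs_gradient_differentiable[OF adm s Hu cont[rule_format, OF T(2)] x])
    then have "\<forall>i j. \<exists>d. ((\<lambda>y. vel_grad u t y $ i $ j) has_derivative (\<lambda>h. h \<bullet> d)) (at x)"
      unfolding gderiv_def by blast
    from this[unfolded choice_iff] obtain D
      where D: "\<And>i j. ((\<lambda>y. vel_grad u t y $ i $ j) has_derivative (\<lambda>h. h \<bullet> D i j)) (at x)" by blast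
    define A B where "A = vel_grad u t x" and "B = jacobian w (at x)"
    define Q where "Q i j = B $ i $ j + u t x \<bullet> D i j" for i j
    have dA: "((\<lambda>\<tau>. vel_grad u \<tau> (\<gamma> \<tau>) $ i $ j) has_real_derivative Q i j) (at t within ?J)" for i j
      unfolding Q_def B_def x_def
    proof (rule material_derivative[where U="?U" and a="\<lambda>\<tau> x. vel_grad u \<tau> x $ i $ j"
          and b="\<lambda>x. jacobian w (at x) $ i $ j" and D="\<lambda>h. h \<bullet> D i j"])
      show "((\<lambda>y. vel_grad u t y $ i $ j) has_derivative (\<lambda>h. h \<bullet> D i j)) (at (\<gamma> t))"
        using D by (simp add: x_def)
      show "\<forall>\<^sub>F \<tau> in at t within ?J. \<forall>x\<in>?U. \<bar>(vel_grad u \<tau> x $ i $ j - vel_grad u t x $ i $ j) / (\<tau> - t)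
        - jacobian w (at x) $ i $ j\<bar> \<le> e" if "e > 0" for e
        using w(3)[OF that] by eventually_elim blast
    qed (use T \<gamma> w(2) in auto)
    have du: "(u t has_derivative (\<lambda>h. vel_grad u t y *v h)) (at y)" if "y \<in> ?U" for y
      using euler tl that unfolding euler_solution_def vel_grad_def by (subst jacobian_works[symmetric]) blast
    have row: "(M *v h) $ i = h \<bullet> M $ i" for M :: "real^3^3" and h i
      by (simp add: matrix_vector_mult_def inner_vec_def mult.commute)
    have comp: "((\<lambda>y. f y $ i) has_derivative (\<lambda>h. f' h $ i)) (at y)" if "(f has_derivative f') (at y)"
      for f f' :: "real^3 \<Rightarrow> real^3" and i y
      by (rule bounded_linear.has_derivative[OF bounded_linear_vec_nth that])
    have ax: "axis i (1::real) \<bullet> y = y $ i" "y \<bullet> axis i 1 = y $ i" for y :: "real^3" and i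
      by (simp_all add: inner_axis inner_axis')
    \<comment> \<open>Schwarz symmetry with component \<open>i\<close> of the velocity as the
      potential.\<close>
    have sym1: "D i j $ k = D i k $ j" for i j k
    proof -
      have "GDERIV (\<lambda>y. u t y $ i) y :> vel_grad u t y $ i" if "y \<in> ?U" for y
        unfolding gderiv_def row[symmetric] by (rule comp[OF du[OF that]])
      moreover have "((\<lambda>y. vel_grad u t y $ i) has_derivative (\<lambda>h. \<chi> j. h \<bullet> D i j)) (at x)"
        by (rule has_derivative_cart) (simp add: D)
      ultimately have "axis j 1 \<bullet> (\<chi> j'. axis k 1 \<bullet> D i j') = axis k 1 \<bullet> (\<chi> j'. axis j 1 \<bullet> D i j')"
        by (rule Schwarz_symmetry[OF U x])
      then show ?thesis by (simp add: ax)
    qed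
    \<comment> \<open>The value that the Euler equation forces on the pressure gradient, written in
      terms of fields whose differentiability at \<open>x\<close> is known; this makes the pressure
      gradient differentiable there.\<close>
    define G where "G y = - w y - vel_grad u t y *v u t y" for y
    have GP: "GDERIV (P t) y :> G y" if y: "y \<in> ?U" for y
    proof -
      obtain gradP where gP: "GDERIV (P t) y :> gradP"
        and dt: "((\<lambda>\<tau>. u \<tau> y) has_vector_derivative - (vel_grad u t y *v u t y) - gradP) (at t within lifespan Tstar)"
        using euler tl y unfolding euler_solution_def by blast
      have dJ: "((\<lambda>\<tau>. u \<tau> y) has_vector_derivative - (vel_grad u t y *v u t y) - gradP) (at t within ?J)"
        by (rule has_vector_derivative_within_subset[OF dt JL])
      have "(- (vel_grad u t y *v u t y) - gradP) $ i = w y $ i" for i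
      \<comment> \<open>The pointwise time derivative in the Euler equation and the uniform limit
        \<open>w\<close> of difference quotients come from different hypotheses; they agree as
        limits of the same quotients.\<close>
      proof (rule tendsto_unique[OF nontriv])
        have "((\<lambda>\<tau>. u \<tau> y $ i) has_vector_derivative (- (vel_grad u t y *v u t y) - gradP) $ i) (at t within ?J)"
          by (rule bounded_linear.has_vector_derivative[OF bounded_linear_vec_nth dJ])
        then show "((\<lambda>\<tau>. (u \<tau> y $ i - u t y $ i) / (\<tau> - t)) \<longlongrightarrow> (- (vel_grad u t y *v u t y) - gradP) $ i) (at t within ?J)"
          by (simp add: has_real_derivative_iff_has_vector_derivative[symmetric] has_field_derivative_iff)
        show "((\<lambda>\<tau>. (u \<tau> y $ i - u t y $ i) / (\<tau> - t)) \<longlongrightarrow> w y $ i) (at t within ?J)"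
        proof (rule tendstoI)
          fix e :: real assume "e > 0"
          then have "e / 2 > 0" by simp
          from w(3)[OF this] show "\<forall>\<^sub>F \<tau> in at t within ?J. dist ((u \<tau> y $ i - u t y $ i) / (\<tau> - t)) (w y $ i) < e"
          proof eventually_elim
            case (elim \<tau>)
            then have "\<bar>(u \<tau> y $ i - u t y $ i) / (\<tau> - t) - w y $ i\<bar> \<le> e / 2" using y by blast
            then show ?case using \<open>e > 0\<close> by (simp add: dist_real_def)
          qed
        qed
      qed
      then have eq: "- (vel_grad u t y *v u t y) - gradP = w y" by (simp add: vec_eq_iff)
      have "gradP = G y" unfolding G_def eq[symmetric] by simp
      then show ?thesis using gP by simp
    qed
    have dG: "(G has_derivative (\<lambda>h. \<chi> i. - (B *v h) $ i - (\<Sum>k\<in>UNIV. A $ i $ k * (A *v h) $ k + (h \<bullet> D i k) * u t x $ k))) (at x)"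
    proof (rule has_derivative_cart, unfold vec_lambda_beta)
      fix i
      have "(w has_derivative (\<lambda>h. B *v h)) (at x)"
        unfolding B_def using w(1)[OF x] by (simp add: jacobian_works[symmetric])
      then have 1: "((\<lambda>y. - w y $ i) has_derivative (\<lambda>h. - (B *v h) $ i)) (at x)"
        by (intro has_derivative_minus comp)
      have 2: "((\<lambda>y. \<Sum>k\<in>UNIV. vel_grad u t y $ i $ k * u t y $ k) has_derivative
          (\<lambda>h. \<Sum>k\<in>UNIV. A $ i $ k * (A *v h) $ k + (h \<bullet> D i k) * u t x $ k)) (at x)"
        unfolding A_def by (intro has_derivative_sum has_derivative_mult D comp du x)
      have "(\<lambda>y. G y $ i) = (\<lambda>y. - w y $ i - (\<Sum>k\<in>UNIV. vel_grad u t y $ i $ k * u t y $ k))"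
        by (simp add: G_def matrix_vector_mult_def)
      then show "((\<lambda>y. G y $ i) has_derivative
          (\<lambda>h. - (B *v h) $ i - (\<Sum>k\<in>UNIV. A $ i $ k * (A *v h) $ k + (h \<bullet> D i k) * u t x $ k))) (at x)"
        using has_derivative_diff[OF 1 2] by simp
    qed
    \<comment> \<open>The same symmetry, now with the pressure as the potential.\<close>
    have sym2: "B $ i $ j + (\<Sum>k\<in>UNIV. A $ i $ k * A $ k $ j + D i k $ j * u t x $ k)
      = B $ j $ i + (\<Sum>k\<in>UNIV. A $ j $ k * A $ k $ i + D j k $ i * u t x $ k)" for i j
      using Schwarz_symmetry[OF U x GP dG, of "axis i 1" "axis j 1"] by (simp add: ax row)
    have tr: "trace A = 0" using euler tl x unfolding euler_solution_def A_def by blast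
    have alg: "vector [Q 3 2 - Q 2 3, Q 1 3 - Q 3 1, Q 2 1 - Q 1 2]
      = A *v (vector [A $ 3 $ 2 - A $ 2 $ 3, A $ 1 $ 3 - A $ 3 $ 1, A $ 2 $ 1 - A $ 1 $ 2] :: real^3)"
      by (rule vorticity_stretching_algebra[OF sym1 sym2 tr Q_def])
    have "((\<lambda>\<tau>. vorticity u \<tau> (\<gamma> \<tau>)) has_vector_derivative
      vector [Q 3 2 - Q 2 3, Q 1 3 - Q 3 1, Q 2 1 - Q 1 2]) (at t within ?J)"
    proof (rule has_vector_derivative_cart)
      fix i :: 3
      show "((\<lambda>\<tau>. vorticity u \<tau> (\<gamma> \<tau>) $ i) has_real_derivative
        (vector [Q 3 2 - Q 2 3, Q 1 3 - Q 3 1, Q 2 1 - Q 1 2] :: real^3) $ i) (at t within ?J)"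
        using exhaust_3[of i] by (auto simp: vorticity_def Let_def vector_3 intro!: DERIV_diff dA)
    qed
    then have "((\<lambda>\<tau>. vorticity u \<tau> (\<gamma> \<tau>)) has_vector_derivative vel_grad u t (\<gamma> t) *v vorticity u t (\<gamma> t)) (at t within ?J)"
      unfolding alg by (simp add: A_def x_def vorticity_def Let_def)
    moreover have "continuous (at t within ?J) (\<lambda>\<tau>. vel_grad u \<tau> (\<gamma> \<tau>) $ i $ j)"
      by (rule DERIV_continuous[OF dA])
    ultimately show ?thesis by blast
  qed
  then show "((\<lambda>\<tau>. vorticity u \<tau> (\<gamma> \<tau>)) has_vector_derivative
      vel_grad u t (\<gamma> t) *v vorticity u t (\<gamma> t)) (at t within {0..T})"
    "continuous (at t within {0..T}) (\<lambda>\<tau>. vel_grad u \<tau> (\<gamma> \<tau>) $ i $ j)" by blast+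
qed

section \<open>Bounds, essential suprema and trajectories for the final estimate\<close>

lemma derivative_le_lipschitz:
  assumes "open U" "x \<in> U" "\<And>y. y \<in> U \<Longrightarrow> norm (f y - f x) \<le> L * norm (y - x)" "(f has_derivative D) (at x)"
  shows "norm (D h) \<le> L * norm h"
proof -
  interpret bounded_linear D by (rule has_derivative_bounded_linear[OF assms(4)])
  have "norm (D h) \<le> L * norm h + e * norm h" if "h \<noteq> 0" and e: "e > 0" for e
  proof -
    obtain d where d: "d > 0" "\<And>y. norm (y - x) < d \<Longrightarrow> norm (f y - f x - D (y - x)) \<le> e * norm (y - x)"
      using has_derivative_at_alt[THEN iffD1, OF assms(4)] e by blast
    obtain d' where d': "d' > 0" "ball x d' \<subseteq> U" using assms(1,2) openE by blast
    define r where "r = min d d' / (2 * norm h)"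
    have r: "r > 0" "r * norm h < d" "r * norm h < d'"
      using d(1) d'(1) that by (auto simp: r_def)
    let ?y = "x + r *\<^sub>R h"
    have "dist ?y x < d'" using r by (simp add: dist_norm)
    then have y: "?y \<in> U" using d'(2) by (auto simp: dist_commute)
    have "r * norm (D h) = norm (D (?y - x))" using r(1) by (simp add: scaleR)
    also have "\<dots> \<le> norm (f ?y - f x) + norm (f ?y - f x - D (?y - x))"
      using norm_triangle_ineq4[of "f ?y - f x" "f ?y - f x - D (?y - x)"] by simp
    also have "\<dots> \<le> L * norm (?y - x) + e * norm (?y - x)"
      using r by (intro add_mono assms(3) y d(2)) simp
    also have "\<dots> = r * (L * norm h + e * norm h)" using r(1) by (simp add: algebra_simps)
    finally show ?thesis using r(1) by simp
  qed
  note main = this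
  show ?thesis
  proof (cases "h = 0")
    case False
    show ?thesis
    proof (rule field_le_epsilon)
      fix e :: real assume "e > 0"
      then show "norm (D h) \<le> L * norm h + e"
        using main[OF False, of "e / norm h"] False by simp
    qed
  qed (simp add: zero)
qed

text \<open>The set where a continuous function exceeds its essential supremum is open and null,
  hence empty. The bound \<open>B\<close> excludes an infinite essential supremum, which
  \<open>real_of_ereal\<close> would turn into 0.\<close>

lemma norm_le_Linf_norm:
  assumes adm: "admissible_domain \<Omega>" and cont: "continuous_on (region \<Omega>) f"
    and B: "\<And>x. x \<in> region \<Omega> \<Longrightarrow> norm (f x) \<le> B" and x: "x \<in> region \<Omega>"
  shows "norm (f x) \<le> Linf_norm \<Omega> f"
proof -
  let ?U = "region \<Omega>" and ?M = "restrict_space lborel (region \<Omega>)"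
  let ?E = "esssup ?M (\<lambda>x. ereal (norm (f x)))"
  note U = open_region[OF adm]
  have "(\<lambda>x. norm (f x)) \<in> borel_measurable (restrict_space borel ?U)"
    by (intro borel_measurable_continuous_on_restrict continuous_intros cont)
  then have "(\<lambda>x. norm (f x)) \<in> borel_measurable ?M"
  proof -
    have "borel_measurable ?M = borel_measurable (restrict_space borel ?U)"
      by (rule measurable_cong_sets) (simp_all add: sets_restrict_space_cong[of lborel borel])
    then show "(\<lambda>x. norm (f x)) \<in> borel_measurable (restrict_space borel ?U) \<Longrightarrow> ?thesis" by simp
  qed
  then have meas: "(\<lambda>x. ereal (norm (f x))) \<in> borel_measurable ?M" by simp
  have "?E \<le> ereal B"
    using B by (intro esssup_I meas AE_I2) (auto simp: space_restrict_space)
  have AE: "AE y in lborel. y \<in> ?U \<longrightarrow> ereal (norm (f y)) \<le> ?E"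
  proof -
    have "AE y in ?M. ereal (norm (f y)) \<le> ?E" by (rule esssup_AE)
    then show ?thesis using U by (subst (asm) AE_restrict_space_iff) auto
  qed
  have ge: "ereal (norm (f x)) \<le> ?E"
  proof (rule ccontr)
    assume "\<not> ereal (norm (f x)) \<le> ?E"
    then have "?E < ereal (norm (f x))" by simp
    from ereal_dense2[OF this] obtain e where e: "?E < ereal e" "ereal e < ereal (norm (f x))" by blast
    let ?V = "?U \<inter> (\<lambda>y. norm (f y)) -` {e<..}"
    have "open ?V" by (intro continuous_open_preimage continuous_intros cont U)
    moreover have "AE y in lborel. y \<notin> ?V"
      using AE
    proof eventually_elim
      case (elim y)
      show ?case
      proof
        assume "y \<in> ?V"
        then have "ereal (norm (f y)) \<le> ?E" "ereal e < ereal (norm (f y))" using elim by auto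
        then show False using e(1) by (metis less_trans not_le)
      qed
    qed
    ultimately have "?V = {}" by (rule AE_notin_open_empty)
    then show False using x e(2) by auto
  qed
  then have "?E = ereal (Linf_norm \<Omega> f)"
    unfolding Linf_norm_def using \<open>?E \<le> ereal B\<close> by (cases ?E) auto
  then show ?thesis using ge by simp
qed

text \<open>The differential equation is solved for a Lipschitz extension \<open>v\<close> on the
  whole space. By continuity \<open>v\<close> equals \<open>u\<close> up to the closure, so
  impermeability makes \<open>v\<close> tangent to the frontier and the solution remains in the
  region, where it is a trajectory of \<open>u\<close>. Without a boundary the frontier is empty and
  the tangency condition is vacuous.\<close>

lemma trajectory_through_point:
  fixes u :: "real \<Rightarrow> real^3 \<Rightarrow> real^3"
  assumes adm: "admissible_domain \<Omega>" and s: "s > 9/2" and T: "T \<ge> 0"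
    and C0: "C0_Hs {0..T} \<Omega> s u"
    and rep: "\<forall>t\<in>{0..T}. continuous_representative \<Omega> (u t)"
    and imp: "\<forall>t\<in>{0..T}. impermeable \<Omega> (u t)" and x: "x \<in> region \<Omega>"
  obtains \<gamma> where "\<gamma> T = x" "\<forall>t\<in>{0..T}. \<gamma> t \<in> region \<Omega>"
    "\<forall>t\<in>{0..T}. (\<gamma> has_vector_derivative u t (\<gamma> t)) (at t within {0..T})"
proof -
  let ?U = "region \<Omega>" and ?J = "{0..T}"
  have contc: "\<forall>t\<in>?J. continuous_on (closure ?U) (u t)"
    using rep by (simp add: continuous_representative_def)
  then have cont: "\<forall>t\<in>?J. continuous_on ?U (u t)"
    by (auto intro: continuous_on_subset[OF _ closure_subset])
  obtain L where L: "L \<ge> 0" "\<And>t x y. t \<in> ?J \<Longrightarrow> x \<in> ?U \<Longrightarrow> y \<in> ?U \<Longrightarrow> norm (u t x - u t y) \<le> L * norm (x - y)"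
    by (rule uniformly_lipschitz_in_time[OF adm s C0 cont compact_Icc]) (rule that)
  have unif: "\<forall>\<^sub>F \<tau> in at t within ?J. \<forall>x\<in>?U. norm (u \<tau> x - u t x) \<le> e" if "t \<in> ?J" "e > 0" for t e
  proof -
    have "e / 3 > 0" using that by simp
    from eventually_uniform_in_time[OF adm s C0 cont that(1) this] show ?thesis
    proof eventually_elim
      case (elim \<tau>)
      show ?case
      proof
        fix x assume "x \<in> ?U"
        then have "\<bar>(u \<tau> x - u t x) $ i\<bar> \<le> e / 3" for i using elim by simp
        from norm_le_of_components[OF this] show "norm (u \<tau> x - u t x) \<le> e" by simp
      qed
    qed
  qed
  obtain v K where v: "K \<ge> 0" "\<And>t x. t \<in> ?J \<Longrightarrow> x \<in> ?U \<Longrightarrow> v t x = u t x"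
    "\<And>t x y. t \<in> ?J \<Longrightarrow> norm (v t x - v t y) \<le> K * norm (x - y)"
    "continuous_on (?J \<times> UNIV) (\<lambda>(t, x). v t x)"
  proof (rule exists_lipschitz_extension[of ?U L ?J u])
    show "?U \<noteq> {}" using x by blast
    show "norm (u t x - u t y) \<le> L * norm (x - y)" if "t \<in> ?J" "x \<in> ?U" "y \<in> ?U" for t x y
      by (rule L(2)[OF that])
    show "\<forall>\<^sub>F \<tau> in at t within ?J. \<forall>x\<in>?U. norm (u \<tau> x - u t x) \<le> e" if "t \<in> ?J" "e > 0" for t e
      by (rule unif[OF that])
  qed (rule L(1), rule that)
  obtain \<gamma> where \<gamma>: "\<gamma> T = x" "\<And>t. t \<in> ?J \<Longrightarrow> (\<gamma> has_vector_derivative v t (\<gamma> t)) (at t within ?J)"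
    using Picard_Lindelof_backward[OF T v(4,1,3), of x] by blast
  have closure_eq: "v t q = u t q" if t: "t \<in> ?J" and q: "q \<in> closure ?U" for t q
  proof -
    have "continuous_on UNIV (v t)"
      using v(1) v(3)[OF t] by (intro lipschitz_on_continuous_on[of K] lipschitz_onI) (auto simp: dist_norm)
    then have "continuous_on (closure ?U) (\<lambda>y. v t y - u t y)"
      using contc t by (intro continuous_intros) (auto intro: continuous_on_subset)
    then have "v t q - u t q = 0"
      by (rule continuous_constant_on_closure[OF _ _ q]) (simp add: v(2)[OF t])
    then show ?thesis by simp
  qed
  have tan: "v t q \<bullet> n = 0" if "t \<in> ?J" "q \<in> frontier ?U" "outward_unit_normal ?U q n" for t q n
  proof -
    have "u t q \<bullet> n = 0" using imp that by (cases \<Omega>) (auto simp: frontier_UNIV)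
    then show ?thesis using closure_eq[OF that(1)] that(2) by (simp add: frontier_def)
  qed
  have reg: "\<exists>\<rho>. local_defining_function ?U p \<rho>" if "p \<in> frontier ?U" for p
    using adm that by (cases \<Omega>) (auto simp: bounded_regular_domain_def frontier_UNIV)
  have inside: "\<gamma> t \<in> ?U" if "t \<in> ?J" for t
    by (rule flow_stays_inside[OF open_region[OF adm] reg v(4,1,3) tan \<gamma>(2) _ that]) (use \<gamma>(1) x in auto)
  show ?thesis
    by (rule that[of \<gamma>, OF \<gamma>(1)]) (use inside \<gamma>(2) v(2) in auto)
qed

theorem proposition1:
  fixes \<Omega> :: fluid_domain and Tstar :: ereal and s :: real
    and u :: "real \<Rightarrow> real^3 \<Rightarrow> real^3" and P :: "real \<Rightarrow> real^3 \<Rightarrow> real"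
  assumes "admissible_domain \<Omega>"
    and "0 < Tstar"
    and "s > 9/2"
    and "\<And>T. T \<in> lifespan Tstar \<Longrightarrow> C0_Hs {0..T} \<Omega> s u \<and> C1_Hs {0..T} \<Omega> (s - 1) u"
    and "\<And>t. t \<in> lifespan Tstar \<Longrightarrow> continuous_representative \<Omega> (u t)"
    and "euler_solution \<Omega> Tstar u P"
    and "\<And>t. t \<in> lifespan Tstar \<Longrightarrow> impermeable \<Omega> (u t)"
    and "\<exists>x\<in>region \<Omega>. vorticity u 0 x \<noteq> 0"
  shows "\<forall>T\<in>lifespan Tstar.
    ereal (1 / sqrt (Linf_norm \<Omega> (vorticity u 0))) *
      (SUP x\<in>region \<Omega>. ereal (sqrt (norm (vorticity u T x)))) \<le> amplitude_growth \<Omega> u T"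
proof
  fix T assume T: "T \<in> lifespan Tstar"
  let ?U = "region \<Omega>" and ?J = "{0..T}"
  have T0: "T \<ge> 0" using T by (simp add: lifespan_def)
  note J = lifespan_Icc_subset[OF T]
  note adm = assms(1) and s = assms(3) and euler = assms(6)
  have C0: "C0_Hs ?J \<Omega> s u" and C1: "C1_Hs ?J \<Omega> (s - 1) u" using assms(4)[OF T] by auto
  have rep: "\<forall>t\<in>?J. continuous_representative \<Omega> (u t)" and imp: "\<forall>t\<in>?J. impermeable \<Omega> (u t)"
    using assms(5,7) J by auto
  have cont: "\<forall>t\<in>?J. continuous_on ?U (u t)"
    using rep by (auto simp: continuous_representative_def intro: continuous_on_subset[OF _ closure_subset])
  obtain L where L: "L \<ge> 0" "\<And>t x y. t \<in> ?J \<Longrightarrow> x \<in> ?U \<Longrightarrow> y \<in> ?U \<Longrightarrow> norm (u t x - u t y) \<le> L * norm (x - y)"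
    by (rule uniformly_lipschitz_in_time[OF adm s C0 cont compact_Icc]) (rule that)
  have AL: "norm (vel_grad u t x *v h) \<le> L * norm h" if t: "t \<in> ?J" and x: "x \<in> ?U" for t x h
  proof (rule derivative_le_lipschitz[OF open_region[OF adm] x])
    show "(u t has_derivative (\<lambda>h. vel_grad u t x *v h)) (at x)"
      using euler t J x unfolding euler_solution_def vel_grad_def by (subst jacobian_works[symmetric]) blast
    show "norm (u t y - u t x) \<le> L * norm (y - x)" if "y \<in> ?U" for y by (rule L(2)[OF t that x])
  qed
  define \<omega>0 where "\<omega>0 = Linf_norm \<Omega> (vorticity u 0)"
  have \<omega>0: "norm (vorticity u 0 x) \<le> \<omega>0" if x: "x \<in> ?U" for x
    unfolding \<omega>0_def
  proof (rule norm_le_Linf_norm[OF adm _ _ x])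
    have 0: "0 \<in> ?J" using T0 by simp
    have "in_Hs_vec \<Omega> s (u 0)" using C0 0 by (simp add: C0_Hs_def)
    then have "(\<lambda>y. vel_grad u 0 y $ i $ j) differentiable (at x)" if "x \<in> ?U" for i j x
      using Hs_gradient_differentiable[OF adm s _ cont[rule_format, OF 0] that] by (simp add: vel_grad_def)
    then have c: "continuous_on ?U (\<lambda>y. vel_grad u 0 y $ i $ j)" for i j
      by (meson continuous_at_imp_continuous_on differentiable_imp_continuous_within)
    have "continuous_on ?U (\<lambda>x. \<chi> i. vorticity u 0 x $ i)"
    proof (rule continuous_on_vec_lambda)
      fix i :: 3
      show "continuous_on ?U (\<lambda>x. vorticity u 0 x $ i)"
        using exhaust_3[of i] by (auto simp: vorticity_def Let_def vector_3 intro!: continuous_on_diff c)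
    qed
    then show "continuous_on ?U (vorticity u 0)" by simp
    fix y assume y: "y \<in> ?U"
    \<comment> \<open>A finite bound for the initial vorticity, as \<open>norm_le_Linf_norm\<close>
      demands: entries of the gradient are at most \<open>L\<close>, components of the curl at most
      \<open>2 * L\<close>, and three components give \<open>6 * L\<close>.\<close>
    have lA: "\<bar>vel_grad u 0 y $ i $ j\<bar> \<le> L" for i j
    proof -
      have "vel_grad u 0 y $ i $ j = (vel_grad u 0 y *v axis j 1) $ i"
        by (simp add: matrix_vector_mul_component inner_axis)
      then show ?thesis
        using component_le_norm_cart[of "vel_grad u 0 y *v axis j 1" i] AL[OF 0 y, of "axis j 1"] by simp
    qed
    have *: "\<bar>vel_grad u 0 y $ i $ j - vel_grad u 0 y $ k $ l\<bar> \<le> 2 * L" for i j k l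
      using lA[of i j] lA[of k l] by linarith
    have "\<bar>vorticity u 0 y $ i\<bar> \<le> 2 * L" for i
      using exhaust_3[of i] * by (auto simp: vorticity_def Let_def vector_3)
    from norm_le_of_components[OF this] show "norm (vorticity u 0 y) \<le> 6 * L" by simp
  qed
  \<comment> \<open>Otherwise the pointwise bound would force the initial vorticity to vanish
    everywhere.\<close>
  have pos: "\<omega>0 > 0" using assms(8) \<omega>0 by (metis norm_le_zero_iff not_le order_trans)
  have bound: "ereal (1 / sqrt \<omega>0) * ereal (sqrt (norm (vorticity u T x))) \<le> amplitude_growth \<Omega> u T"
    if x: "x \<in> ?U" for x
  proof -
    obtain \<gamma> where \<gamma>: "\<gamma> T = x" "\<forall>t\<in>?J. \<gamma> t \<in> ?U"
      "\<forall>t\<in>?J. (\<gamma> has_vector_derivative u t (\<gamma> t)) (at t within ?J)"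
      by (rule trajectory_through_point[OF adm s T0 C0 rep imp x]) (rule that)
    have tr: "trace (vel_grad u t (\<gamma> t)) = 0" if "t \<in> ?J" for t
      using euler J \<gamma>(2) that unfolding euler_solution_def by blast
    have AL': "norm (vel_grad u t (\<gamma> t) *v h) \<le> L * norm h" if "t \<in> ?J" for t h
      using AL that \<gamma>(2) by blast
    have contA: "continuous_on ?J (\<lambda>t. vel_grad u t (\<gamma> t) $ i $ j)" for i j
      using vel_grad_continuous_along[OF adm s T _ C0 C1 cont euler \<gamma>(2,3)]
      by (simp add: continuous_on_eq_continuous_within)
    have W: "((\<lambda>\<tau>. vorticity u \<tau> (\<gamma> \<tau>)) has_vector_derivative
        vel_grad u t (\<gamma> t) *v vorticity u t (\<gamma> t)) (at t within ?J)" if "t \<in> ?J" for t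
      by (rule vorticity_transport_equation[OF adm s T that C0 C1 cont euler \<gamma>(2,3)])
    obtain \<xi> b where \<xi>: "\<And>t. t \<in> ?J \<Longrightarrow> (\<xi> has_vector_derivative - (transpose (vel_grad u t (\<gamma> t)) *v \<xi> t)) (at t within ?J)"
      and b: "\<And>t. t \<in> ?J \<Longrightarrow> (b has_vector_derivative - (vel_grad u t (\<gamma> t) *v b t)
        + (2 * (\<xi> t \<bullet> (vel_grad u t (\<gamma> t) *v b t)) / (norm (\<xi> t))\<^sup>2) *\<^sub>R \<xi> t) (at t within ?J)"
      and init: "norm (b 0) = 1" "norm (\<xi> 0) = 1" "b 0 \<bullet> \<xi> 0 = 0"
      and est: "norm (vorticity u T (\<gamma> T)) \<le> norm (vorticity u 0 (\<gamma> 0)) * (norm (b T))\<^sup>2"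
    proof (rule amplitude_controls_vorticity[of T L "\<lambda>t. vel_grad u t (\<gamma> t)" "\<lambda>t. vorticity u t (\<gamma> t)"])
      show "trace (vel_grad u t (\<gamma> t)) = 0" if "t \<in> ?J" for t by (rule tr[OF that])
      show "norm (vel_grad u t (\<gamma> t) *v h) \<le> L * norm h" if "t \<in> ?J" for t h by (rule AL'[OF that])
      show "continuous_on ?J (\<lambda>t. vel_grad u t (\<gamma> t) $ i $ j)" for i j by (rule contA)
      show "((\<lambda>\<tau>. vorticity u \<tau> (\<gamma> \<tau>)) has_vector_derivative
        vel_grad u t (\<gamma> t) *v vorticity u t (\<gamma> t)) (at t within ?J)" if "t \<in> ?J" for t by (rule W[OF that])
    qed (rule T0, rule L(1), rule that)
    have sol: "bichar_amplitude_solution \<Omega> u T \<gamma> \<xi> b"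
      unfolding bichar_amplitude_solution_def Let_def using \<gamma>(2,3) \<xi> b by blast
    have "norm (vorticity u T x) \<le> \<omega>0 * (norm (b T))\<^sup>2"
      using est \<gamma>(1,2) T0 mult_right_mono[OF \<omega>0[of "\<gamma> 0"], of "(norm (b T))\<^sup>2"] by auto
    then have "sqrt (norm (vorticity u T x)) \<le> sqrt (\<omega>0 * (norm (b T))\<^sup>2)" by simp
    then have "1 / sqrt \<omega>0 * sqrt (norm (vorticity u T x)) \<le> norm (b T)"
      using pos by (simp add: real_sqrt_mult pos_divide_le_eq mult.commute)
    then have "ereal (1 / sqrt \<omega>0) * ereal (sqrt (norm (vorticity u T x))) \<le> ereal (norm (b T))" by simp
    also have "\<dots> \<le> amplitude_growth \<Omega> u T"
      unfolding amplitude_growth_def using sol init by (intro Sup_upper) blast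
    finally show ?thesis .
  qed
  \<comment> \<open>Moving the factor into a supremum of extended reals requires a nonempty index
    set; the point of nonzero initial vorticity provides one.\<close>
  have "?U \<noteq> {}" using assms(8) by blast
  then have "ereal (1 / sqrt \<omega>0) * (SUP x\<in>?U. ereal (sqrt (norm (vorticity u T x))))
    = (SUP x\<in>?U. ereal (1 / sqrt \<omega>0) * ereal (sqrt (norm (vorticity u T x))))"
    using pos by (intro SUP_ereal_mult_left[symmetric]) auto
  also have "\<dots> \<le> amplitude_growth \<Omega> u T" by (intro SUP_least bound)
  finally show "ereal (1 / sqrt (Linf_norm \<Omega> (vorticity u 0))) *
      (SUP x\<in>?U. ereal (sqrt (norm (vorticity u T x)))) \<le> amplitude_growth \<Omega> u T"
    unfolding \<omega>0_def .
qed

end
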